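(* Let $n_1\le n_2$, let $\Phi:\mathbb{R}^{n_1\times n_2}\to\mathbb{R}^m$ be a linear operator, $\mu>0$, and let $h:\mathbb{R}^m\to\mathbb{R}\cup\{+\infty\}$ be proper convex, twice continuously differentiable in $\operatorname{int}(\operatorname{dom} h)$, with $\nabla^2h(\Phi X)$ positive definite for every $X\in\Phi^{-1}(\operatorname{int}(\operatorname{dom} h))$. Suppose that $\bar X\in\Phi^{-1}(\operatorname{int}(\operatorname{dom} h))$ is a minimizer of $$\min_{X\in\mathbb{R}^{n_1\times n_2}}\ h(\Phi X)+\mu\|X\|_* ,$$ and let $\bar Y=-\frac1\mu\Phi^*\nabla h(\Phi\bar X)\in\partial\|\bar X\|_*$, with $r=\operatorname{rank}(\bar X)$. Let $(U,V)\in\mathcal{O}(\bar X)$, written $U=(U_I\ U_J)$, $V=(V_I\ V_K)$ with $U_I,V_I$ the first $r$ columns, write $\bar Y=U\begin{pmatrix}\mathbb{I}_r & 0\\ 0 & \bar W\end{pmatrix}V^T$ with $\|\bar W\|\le 1$, let $\bar W=\hat U\Sigma\hat V^T$ be a full SVD (singular values in nonincreasing order), and put $\bar U=(U_I\ U_J\hat U)$, $\bar V=(V_I\ V_K\hat V)$, so that $(\bar U,\bar V)\in\mathcal{O}(\bar X)\cap\mathcal{O}(\bar Y)$. Let $E:=U_IV_I^T$, let $\mathbb{T}:=\{U_IY^T+XV_I^T\mid X\in\mathbb{R}^{n_1\times r},\,Y\in\mathbb{R}^{n_2\times r}\}$, and define $$\mathcal{E}:=\left\{W\in\mathbb{R}^{n_1\times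 n_2}\ \Big|\ P_{\mathbb{T}}W=\bar U\begin{pmatrix}A & B & 0\\ B^T & 0 & 0\\ 0 & 0 & 0\end{pmatrix}\bar V^T\text{ for some }A\in\mathbb{S}^r,\ B\in\mathbb{R}^{r\times(p(\bar Y)-r)}\right\},$$ $$\mathcal{C}:=\{W\in\mathbb{R}^{n_1\times n_2}\mid\langle E,W\rangle+\|P_{\mathbb{T}^\perp}W\|_*=0\}.$$ The following are equivalent: (i) $\bar X$ is a strong solution of the problem. (ii) $\operatorname{Ker}\Phi\cap\mathcal{E}\cap\mathcal{C}=\{0\}$. (iii) Condition (a) and either (b) or (c) hold, where: (a) (Strong Restricted Injectivity) $\operatorname{Ker}\Phi\cap\mathcal{E}\cap\mathbb{T}=\{0\}$; (b) (Strong Nondegenerate Source Condition) there exists $Y\in\operatorname{Im}\Phi^*+\mathcal{E}^\perp$ such that $Y=U\begin{pmatrix}\mathbb{I}_r & 0\\ 0 & Z\end{pmatrix}V^T$ with $\|Z\|<1$; (c) (Analysis Strong Source Condition) the optimal value $\zeta(\bar X)$ of $$\min_{Z\in\mathbb{R}^{(n_1-r)\times(n_2-r)}}\ \|Z\|\quad\text{subject to}\quad\mathcal{M}(U_JZV_K^T)=-\mathcal{M}E$$ is smaller than $1$, where $\mathcal{M}$ is a linear operator such that $\operatorname{Im}\mathcal{M}^*=\operatorname{Ker}\Phi\cap\mathcal{E}$. (Here (iii) means: (a) together with (b), or, equivalently, (a) together with (c).)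
   Context: $\mathbb{R}^{n_1\times n_2}$ carries the inner product $\langle X,Y\rangle=\operatorname{Tr}(X^TY)$ with Frobenius norm $\|\cdot\|_F$; $\|\cdot\|_*$ is the nuclear norm, $\|\cdot\|$ the spectral norm, $\sigma_1(X)\ge\dots\ge\sigma_{n_1}(X)$ the singular values. $\mathcal{O}(X)$ is the set of pairs $(U,V)$ of orthogonal matrices ($n_1\times n_1$ and $n_2\times n_2$) such that $X=U\,\mathrm{Diag}(\sigma(X))\,V^T$, where $\mathrm{Diag}(\sigma(X))$ is the $n_1\times n_2$ matrix with the singular values in nonincreasing order on the diagonal and zeros elsewhere. $p(\bar Y)=\#\{i\mid\sigma_i(\bar Y)=1\}$. $\mathbb{S}^r$ denotes symmetric $r\times r$ matrices; $\mathbb{I}_r$ the identity. $P_{\mathbb{T}}$, $P_{\mathbb{T}^\perp}$ are the orthogonal projections onto $\mathbb{T}$ and its orthogonal complement. The subdifferential of the nuclear norm is $\partial\|\bar X\|_*=\{U\begin{pmatrix}\mathbb{I}_r & 0\\ 0 & W\end{pmatrix}V^T\mid\|W\|\le1\}$ for any $(U,V)\in\mathcal{O}(\bar X)$. $\bar X$ is a strong solution of $\min\varphi$ if there exist $c,\varepsilon>0$ with $\varphi(X)-\varphi(\bar X)\ge c\|X-\bar X\|_F^2$ for all $X$ with $\|X-\bar X\|_F\le\varepsilon$. *)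

theory Defs
  imports "HOL-Analysis.Analysis" "Jordan_Normal_Form.Char_Poly"
begin

text \<open>
  The ambient space is \<open>real ^ 'n2 ^ 'n1\<close>: its library inner product is
  \<open>Tr (X\<^sup>T Y)\<close> and its library norm is the Frobenius norm. Factors and blocks whose
  sizes depend on the rank are matrices \<^typ>\<open>real mat\<close> with explicit dimensions.
\<close>

no_notation Matrix.vec_index (infixl \<open>$\<close> 100)
no_notation Matrix.scalar_prod (infix \<open>\<bullet>\<close> 70)
unbundle inner_syntax and vec_syntax

type_synonym ('m, 'n) rmatrix = "real ^ 'n ^ 'm"

text \<open>The order of the index type numbers the rows and columns as 0, 1, 2, \<dots>\<close>

definition pos :: "'n::{finite,linorder} \<Rightarrow> nat" where
  "pos i = card {..<i}"

definition to_mat :: "('n1::{finite,linorder}, 'n2::{finite,linorder}) rmatrix \<Rightarrow> real mat" where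
  "to_mat X = Matrix.mat CARD('n1) CARD('n2) (\<lambda>(k, l). X $ inv_into UNIV pos k $ inv_into UNIV pos l)"

definition of_mat :: "real mat \<Rightarrow> ('n1::{finite,linorder}, 'n2::{finite,linorder}) rmatrix" where
  "of_mat A = (\<chi> i j. A $$ (pos i, pos j))"

text \<open>
  Square roots of the eigenvalues of \<open>A A\<^sup>T\<close> with multiplicity, in nonincreasing order.
  There are \<^term>\<open>dim_row A\<close> of them, so this is the usual notion for
  \<^prop>\<open>dim_row A \<le> dim_col A\<close>; \<open>\<sigma>\<^sub>i\<close> is the entry with index \<open>i - 1\<close>.
\<close>

definition singular_values :: "real mat \<Rightarrow> real list" where
  "singular_values A =
     rev (sorted_list_of_multiset (image_mset sqrt (proots (char_poly (A * A\<^sup>T)))))"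

definition nuclear_norm :: "('n1::{finite,linorder}, 'n2::{finite,linorder}) rmatrix \<Rightarrow> real" where
  "nuclear_norm X = sum_list (singular_values (to_mat X))"

text \<open>The unit ball, rather than the unit sphere, gives norm 0 to matrices without columns.\<close>

definition spectral_norm :: "real mat \<Rightarrow> real" where
  "spectral_norm A =
     (SUP x \<in> {x \<in> carrier_vec (dim_col A). scalar_prod x x \<le> 1}.
        sqrt (scalar_prod (A *\<^sub>v x) (A *\<^sub>v x)))"

definition orthogonal_mats :: "nat \<Rightarrow> real mat set" where
  "orthogonal_mats n = {U \<in> carrier_mat n n. U\<^sup>T * U = 1\<^sub>m n}"

definition Diag :: "nat \<Rightarrow> nat \<Rightarrow> real list \<Rightarrow> real mat" where
  "Diag m n xs = Matrix.mat m n (\<lambda>(i, j). if i = j then xs ! i else 0)"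

text \<open>The set \<open>\<O>(A)\<close> of pairs of orthogonal factors of ordered full SVDs of \<open>A\<close>.\<close>

definition SVD_pairs :: "real mat \<Rightarrow> (real mat \<times> real mat) set" where
  "SVD_pairs A = {(U, V). U \<in> orthogonal_mats (dim_row A) \<and> V \<in> orthogonal_mats (dim_col A) \<and>
     A = U * Diag (dim_row A) (dim_col A) (singular_values A) * V\<^sup>T}"

definition num_unit_sv :: "('n1::{finite,linorder}, 'n2::{finite,linorder}) rmatrix \<Rightarrow> nat" where
  "num_unit_sv Y = card {i. i < CARD('n1) \<and> singular_values (to_mat Y) ! i = 1}"

definition first_cols :: "nat \<Rightarrow> real mat \<Rightarrow> real mat" where
  "first_cols r U = mat_of_cols (dim_row U) (take r (cols U))"

definition other_cols :: "nat \<Rightarrow> real mat \<Rightarrow> real mat" where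
  "other_cols r U = mat_of_cols (dim_row U) (drop r (cols U))"

definition append_cols :: "real mat \<Rightarrow> real mat \<Rightarrow> real mat" where
  "append_cols A B = mat_of_cols (dim_row A) (cols A @ cols B)"

definition id_block :: "nat \<Rightarrow> real mat \<Rightarrow> real mat" where
  "id_block r W = four_block_mat (1\<^sub>m r) (0\<^sub>m r (dim_col W)) (0\<^sub>m (dim_row W) r) W"

text \<open>The \<open>m \<times> n\<close> matrix \<open>(A, B, 0; B\<^sup>T, 0, 0; 0, 0, 0)\<close>, where \<open>A\<close> is \<open>r \<times> r\<close> and
  \<open>B\<close> is \<open>r \<times> (p - r)\<close>.\<close>

definition ABBT_block :: "nat \<Rightarrow> nat \<Rightarrow> nat \<Rightarrow> nat \<Rightarrow> real mat \<Rightarrow> real mat \<Rightarrow> real mat" where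
  "ABBT_block m n r p A B =
     four_block_mat
       (four_block_mat A B (B\<^sup>T) (0\<^sub>m (p - r) (p - r))) (0\<^sub>m p (n - p))
       (0\<^sub>m (m - p) p) (0\<^sub>m (m - p) (n - p))"

definition orth_proj :: "'a::euclidean_space set \<Rightarrow> 'a \<Rightarrow> 'a" where
  "orth_proj S x = (THE y. y \<in> S \<and> x - y \<in> S\<^sup>\<bottom>)"

definition set_T :: "nat \<Rightarrow> real mat \<Rightarrow> real mat \<Rightarrow>
    ('n1::{finite,linorder}, 'n2::{finite,linorder}) rmatrix set" where
  "set_T r UI VI = {of_mat (UI * Y\<^sup>T + X * VI\<^sup>T) | X Y.
     X \<in> carrier_mat CARD('n1) r \<and> Y \<in> carrier_mat CARD('n2) r}"

definition set_E :: "('n1, 'n2) rmatrix set \<Rightarrow> nat \<Rightarrow> nat \<Rightarrow> real mat \<Rightarrow> real mat \<Rightarrow>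
    ('n1::{finite,linorder}, 'n2::{finite,linorder}) rmatrix set" where
  "set_E T r p Ub Vb = {W. \<exists>A B. A \<in> carrier_mat r r \<and> A\<^sup>T = A \<and> B \<in> carrier_mat r (p - r) \<and>
     orth_proj T W = of_mat (Ub * ABBT_block CARD('n1) CARD('n2) r p A B * Vb\<^sup>T)}"

definition set_C :: "('n1, 'n2) rmatrix set \<Rightarrow> ('n1, 'n2) rmatrix \<Rightarrow>
    ('n1::{finite,linorder}, 'n2::{finite,linorder}) rmatrix set" where
  "set_C T E = {W. E \<bullet> W + nuclear_norm (orth_proj (T\<^sup>\<bottom>) W) = 0}"

definition effective_domain :: "('a \<Rightarrow> ereal) \<Rightarrow> 'a set" where
  "effective_domain h = {x. h x < \<infinity>}"

definition proper_convex :: "('a::real_vector \<Rightarrow> ereal) \<Rightarrow> bool" where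
  "proper_convex h \<longleftrightarrow> (\<forall>x. h x \<noteq> -\<infinity>) \<and> effective_domain h \<noteq> {} \<and>
     (\<forall>x y t. 0 < t \<and> t < 1 \<longrightarrow>
        h ((1 - t) *\<^sub>R x + t *\<^sub>R y) \<le> ereal (1 - t) * h x + ereal t * h y)"

text \<open>\<open>f\<close> is twice continuously differentiable on the open set \<open>S\<close>, with gradient \<open>g\<close> and
  Hessian \<open>H\<close>; both are determined by \<open>f\<close> on \<open>S\<close> and unconstrained elsewhere.\<close>

definition C2_on :: "(real ^ 'm) set \<Rightarrow> (real ^ 'm \<Rightarrow> real) \<Rightarrow> (real ^ 'm \<Rightarrow> real ^ 'm) \<Rightarrow>
    (real ^ 'm \<Rightarrow> real ^ 'm ^ 'm) \<Rightarrow> bool" where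
  "C2_on S f g H \<longleftrightarrow> (\<forall>x\<in>S. GDERIV f x :> g x) \<and>
     (\<forall>x\<in>S. (g has_derivative (\<lambda>v. H x *v v)) (at x)) \<and> continuous_on S H"

definition positive_definite :: "real ^ 'm ^ 'm \<Rightarrow> bool" where
  "positive_definite A \<longleftrightarrow> transpose A = A \<and> (\<forall>v. v \<noteq> 0 \<longrightarrow> v \<bullet> (A *v v) > 0)"

definition objective :: "(('n1, 'n2) rmatrix \<Rightarrow> 'b) \<Rightarrow> ('b \<Rightarrow> ereal) \<Rightarrow> real \<Rightarrow>
    ('n1::{finite,linorder}, 'n2::{finite,linorder}) rmatrix \<Rightarrow> ereal" where
  "objective \<Phi> h \<mu> X = h (\<Phi> X) + ereal (\<mu> * nuclear_norm X)"

text \<open>Finiteness at the reference point is implicit in the notion of a solution; it is stated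
  because \<open>\<infinity> - \<infinity> = \<infinity>\<close> in \<^typ>\<open>ereal\<close>.\<close>

definition strong_solution :: "('a::real_normed_vector \<Rightarrow> ereal) \<Rightarrow> 'a \<Rightarrow> bool" where
  "strong_solution \<phi> xb \<longleftrightarrow> \<bar>\<phi> xb\<bar> \<noteq> \<infinity> \<and>
     (\<exists>c>0. \<exists>\<epsilon>>0. \<forall>x. norm (x - xb) \<le> \<epsilon> \<longrightarrow> \<phi> x - \<phi> xb \<ge> ereal (c * (norm (x - xb))\<^sup>2))"

definition Ker :: "('a \<Rightarrow> 'b::zero) \<Rightarrow> 'a set" where
  "Ker f = {x. f x = 0}"

definition strong_restricted_injectivity ::
    "('a::zero \<Rightarrow> 'b::zero) \<Rightarrow> 'a set \<Rightarrow> 'a set \<Rightarrow> bool" where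
  "strong_restricted_injectivity \<Phi> \<E> T \<longleftrightarrow> Ker \<Phi> \<inter> \<E> \<inter> T = {0}"

definition strong_nondegenerate_source ::
    "(('n1::{finite,linorder}, 'n2::{finite,linorder}) rmatrix \<Rightarrow> 'b::real_inner) \<Rightarrow>
     ('n1, 'n2) rmatrix set \<Rightarrow> nat \<Rightarrow> real mat \<Rightarrow> real mat \<Rightarrow> bool" where
  "strong_nondegenerate_source \<Phi> \<E> r U V \<longleftrightarrow>
     (\<exists>Y \<in> {a + b | a b. a \<in> range (adjoint \<Phi>) \<and> b \<in> \<E>\<^sup>\<bottom>}.
      \<exists>Z \<in> carrier_mat (CARD('n1) - r) (CARD('n2) - r).
        Y = of_mat (U * id_block r Z * V\<^sup>T) \<and> spectral_norm Z < 1)"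

text \<open>The optimal value is \<open>\<infinity>\<close> if no matrix is feasible.\<close>

definition zeta :: "(('n1::{finite,linorder}, 'n2::{finite,linorder}) rmatrix \<Rightarrow> 'q::real_vector) \<Rightarrow>
     ('n1, 'n2) rmatrix \<Rightarrow> nat \<Rightarrow> real mat \<Rightarrow> real mat \<Rightarrow> ereal" where
  "zeta M E r UJ VK =
     (INF Z \<in> {Z \<in> carrier_mat (CARD('n1) - r) (CARD('n2) - r).
                M (of_mat (UJ * Z * VK\<^sup>T)) = - M E}. ereal (spectral_norm Z))"

end

theory Submission
  imports Defs
begin

text \<open>
  Let \<open>K\<close> be the normal cone to the spectral unit ball at \<open>Yb\<close>. In the bases given by the columns
  of \<open>Ub\<close> and \<open>Vb\<close> it consists of the positive semidefinite blocks of size \<open>p\<close>, and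
  the gap \<open>\<parallel>X\<parallel>\<^sub>* - \<langle>Yb, X\<rangle>\<close> is nonnegative and vanishes exactly on \<open>K\<close>. On \<open>Ker \<Phi>\<close>, which is
  orthogonal to \<open>Yb\<close>, the set \<open>\<E> \<inter> \<C>\<close> is the tangent cone to \<open>K\<close> at \<open>Xb\<close>.

  A tangent direction in \<open>Ker \<Phi>\<close> is realised by a curve in \<open>K\<close> with a correction of order \<open>t\<^sup>2\<close>. Along it
  the gap vanishes and the remainder of \<open>h\<close> is \<open>o(t\<^sup>2)\<close>, so there is no quadratic growth.
  Conversely, if quadratic growth fails, normalised increments have a limit \<open>W\<close> in \<open>Ker \<Phi>\<close> along
  which the gap is \<open>o(t\<^sup>2)\<close>. Testing the nuclear norm against \<open>Yb + t N\<close>, rescaled into the unit ball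
  by a factor \<open>1 + O(t\<^sup>2)\<close>, gives \<open>\<langle>N, W\<rangle> \<le> 0\<close> for sufficiently many \<open>N\<close> to force \<open>W\<close> into the tangent
  cone.

  The equivalence with the source conditions is a separation argument: on \<open>Ker \<Phi> \<inter> \<E>\<close> the function
  \<open>\<langle>E, W\<rangle> + \<parallel>P\<^bsub>T\<bottom>\<^esub> W\<parallel>\<^sub>*\<close> is nonnegative and is the support function of the matrices \<open>E + N\<close> with \<open>N\<close>
  in the closed unit ball of \<open>T\<^sup>\<bottom>\<close>.
\<close>

text \<open>Singular values enter only through trace duality (\<open>inner_le_nuclear_norm\<close>,
  \<open>nuclear_norm_attained\<close>), without perturbation theory of eigenvalues. Blocks whose
  size depends on the rank become index ranges of coordinates in the two singular bases. The tests
  \<open>N\<close> form three families: antisymmetric pairs in the leading \<open>p\<close> by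
  \<open>p\<close> block force symmetry, single entries outside it force zeros, negated rank-one
  forms force semidefiniteness. The second family is the reason for the factor 1 + O(t^2): such an
  \<open>N\<close> involves a direction in which \<open>Ybar\<close> contracts strictly, and Young's
  inequality absorbs the cross term into the slack 1 - sigma^2 there. An excess of order t^2 is not
  negligible at the scale of the gap, so tests use the step s t with s fixed, and s becomes small
  only after the limit in t. The correction of the curve is forced: where \<open>W\<close> couples
  the range of \<open>Xbar\<close> with its kernel, \<open>Xbar + t W\<close> may fail to be
  semidefinite by order t^2. Since the operator then moves only by O(t^2), first-order
  differentiability of \<open>h\<close> gives the o(t^2) remainder.\<close>

type_synonym 'n rvec = "real ^ 'n"

section \<open>Orthonormal bases and the spectral theorem\<close>

text \<open>Rayleigh quotient: a maximiser of \<open>x . f x\<close> on the unit sphere of an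
  invariant subspace is an eigenvector, and its orthogonal complement is again invariant. Working
  relative to \<open>S\<close> is what lets the induction on the dimension descend.\<close>

lemma selfadjoint_eigenbasis:
  fixes f :: "'a::euclidean_space \<Rightarrow> 'a"
  assumes lin: "linear f" and sa: "\<And>x y. f x \<bullet> y = x \<bullet> f y"
  shows "subspace S \<Longrightarrow> f ` S \<subseteq> S \<Longrightarrow>
    \<exists>B\<subseteq>S. finite B \<and> card B = dim S \<and> pairwise (\<lambda>x y. x \<bullet> y = 0) B \<and> (\<forall>b\<in>B. norm b = 1) \<and>
      (\<forall>b\<in>B. \<exists>l. f b = l *\<^sub>R b)"
proof (induction "dim S" arbitrary: S rule: less_induct)
  case less
  show ?case
  proof (cases "S = {0}")
    case True
    then show ?thesis by (intro exI[of _ "{}"]) auto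
  next
    case False
    have contf: "continuous_on A f" for A
      using lin linear_continuous_on linear_conv_bounded_linear by blast
    have "compact (sphere 0 1 \<inter> S)"
      by (simp add: closed_subspace compact_Int_closed less.prems(1))
    moreover have "sphere 0 1 \<inter> S \<noteq> {}"
    proof -
      obtain x where "x \<in> S" "x \<noteq> 0"
        using False less.prems(1) subspace_0 by blast
      then have "(1 / norm x) *\<^sub>R x \<in> sphere 0 1 \<inter> S"
        using less.prems(1) by (auto simp: subspace_scale)
      then show ?thesis by blast
    qed
    moreover have "continuous_on (sphere 0 1 \<inter> S) (\<lambda>x. x \<bullet> f x)"
      by (intro continuous_intros contf)
    ultimately obtain e where e: "e \<in> sphere 0 1 \<inter> S"
      and max: "\<And>x. x \<in> sphere 0 1 \<inter> S \<Longrightarrow> x \<bullet> f x \<le> e \<bullet> f e"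
      using continuous_attains_sup[of "sphere 0 1 \<inter> S" "\<lambda>x. x \<bullet> f x"] by blast
    have eS: "e \<in> S" and ne: "norm e = 1" using e by auto
    then have ee: "e \<bullet> e = 1" by (simp add: dot_square_norm)
    define l where "l = e \<bullet> f e"
    have quad: "x \<bullet> f x \<le> l * (x \<bullet> x)" if "x \<in> S" for x
    proof (cases "x = 0")
      case True
      then show ?thesis using lin by (simp add: linear_0)
    next
      case False
      have "(1 / norm x) *\<^sub>R x \<in> sphere 0 1 \<inter> S"
        using that False less.prems(1) by (auto simp: subspace_scale)
      from max[OF this] have "(x \<bullet> f x) / (norm x)\<^sup>2 \<le> l"
        by (simp add: l_def linear_scale[OF lin] power2_eq_square)
      then show ?thesis using False by (simp add: field_simps dot_square_norm)
    qed
    have fS: "f x \<in> S" if "x \<in> S" for x using that less.prems by blast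
    define g where "g = f e - l *\<^sub>R e"
    have gS: "g \<in> S" unfolding g_def
      using eS fS less.prems(1) by (simp add: subspace_diff subspace_scale)
    \<comment> \<open>first-order optimality of \<open>e\<close> in the direction \<open>g\<close>\<close>
    have "g \<bullet> g = 0"
    proof (rule ccontr)
      assume g0: "g \<bullet> g \<noteq> 0"
      then have gp: "g \<bullet> g > 0" using inner_ge_zero[of g] by linarith
      \<comment> \<open>\<open>k\<close> dominates the coefficient of the second-order term, so with
        \<open>s = g . g / k\<close> the loss is at most \<open>g . g\<close>, half of the
        first-order gain \<open>2 (g . g)\<close>.\<close>
      define k where "k = \<bar>l * (g \<bullet> g) - g \<bullet> f g\<bar> + 1"
      have kp: "k > 0" by (simp add: k_def)
      define s where "s = (g \<bullet> g) / k"
      have sp: "s > 0" using gp kp by (simp add: s_def)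
      have eg: "e \<bullet> g = 0"
        by (simp add: g_def inner_diff_right l_def ee)
      have "(e + s *\<^sub>R g) \<in> S" using eS gS less.prems(1) by (simp add: subspace_add subspace_scale)
      from quad[OF this]
      have "l + 2 * s * (g \<bullet> f e) + s\<^sup>2 * (g \<bullet> f g) \<le> l * (1 + s\<^sup>2 * (g \<bullet> g))"
        using sa[of e g] eg
        by (simp add: linear_add[OF lin] linear_scale[OF lin] inner_add_left inner_add_right
            ee l_def[symmetric] power2_eq_square inner_commute algebra_simps)
      moreover have "g \<bullet> f e = g \<bullet> g"
        using eg by (simp add: g_def inner_diff_right inner_diff_left inner_commute algebra_simps l_def ee)
      ultimately have "s * (2 * (g \<bullet> g)) \<le> s * (s * (l * (g \<bullet> g) - g \<bullet> f g))"
        by (simp add: power2_eq_square algebra_simps)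
      then have "2 * (g \<bullet> g) \<le> s * (l * (g \<bullet> g) - g \<bullet> f g)" using sp by simp
      also have "\<dots> \<le> s * k" using sp by (intro mult_left_mono) (auto simp: k_def)
      also have "\<dots> = g \<bullet> g" using kp by (simp add: s_def)
      finally show False using gp by simp
    qed
    then have fe: "f e = l *\<^sub>R e" by (simp add: g_def)
    define S' where "S' = {x \<in> S. e \<bullet> x = 0}"
    have sub: "subspace S'"
    proof -
      have "subspace {x. e \<bullet> x = 0}" by (rule subspace_hyperplane)
      then have "subspace (S \<inter> {x. e \<bullet> x = 0})" using less.prems(1) by (intro subspace_inter)
      moreover have "S' = S \<inter> {x. e \<bullet> x = 0}" by (auto simp: S'_def)
      ultimately show ?thesis by simp
    qed
    have dimS: "dim S' + 1 = dim S"
    proof -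
      have "dim {x \<in> S. \<forall>y\<in>span {e}. real_inner_class.orthogonal y x} + dim (span {e}) = dim S"
        using dim_subspace_orthogonal_to_vectors[of "span {e}" S] eS less.prems(1)
        by (simp add: span_minimal)
      moreover have "{x \<in> S. \<forall>y\<in>span {e}. real_inner_class.orthogonal y x} = S'"
        by (auto simp: S'_def span_singleton real_inner_class.orthogonal_def)
      moreover have "dim (span {e}) = 1" using ne by (auto simp: dim_span)
      ultimately show ?thesis by simp
    qed
    have inv: "f ` S' \<subseteq> S'"
    proof
      fix y assume "y \<in> f ` S'"
      then obtain x where x: "x \<in> S" "e \<bullet> x = 0" "y = f x" by (auto simp: S'_def)
      have "e \<bullet> f x = 0" using sa[of e x] x(2) by (simp add: fe real_inner_class.orthogonal_def)
      then show "y \<in> S'" using x fS by (simp add: S'_def)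
    qed
    obtain B where B: "B \<subseteq> S'" "finite B" "card B = dim S'" "pairwise (\<lambda>x y. x \<bullet> y = 0) B"
      "\<forall>b\<in>B. norm b = 1" "\<forall>b\<in>B. \<exists>l. f b = l *\<^sub>R b"
      using less.hyps[of S'] dimS sub inv by auto
    have "e \<notin> B" using B(1) ne by (auto simp: S'_def ee)
    moreover have "pairwise (\<lambda>x y. x \<bullet> y = 0) (insert e B)"
      using B(1,4) by (auto simp: pairwise_insert S'_def inner_commute)
    ultimately show ?thesis
      using B eS ne fe dimS by (intro exI[of _ "insert e B"]) (auto simp: S'_def)
  qed
qed

text \<open>Indexed by natural numbers so that left and right singular vectors pair up by position;
  values from the dimension on are unconstrained.\<close>

definition onb :: "(nat \<Rightarrow> 'a::euclidean_space) \<Rightarrow> bool" where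
  "onb u \<longleftrightarrow> (\<forall>k<DIM('a). \<forall>l<DIM('a). u k \<bullet> u l = (if k = l then 1 else 0))"

lemma onb_expand:
  fixes u :: "nat \<Rightarrow> 'a::euclidean_space"
  assumes "onb u"
  shows "x = (\<Sum>k<DIM('a). (u k \<bullet> x) *\<^sub>R u k)"
proof -
  let ?B = "u ` {..<DIM('a)}"
  have o: "k < DIM('a) \<Longrightarrow> l < DIM('a) \<Longrightarrow> u k \<bullet> u l = (if k = l then 1 else 0)" for k l
    using assms by (auto simp: onb_def)
  have inj: "inj_on u {..<DIM('a)}"
  proof (rule inj_onI)
    fix k l assume "k \<in> {..<DIM('a)}" "l \<in> {..<DIM('a)}" "u k = u l"
    then show "k = l" using o[of k l] o[of l l] by (auto split: if_splits)
  qed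
  have "pairwise real_inner_class.orthogonal ?B"
    by (auto simp: pairwise_def real_inner_class.orthogonal_def o)
  moreover have "0 \<notin> ?B"
  proof
    assume "0 \<in> ?B"
    then obtain k where "k < DIM('a)" "u k = 0" by auto
    then show False using o[of k k] by simp
  qed
  ultimately have "independent ?B" by (rule pairwise_orthogonal_independent)
  then have sp: "span ?B = UNIV"
    using card_ge_dim_independent[of ?B UNIV] card_image[OF inj] by auto
  define y where "y = x - (\<Sum>k<DIM('a). (u k \<bullet> x) *\<^sub>R u k)"
  have "y \<bullet> u l = 0" if l: "l < DIM('a)" for l
  proof -
    have "(\<Sum>k<DIM('a). (u k \<bullet> x) * (u k \<bullet> u l)) = (\<Sum>k<DIM('a). if k = l then u k \<bullet> x else 0)"
      using o l by (intro sum.cong) auto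
    moreover have "y \<bullet> u l = x \<bullet> u l - (\<Sum>k<DIM('a). (u k \<bullet> x) * (u k \<bullet> u l))"
      by (simp add: y_def inner_diff_left inner_sum_left)
    ultimately show ?thesis using l by (simp add: inner_commute)
  qed
  then have "\<And>b. b \<in> ?B \<Longrightarrow> real_inner_class.orthogonal y b" by (auto simp: real_inner_class.orthogonal_def)
  then have "real_inner_class.orthogonal y y"
    using orthogonal_to_span[of y ?B y] sp by auto
  then show ?thesis by (simp add: y_def real_inner_class.orthogonal_def)
qed

lemma onb_inner:
  fixes u :: "nat \<Rightarrow> 'a::euclidean_space"
  assumes "onb u"
  shows "x \<bullet> y = (\<Sum>k<DIM('a). (u k \<bullet> x) * (u k \<bullet> y))"
  by (subst (1) onb_expand[OF assms, of x]) (simp add: inner_sum_left)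

lemma onb_norm:
  fixes u :: "nat \<Rightarrow> 'a::euclidean_space"
  assumes "onb u"
  shows "(norm x)\<^sup>2 = (\<Sum>k<DIM('a). (u k \<bullet> x)\<^sup>2)"
  using onb_inner[OF assms, of x x] by (simp add: dot_square_norm power2_eq_square)

text \<open>Serves families that need not be bases, such as the right singular vectors of nonzero
  singular values. It is the nonnegativity of the squared distance from \<open>x\<close> to its
  projection.\<close>

lemma bessel:
  fixes w :: "'i \<Rightarrow> 'a::real_inner"
  assumes "finite S" and o: "\<And>k l. k \<in> S \<Longrightarrow> l \<in> S \<Longrightarrow> w k \<bullet> w l = (if k = l then 1 else 0)"
  shows "(\<Sum>k\<in>S. (w k \<bullet> x)\<^sup>2) \<le> (norm x)\<^sup>2"
proof -
  let ?y = "\<Sum>k\<in>S. (w k \<bullet> x) *\<^sub>R w k"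
  have yx: "?y \<bullet> x = (\<Sum>k\<in>S. (w k \<bullet> x)\<^sup>2)" by (simp add: inner_sum_left power2_eq_square)
  have "?y \<bullet> ?y = (\<Sum>k\<in>S. (w k \<bullet> x) * (\<Sum>l\<in>S. (w l \<bullet> x) * (w k \<bullet> w l)))"
    by (simp add: inner_sum_left inner_sum_right sum_distrib_left inner_commute mult_ac)
  also have "\<dots> = (\<Sum>k\<in>S. (w k \<bullet> x)\<^sup>2)"
  proof (intro sum.cong refl)
    fix k assume k: "k \<in> S"
    have "(\<Sum>l\<in>S. (w l \<bullet> x) * (w k \<bullet> w l)) = (\<Sum>l\<in>S. if k = l then w l \<bullet> x else 0)"
      using o k by (intro sum.cong) auto
    then show "(w k \<bullet> x) * (\<Sum>l\<in>S. (w l \<bullet> x) * (w k \<bullet> w l)) = (w k \<bullet> x)\<^sup>2"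
      using k \<open>finite S\<close> by (simp add: power2_eq_square)
  qed
  finally have yy: "?y \<bullet> ?y = (\<Sum>k\<in>S. (w k \<bullet> x)\<^sup>2)" .
  have "0 \<le> (x - ?y) \<bullet> (x - ?y)" by simp
  also have "\<dots> = x \<bullet> x - 2 * (?y \<bullet> x) + ?y \<bullet> ?y"
    by (simp add: inner_diff_left inner_diff_right inner_commute)
  finally show ?thesis using yx yy by (simp add: dot_square_norm)
qed

lemma transpose_dot:
  fixes X :: "real^'n^'m"
  shows "(Finite_Cartesian_Product.transpose X *v a) \<bullet> b = a \<bullet> (X *v b)"
  by (simp add: transpose_matrix_vector dot_lmul_matrix)

lemma symmetric_matrix_eigenbasis:
  fixes A :: "real ^ 'n ^ 'n"
  assumes "Finite_Cartesian_Product.transpose A = A"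
  obtains q d where "onb q" "\<And>k. k < CARD('n) \<Longrightarrow> A *v q k = d k *\<^sub>R q k"
proof -
  have "(A *v x) \<bullet> y = x \<bullet> (A *v y)" for x y
    using transpose_dot[of A x y] assms by simp
  with selfadjoint_eigenbasis[of "(*v) A" UNIV]
  obtain B where B: "finite B" "card B = CARD('n)" "pairwise (\<lambda>x y. x \<bullet> y = 0) B" "\<forall>b\<in>B. norm b = 1"
    "\<forall>b\<in>B. \<exists>l. A *v b = l *\<^sub>R b"
    by auto
  obtain q where q: "bij_betw q {..<CARD('n)} B"
    using B(1,2) ex_bij_betw_nat_finite by (metis atLeast0LessThan)
  have qB: "k < CARD('n) \<Longrightarrow> q k \<in> B" for k using q by (auto simp: bij_betw_def)
  have "onb q" unfolding onb_def
  proof (intro allI impI)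
    fix k l assume "k < DIM(real^'n)" "l < DIM(real^'n)"
    then have k: "k < CARD('n)" "l < CARD('n)" by auto
    show "q k \<bullet> q l = (if k = l then 1 else 0)"
    proof (cases "k = l")
      case True then show ?thesis using B(4) qB[OF k(1)] by (simp add: dot_square_norm)
    next
      case False
      then have "q k \<noteq> q l" using q k by (auto simp: bij_betw_def inj_on_def)
      then show ?thesis using B(3) qB k False by (auto simp: pairwise_def)
    qed
  qed
  moreover have "\<forall>k. \<exists>l. k < CARD('n) \<longrightarrow> A *v q k = l *\<^sub>R q k" using B(5) qB by blast
  from choice[OF this] obtain d where "\<forall>k<CARD('n). A *v q k = d k *\<^sub>R q k" by blast
  ultimately show ?thesis using that by blast
qed

definition outer :: "real ^ 'm \<Rightarrow> real ^ 'n \<Rightarrow> real ^ 'n ^ 'm" where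
  "outer a b = (\<chi> i j. a $ i * b $ j)"

lemma outer_mult_vec: "outer a b *v x = (b \<bullet> x) *\<^sub>R a"
  unfolding Finite_Cartesian_Product.vec_eq_iff
  by (simp add: outer_def matrix_vector_mult_def inner_vec_def sum_distrib_left sum_distrib_right mult_ac)

lemma inner_outer: "X \<bullet> outer a b = a \<bullet> (X *v b)"
  by (simp add: outer_def inner_vec_def matrix_vector_mult_def sum_distrib_left mult_ac)

lemma inner_transpose: "Finite_Cartesian_Product.transpose X \<bullet> Finite_Cartesian_Product.transpose Y = (X :: real^'n^'m) \<bullet> Y"
  unfolding inner_vec_def Finite_Cartesian_Product.transpose_def by simp (rule sum.swap)

lemma sum_matrix_vector: "(\<Sum>i\<in>I. A i) *v x = (\<Sum>i\<in>I. A i *v x)" for A :: "'i \<Rightarrow> real^'n^'m"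
  by (induction I rule: infinite_finite_induct) (auto simp: matrix_vector_mult_add_rdistrib)

text \<open>Multiplication by the resolution of the identity that \<open>v\<close> provides: a
  matrix is recovered from its action on a basis.\<close>

lemma onb_outer_sum:
  fixes X :: "real^'n^'m"
  assumes "onb v"
  shows "X = (\<Sum>l<CARD('n). outer (X *v v l) (v l))"
proof -
  have "X *v x = (\<Sum>l<CARD('n). outer (X *v v l) (v l)) *v x" for x
  proof -
    have "X *v x = X *v (\<Sum>l<CARD('n). (v l \<bullet> x) *\<^sub>R v l)"
      by (rule arg_cong[where f = "matrix_vector_mult X"]) (rule onb_expand[OF assms, simplified])
    also have "\<dots> = (\<Sum>l<CARD('n). (v l \<bullet> x) *\<^sub>R (X *v v l))"
      by (simp add: linear_sum[OF matrix_vector_mul_linear] matrix_vector_mult_scaleR)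
    also have "\<dots> = (\<Sum>l<CARD('n). outer (X *v v l) (v l)) *v x"
      by (simp add: outer_mult_vec sum_matrix_vector)
    finally show ?thesis .
  qed
  then show ?thesis by (subst matrix_eq) blast
qed

section \<open>Singular values and duality for the nuclear norm\<close>

text \<open>An orthogonal diagonalisation makes \<open>A A^T\<close> similar to a diagonal matrix,
  so the characteristic polynomial splits with roots \<open>d k\<close>. Multisets are compared
  because the diagonal need not be sorted.\<close>

lemma mset_singular_values:
  assumes A: "A \<in> carrier_mat m n" and Q: "Q \<in> orthogonal_mats m"
    and eq: "A * A\<^sup>T = Q * mat_diag m d * Q\<^sup>T"
  shows "mset (singular_values A) = image_mset (\<lambda>k. sqrt (d k)) (mset_set {..<m})"
proof -
  have Qc: "Q \<in> carrier_mat m m" and QQ: "Q\<^sup>T * Q = 1\<^sub>m m" using Q by (auto simp: orthogonal_mats_def)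
  have QQ': "Q * Q\<^sup>T = 1\<^sub>m m"
    using mat_mult_left_right_inverse[OF _ Qc QQ] Qc by simp
  have "similar_mat (A * A\<^sup>T) (mat_diag m d)"
    unfolding similar_mat_def similar_mat_wit_def Let_def
    using A Qc QQ QQ' eq by (intro exI[of _ Q] exI[of _ "Q\<^sup>T"]) auto
  then have "char_poly (A * A\<^sup>T) = char_poly (mat_diag m d)" by (rule char_poly_similar)
  also have "\<dots> = (\<Prod>a\<leftarrow>diag_mat (mat_diag m d). [:- a, 1:])"
    by (rule char_poly_upper_triangular[of _ m]) (auto simp: mat_diag_def upper_triangular_def)
  also have "diag_mat (mat_diag m d) = map d [0..<m]"
    by (auto simp: diag_mat_def mat_diag_def)
  finally have cp: "char_poly (A * A\<^sup>T) = (\<Prod>a\<leftarrow>map d [0..<m]. [:- a, 1:])" .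
  have "proots (\<Prod>a\<leftarrow>xs. [:- a, 1:]) = mset xs" for xs :: "real list"
  proof (induction xs)
    case (Cons a xs)
    have nz: "(\<Prod>a\<leftarrow>xs. [:- a, 1:]) \<noteq> 0" by (auto simp: prod_list_zero_iff)
    have "proots ([:- a, 1:] * (\<Prod>a\<leftarrow>xs. [:- a, 1:])) = proots [:- a, 1:] + proots (\<Prod>a\<leftarrow>xs. [:- a, 1:])"
      by (rule proots_mult) (use nz in auto)
    then show ?case using Cons by simp
  qed simp
  then have "proots (char_poly (A * A\<^sup>T)) = mset (map d [0..<m])" unfolding cp by blast
  then show ?thesis
    by (simp add: singular_values_def multiset.map_comp o_def atLeast0LessThan)
qed

section \<open>Transfer between finite index types and matrices with explicit dimensions\<close>

lemma bij_pos: "bij_betw pos (UNIV :: 'n::{finite,linorder} set) {..<CARD('n)}"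
proof -
  have less: "pos i < pos j" if "i < j" for i j :: 'n
    unfolding pos_def using that by (intro psubset_card_mono) auto
  have inj: "inj (pos :: 'n \<Rightarrow> nat)"
    by (intro injI) (metis less linorder_neqE not_less_iff_gr_or_eq)
  have "pos i < CARD('n)" for i :: 'n
    unfolding pos_def by (intro psubset_card_mono) auto
  then have "range (pos :: 'n \<Rightarrow> nat) \<subseteq> {..<CARD('n)}" by auto
  then have "range (pos :: 'n \<Rightarrow> nat) = {..<CARD('n)}"
    using card_image[OF inj] by (intro card_subset_eq) auto
  then show ?thesis using inj by (simp add: bij_betw_def)
qed

lemma pos_less [simp]: "pos (i :: 'n::{finite,linorder}) < CARD('n)"
  using bij_pos by (auto simp: bij_betw_def)

lemma pos_inv [simp]: "k < CARD('n) \<Longrightarrow> pos (inv_into UNIV pos k :: 'n::{finite,linorder}) = k"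
  using bij_pos by (metis bij_betw_inv_into_right lessThan_iff)

lemma inv_pos [simp]: "inv_into UNIV pos (pos i) = (i :: 'n::{finite,linorder})"
  using bij_pos by (metis bij_betw_inv_into_left UNIV_I)

lemma sum_pos: "(\<Sum>i\<in>(UNIV::'n::{finite,linorder} set). f (pos i)) = (\<Sum>k<CARD('n). f k)"
  by (rule sum.reindex_bij_betw[OF bij_pos])

lemma of_mat_to_mat [simp]: "of_mat (to_mat X) = (X :: ('n1::{finite,linorder}, 'n2::{finite,linorder}) rmatrix)"
  by (simp add: of_mat_def to_mat_def Finite_Cartesian_Product.vec_eq_iff)

lemma to_mat_carrier [simp]:
  "to_mat (X :: ('n1::{finite,linorder}, 'n2::{finite,linorder}) rmatrix) \<in> carrier_mat CARD('n1) CARD('n2)"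
  by (simp add: to_mat_def)

lemma to_mat_of_mat:
  "A \<in> carrier_mat CARD('n1) CARD('n2) \<Longrightarrow>
    to_mat (of_mat A :: ('n1::{finite,linorder}, 'n2::{finite,linorder}) rmatrix) = A"
  by (intro eq_matI) (auto simp: of_mat_def to_mat_def)

definition vcol :: "real mat \<Rightarrow> nat \<Rightarrow> real ^ ('n::{finite,linorder})" where
  "vcol P k = (\<chi> i. P $$ (pos i, k))"

text \<open>The bridge for all factorisations in the statement: an explicit product becomes a sum of
  rank-one matrices whose coefficients are the entries of the middle factor.\<close>

lemma of_mat_triple:
  assumes P: "P \<in> carrier_mat CARD('n1) a" and D: "D \<in> carrier_mat a b" and Q: "Q \<in> carrier_mat CARD('n2) b"
  shows "of_mat (P * D * Q\<^sup>T) = (\<Sum>k<a. \<Sum>l<b. D $$ (k, l) *\<^sub>R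
    (outer (vcol P k) (vcol Q l) :: ('n1::{finite,linorder}, 'n2::{finite,linorder}) rmatrix))"
  unfolding Finite_Cartesian_Product.vec_eq_iff
proof (intro allI)
  fix i :: 'n1 and j :: 'n2
  have "(of_mat (P * D * Q\<^sup>T) :: ('n1, 'n2) rmatrix) $ i $ j =
      (\<Sum>k<a. P $$ (pos i, k) * (\<Sum>l<b. D $$ (k, l) * Q $$ (pos j, l)))"
    using P D Q by (simp add: of_mat_def scalar_prod_def atLeast0LessThan)
  also have "\<dots> = (\<Sum>k<a. \<Sum>l<b. D $$ (k, l) * (P $$ (pos i, k) * Q $$ (pos j, l)))"
    by (simp add: sum_distrib_left mult_ac)
  finally show "(of_mat (P * D * Q\<^sup>T) :: ('n1, 'n2) rmatrix) $ i $ j = (\<Sum>k<a. \<Sum>l<b. D $$ (k, l) *\<^sub>R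
    (outer (vcol P k) (vcol Q l) :: ('n1::{finite,linorder}, 'n2::{finite,linorder}) rmatrix)) $ i $ j"
    by (simp add: outer_def vcol_def)
qed

lemma vcol_inner:
  assumes "P \<in> carrier_mat CARD('n) a" "Q \<in> carrier_mat CARD('n) b" "k < a" "l < b"
  shows "vcol P k \<bullet> (vcol Q l :: real ^ ('n::{finite,linorder})) = (P\<^sup>T * Q) $$ (k, l)"
  using assms sum_pos[where 'n='n, of "\<lambda>i. P $$ (i, k) * Q $$ (i, l)"]
  by (simp add: vcol_def inner_vec_def scalar_prod_def atLeast0LessThan)

lemma onb_vcol:
  assumes "Q \<in> orthogonal_mats CARD('n)"
  shows "onb (vcol Q :: nat \<Rightarrow> real ^ ('n::{finite,linorder}))"
  unfolding onb_def
proof (intro allI impI)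
  fix k l assume "k < DIM('n rvec)" "l < DIM('n rvec)"
  then show "vcol Q k \<bullet> (vcol Q l :: 'n rvec) = (if k = l then 1 else 0)"
    using assms by (subst vcol_inner[where a="CARD('n)" and b="CARD('n)"]) (auto simp: orthogonal_mats_def)
qed

text \<open>Eigenbases are found in the typed space, but characteristic polynomials live on explicit
  matrices; this carries the basis across.\<close>

lemma onb_to_orthogonal_mats:
  fixes q :: "nat \<Rightarrow> real ^ ('n::{finite,linorder})"
  assumes "onb q"
  obtains Q where "Q \<in> orthogonal_mats CARD('n)" "\<And>k. k < CARD('n) \<Longrightarrow> vcol Q k = q k"
proof -
  let ?n = "CARD('n)"
  define Q where "Q = Matrix.mat ?n ?n (\<lambda>(i, k). q k $ inv_into UNIV pos i)"
  have Qc: "Q \<in> carrier_mat ?n ?n" by (simp add: Q_def)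
  have v: "vcol Q k = q k" if "k < ?n" for k
    using that by (simp add: vcol_def Q_def Finite_Cartesian_Product.vec_eq_iff)
  have "Q\<^sup>T * Q = 1\<^sub>m ?n"
  proof (rule eq_matI)
    fix k l assume "k < dim_row (1\<^sub>m ?n :: real mat)" "l < dim_col (1\<^sub>m ?n :: real mat)"
    then have kl: "k < ?n" "l < ?n" by auto
    have "(Q\<^sup>T * Q) $$ (k, l) = vcol Q k \<bullet> (vcol Q l :: 'n rvec)"
      by (rule vcol_inner[symmetric, OF Qc Qc kl])
    then show "(Q\<^sup>T * Q) $$ (k, l) = 1\<^sub>m ?n $$ (k, l)"
      using v kl assms by (simp add: onb_def)
  qed (use Qc in auto)
  with Qc v that show ?thesis by (auto simp: orthogonal_mats_def)
qed

lemma of_mat_transpose: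
  assumes "A \<in> carrier_mat CARD('n1) CARD('n2)"
  shows "of_mat (A * A\<^sup>T) = (of_mat A :: ('n1::{finite,linorder}, 'n2::{finite,linorder}) rmatrix)
    ** Finite_Cartesian_Product.transpose (of_mat A :: ('n1, 'n2) rmatrix)"
  unfolding Finite_Cartesian_Product.vec_eq_iff
proof (intro allI)
  fix i j
  show "(of_mat (A * A\<^sup>T) :: ('n1, 'n1) rmatrix) $ i $ j = ((of_mat A :: ('n1, 'n2) rmatrix)
    ** Finite_Cartesian_Product.transpose (of_mat A :: ('n1, 'n2) rmatrix)) $ i $ j"
    using assms sum_pos[where 'n='n2, of "\<lambda>l. A $$ (pos i, l) * A $$ (pos j, l)"]
    by (simp add: of_mat_def scalar_prod_def matrix_matrix_mult_def Finite_Cartesian_Product.transpose_def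
        atLeast0LessThan)
qed

text \<open>The hypothesis says that \<open>q\<close> diagonalises \<open>X X^T\<close>, as
  \<open>q k v* X\<close> is \<open>X^T q\<close>. The spectral sum of the rank-one matrices
  \<open>d k q q^T\<close> is then pulled back to explicit matrices, where \<open>of_mat\<close> is
  injective.\<close>

lemma mset_singular_values_eigen:
  fixes X :: "('n1::{finite,linorder}, 'n2::{finite,linorder}) rmatrix"
  assumes q: "onb q"
    and eig: "\<And>k. k < CARD('n1) \<Longrightarrow> X *v (q k v* X) = d k *\<^sub>R q k"
  shows "mset (singular_values (to_mat X)) = image_mset (\<lambda>k. sqrt (d k)) (mset_set {..<CARD('n1)})"
proof -
  let ?n = "CARD('n1)"
  obtain Q where Q: "Q \<in> orthogonal_mats ?n" and Qv: "\<And>k. k < ?n \<Longrightarrow> vcol Q k = q k"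
    using onb_to_orthogonal_mats[OF q] by blast
  have Qc: "Q \<in> carrier_mat ?n ?n" using Q by (simp add: orthogonal_mats_def)
  have "of_mat (Q * mat_diag ?n d * Q\<^sup>T) = (\<Sum>k<?n. \<Sum>l<?n. mat_diag ?n d $$ (k, l) *\<^sub>R outer (q k) (q l))"
    by (subst of_mat_triple[OF Qc _ Qc]) (auto simp: Qv intro!: sum.cong)
  also have "\<dots> = (\<Sum>k<?n. \<Sum>l<?n. if k = l then d k *\<^sub>R outer (q k) (q k) else 0)"
    by (intro sum.cong refl) (auto simp: mat_diag_def)
  also have "\<dots> = (\<Sum>k<?n. outer ((X ** Finite_Cartesian_Product.transpose X) *v q k) (q k))"
  proof (intro sum.cong refl)
    fix k assume "k \<in> {..<?n}"
    moreover have "outer (d k *\<^sub>R q k) (q k) = d k *\<^sub>R outer (q k) (q k)"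
      by (simp add: outer_def Finite_Cartesian_Product.vec_eq_iff)
    ultimately show "(\<Sum>l<?n. if k = l then d k *\<^sub>R outer (q k) (q k) else 0) =
        outer ((X ** Finite_Cartesian_Product.transpose X) *v q k) (q k)"
      using eig[of k] by (simp add: matrix_vector_mul_assoc[symmetric])
  qed
  also have "\<dots> = X ** Finite_Cartesian_Product.transpose X"
    by (rule onb_outer_sum[OF q, symmetric])
  also have "\<dots> = of_mat (to_mat X * (to_mat X)\<^sup>T)"
    by (simp add: of_mat_transpose[OF to_mat_carrier])
  finally have e: "of_mat (Q * mat_diag ?n d * Q\<^sup>T) = (of_mat (to_mat X * (to_mat X)\<^sup>T) :: ('n1,'n1) rmatrix)" .
  have "Q * mat_diag ?n d * Q\<^sup>T \<in> carrier_mat ?n ?n" "to_mat X * (to_mat X)\<^sup>T \<in> carrier_mat ?n ?n"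
    using Qc by (auto simp: to_mat_def mat_diag_def)
  then have "to_mat X * (to_mat X)\<^sup>T = Q * mat_diag ?n d * Q\<^sup>T"
    using e by (metis to_mat_of_mat)
  then show ?thesis by (rule mset_singular_values[OF to_mat_carrier Q])
qed

lemma nuclear_norm_eigen:
  fixes X :: "('n1::{finite,linorder}, 'n2::{finite,linorder}) rmatrix"
  assumes "onb q"
    and "\<And>k. k < CARD('n1) \<Longrightarrow> X *v (q k v* X) = d k *\<^sub>R q k"
  shows "nuclear_norm X = (\<Sum>k<CARD('n1). sqrt (d k))"
  using mset_singular_values_eigen[OF assms]
  by (simp add: nuclear_norm_def sum_mset_sum_list[symmetric] sum_unfold_sum_mset)

section \<open>Trace duality between the nuclear norm and the contractions, the closed spectral unit
  ball\<close>

definition contraction :: "real ^ 'n ^ 'm \<Rightarrow> bool" where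
  "contraction Z \<longleftrightarrow> (\<forall>x. norm (Z *v x) \<le> norm x)"

text \<open>The inner product is the trace of \<open>Z X^T\<close>, which may be computed in any
  orthonormal basis of the left space.\<close>

lemma inner_onb_left:
  fixes X Z :: "real ^ 'n ^ 'm"
  assumes "onb q"
  shows "Z \<bullet> X = (\<Sum>k<CARD('m). q k \<bullet> (Z *v (q k v* X)))"
proof -
  let ?t = Finite_Cartesian_Product.transpose
  have "Z \<bullet> X = ?t Z \<bullet> ?t X" by (simp add: inner_transpose)
  also have "\<dots> = ?t Z \<bullet> (\<Sum>k<CARD('m). outer (q k v* X) (q k))"
    by (subst onb_outer_sum[OF assms, of "?t X"]) simp
  also have "\<dots> = (\<Sum>k<CARD('m). (q k v* X) \<bullet> (?t Z *v q k))"
    by (simp add: inner_sum_right inner_outer)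
  also have "\<dots> = (\<Sum>k<CARD('m). q k \<bullet> (Z *v (q k v* X)))"
    by (intro sum.cong refl) (metis dot_lmul_matrix inner_commute transpose_matrix_vector)
  finally show ?thesis .
qed

text \<open>Half of a singular value decomposition: for an eigenbasis \<open>q\<close> of
  \<open>X X^T\<close> the vectors \<open>X^T q\<close> are orthogonal with squared lengths
  \<open>d k\<close>. They stay unnormalised because some \<open>d k\<close> may vanish.\<close>

lemma right_singular_system:
  fixes X :: "('n1::{finite,linorder}, 'n2::{finite,linorder}) rmatrix"
  obtains q d where "onb q" "\<And>k. k < CARD('n1) \<Longrightarrow> 0 \<le> d k"
    "\<And>k l. k < CARD('n1) \<Longrightarrow> l < CARD('n1) \<Longrightarrow>
      (q k v* X) \<bullet> (q l v* X) =
      (if k = l then d k else 0)"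
    "nuclear_norm X = (\<Sum>k<CARD('n1). sqrt (d k))"
proof -
  let ?t = Finite_Cartesian_Product.transpose
  have "?t (X ** ?t X) = X ** ?t X" by (simp add: matrix_transpose_mul)
  then obtain q d where q: "onb q" and eig: "\<And>k. k < CARD('n1) \<Longrightarrow> (X ** ?t X) *v q k = d k *\<^sub>R q k"
    using symmetric_matrix_eigenbasis by blast
  have eig': "k < CARD('n1) \<Longrightarrow> X *v (q k v* X) = d k *\<^sub>R q k" for k
    using eig[of k] by (simp add: matrix_vector_mul_assoc[symmetric])
  have o: "(q k v* X) \<bullet> (q l v* X) = (if k = l then d k else 0)" if "k < CARD('n1)" "l < CARD('n1)" for k l
    using that eig' q by (auto simp: dot_lmul_matrix onb_def)
  have "0 \<le> d k" if "k < CARD('n1)" for k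
    using o[OF that that] inner_ge_zero[of "q k v* X"] by simp
  then show ?thesis using that q o nuclear_norm_eigen[OF q eig'] by blast
qed

text \<open>In the basis of \<open>right_singular_system\<close> each summand of the trace is at
  most the length of \<open>X^T q\<close>, by Cauchy-Schwarz and contractivity.\<close>

lemma inner_le_nuclear_norm:
  fixes X :: "('n1::{finite,linorder}, 'n2::{finite,linorder}) rmatrix"
  assumes "contraction Z"
  shows "Z \<bullet> X \<le> nuclear_norm X"
proof -
  obtain q d where q: "onb q" and d: "\<And>k. k < CARD('n1) \<Longrightarrow> 0 \<le> d k"
    and o: "\<And>k l. k < CARD('n1) \<Longrightarrow> l < CARD('n1) \<Longrightarrow>
      (q k v* X) \<bullet> (q l v* X) = (if k = l then d k else 0)"
    and nn: "nuclear_norm X = (\<Sum>k<CARD('n1). sqrt (d k))"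
    using right_singular_system[of X] by metis
  have "q k \<bullet> (Z *v (q k v* X)) \<le> sqrt (d k)" if "k < CARD('n1)" for k
  proof -
    have "q k \<bullet> (Z *v (q k v* X)) \<le> norm (q k) * norm (Z *v (q k v* X))" by (rule norm_cauchy_schwarz)
    also have "norm (q k) = 1" using q that by (simp add: onb_def norm_eq_sqrt_inner)
    also have "norm (Z *v (q k v* X)) \<le> norm (q k v* X)" using assms by (simp add: contraction_def)
    also have "\<dots> = sqrt (d k)" using o[OF that that] by (simp add: norm_eq_sqrt_inner)
    finally show ?thesis by simp
  qed
  then show ?thesis unfolding inner_onb_left[OF q] nn by (intro sum_mono) auto
qed

text \<open>The maximiser is the polar factor of \<open>X\<close>: a partial isometry built from the
  singular vectors with nonzero singular value, the only ones that can be normalised. Bessel's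
  inequality makes it a contraction.\<close>

lemma nuclear_norm_attained:
  fixes X :: "('n1::{finite,linorder}, 'n2::{finite,linorder}) rmatrix"
  obtains Z where "contraction Z" "Z \<bullet> X = nuclear_norm X"
proof -
  obtain q d where q: "onb q" and d: "\<And>k. k < CARD('n1) \<Longrightarrow> 0 \<le> d k"
    and o: "\<And>k l. k < CARD('n1) \<Longrightarrow> l < CARD('n1) \<Longrightarrow>
      (q k v* X) \<bullet> (q l v* X) = (if k = l then d k else 0)"
    and nn: "nuclear_norm X = (\<Sum>k<CARD('n1). sqrt (d k))"
    using right_singular_system[of X] by metis
  define S where "S = {k. k < CARD('n1) \<and> d k \<noteq> 0}"
  have finS: "finite S" and SK: "S \<subseteq> {..<CARD('n1)}" by (auto simp: S_def)
  define w where "w k = (1 / sqrt (d k)) *\<^sub>R (q k v* X)" for k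
  define Z where "Z = (\<Sum>k\<in>S. outer (q k) (w k))"
  have w: "w k \<bullet> w l = (if k = l then 1 else 0)" if "k \<in> S" "l \<in> S" for k l
    using that o[of k l] d[of k] by (auto simp: w_def S_def)
  have "norm (Z *v x) \<le> norm x" for x
  proof -
    have Zx: "Z *v x = (\<Sum>k\<in>S. (w k \<bullet> x) *\<^sub>R q k)"
      by (simp add: Z_def sum_matrix_vector outer_mult_vec)
    have qZ: "q k \<bullet> (Z *v x) = (if k \<in> S then w k \<bullet> x else 0)" if "k < CARD('n1)" for k
    proof -
      have "q k \<bullet> (Z *v x) = (\<Sum>l\<in>S. if l = k then w l \<bullet> x else 0)"
        unfolding Zx inner_sum_right using that q SK by (intro sum.cong) (auto simp: onb_def)
      then show ?thesis using finS by simp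
    qed
    have "(norm (Z *v x))\<^sup>2 = (\<Sum>k<CARD('n1). (if k \<in> S then w k \<bullet> x else 0)\<^sup>2)"
      using qZ by (simp add: onb_norm[OF q])
    also have "\<dots> = (\<Sum>k\<in>S. (w k \<bullet> x)\<^sup>2)"
      using SK by (intro sum.mono_neutral_cong_right) auto
    also have "\<dots> \<le> (norm x)\<^sup>2" by (rule bessel[OF finS w])
    finally show ?thesis by (rule power2_le_imp_le) simp
  qed
  then have "contraction Z" by (simp add: contraction_def)
  moreover have "Z \<bullet> X = (\<Sum>k\<in>S. sqrt (d k))"
    unfolding Z_def inner_sum_left
  proof (intro sum.cong refl)
    fix k assume k: "k \<in> S"
    have "outer (q k) (w k) \<bullet> X = (q k v* X) \<bullet> w k"
      by (simp add: inner_commute[of _ X] inner_outer dot_lmul_matrix)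
    also have "\<dots> = d k / sqrt (d k)" using o[of k k] k by (simp add: w_def S_def)
    also have "\<dots> = sqrt (d k)" using d[of k] k by (simp add: S_def real_div_sqrt)
    finally show "outer (q k) (w k) \<bullet> X = sqrt (d k)" .
  qed
  moreover have "(\<Sum>k\<in>S. sqrt (d k)) = nuclear_norm X"
    unfolding nn by (intro sum.mono_neutral_left) (auto simp: S_def)
  ultimately show ?thesis using that by simp
qed

section \<open>Admissible perturbations of the dual certificate\<close>

text \<open>
  Common singular bases \<open>u\<close>, \<open>v\<close> of the matrices \<open>Ybar\<close> and \<open>Xbar\<close> defined below, with singular values
  \<open>sg\<close> and \<open>ta\<close>, both extended by 0 beyond the number of rows.
\<close>

locale svd_frame =
  fixes u :: "nat \<Rightarrow> 'n1::{finite,linorder} rvec" and v :: "nat \<Rightarrow> 'n2::{finite,linorder} rvec"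
    and r p :: nat and sg ta :: "nat \<Rightarrow> real"
  assumes u: "onb u" and v: "onb v"
    and rp: "r \<le> p" and pn: "p \<le> CARD('n1)" and nn: "CARD('n1) \<le> CARD('n2)"
    and sg1: "k < p \<Longrightarrow> sg k = 1"
    and sg_less: "p \<le> k \<Longrightarrow> 0 \<le> sg k \<and> sg k < 1"
    and sg0: "CARD('n1) \<le> k \<Longrightarrow> sg k = 0"
    and ta_pos: "k < r \<Longrightarrow> 0 < ta k" and ta0: "r \<le> k \<Longrightarrow> ta k = 0"
begin

text \<open>The entries of \<open>X\<close> in the singular bases, so that block conditions become
  conditions on index ranges.\<close>

definition coord :: "('n1, 'n2) rmatrix \<Rightarrow> nat \<Rightarrow> nat \<Rightarrow> real" where
  "coord X k l = u k \<bullet> (X *v v l)"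

lemma uu: "k < CARD('n1) \<Longrightarrow> l < CARD('n1) \<Longrightarrow> u k \<bullet> u l = (if k = l then 1 else 0)"
  using u by (simp add: onb_def)

lemma vv: "k < CARD('n2) \<Longrightarrow> l < CARD('n2) \<Longrightarrow> v k \<bullet> v l = (if k = l then 1 else 0)"
  using v by (simp add: onb_def)

lemma coord_add: "coord (X + Z) k l = coord X k l + coord Z k l"
  by (simp add: coord_def matrix_vector_mult_add_rdistrib inner_add_right)

lemma coord_diff: "coord (X - Z) k l = coord X k l - coord Z k l"
  by (simp add: coord_def matrix_vector_mult_diff_rdistrib inner_diff_right)

lemma coord_scale: "coord (a *\<^sub>R X) k l = a * coord X k l"
  by (simp add: coord_def scaleR_matrix_vector_assoc[symmetric])

lemma coord_zero [simp]: "coord 0 k l = 0"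
  by (simp add: coord_def)

lemma coord_minus: "coord (- X) k l = - coord X k l"
  using coord_diff[of 0 X] by simp

lemma coord_sum: "coord (\<Sum>i\<in>I. f i) k l = (\<Sum>i\<in>I. coord (f i) k l)"
  by (simp add: coord_def sum_matrix_vector inner_sum_right)

lemma coord_outer:
  "i < CARD('n1) \<Longrightarrow> k < CARD('n1) \<Longrightarrow> j < CARD('n2) \<Longrightarrow> l < CARD('n2) \<Longrightarrow>
    coord (outer (u i) (v j)) k l = (if k = i \<and> l = j then 1 else 0)"
  by (auto simp: coord_def outer_mult_vec uu vv)

lemmas coord_simps = coord_add coord_diff coord_scale coord_minus

lemma coord_expand: "X = (\<Sum>k<CARD('n1). \<Sum>l<CARD('n2). coord X k l *\<^sub>R outer (u k) (v l))"
proof -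
  have "(\<Sum>k<CARD('n1). \<Sum>l<CARD('n2). coord X k l *\<^sub>R outer (u k) (v l)) =
      (\<Sum>l<CARD('n2). outer (\<Sum>k<CARD('n1). (u k \<bullet> (X *v v l)) *\<^sub>R u k) (v l))"
    by (subst sum.swap) (simp add: outer_def Finite_Cartesian_Product.vec_eq_iff coord_def sum_distrib_left mult_ac)
  also have "\<dots> = (\<Sum>l<CARD('n2). outer (X *v v l) (v l))"
    using onb_expand[OF u, symmetric] by simp
  also have "\<dots> = X" by (rule onb_outer_sum[OF v, symmetric])
  finally show ?thesis by simp
qed

lemma coord_eqI: "(\<And>k l. k < CARD('n1) \<Longrightarrow> l < CARD('n2) \<Longrightarrow> coord X k l = coord Z k l) \<Longrightarrow> X = Z"
  by (subst coord_expand[of X], subst coord_expand[of Z]) simp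

lemma inner_coord: "X \<bullet> Z = (\<Sum>k<CARD('n1). \<Sum>l<CARD('n2). coord X k l * coord Z k l)"
  by (subst coord_expand[of Z])
    (simp add: inner_sum_right inner_outer coord_def mult.commute)

lemma coord_combo:
  assumes "A \<subseteq> {..<CARD('n1)}" "B \<subseteq> {..<CARD('n2)}" "k < CARD('n1)" "l < CARD('n2)"
  shows "coord (\<Sum>i\<in>A. \<Sum>j\<in>B. g i j *\<^sub>R outer (u i) (v j)) k l =
    (if k \<in> A \<and> l \<in> B then g k l else 0)"
proof -
  have fin: "finite A" "finite B" using assms finite_subset by blast+
  have "coord (\<Sum>i\<in>A. \<Sum>j\<in>B. g i j *\<^sub>R outer (u i) (v j)) k l =
      (\<Sum>i\<in>A. \<Sum>j\<in>B. if j = l then (if i = k then g i j else 0) else 0)"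
    unfolding coord_sum coord_scale using assms by (intro sum.cong refl) (auto simp: coord_outer subset_iff)
  also have "\<dots> = (if k \<in> A \<and> l \<in> B then g k l else 0)" using fin by (cases "l \<in> B") simp_all
  finally show ?thesis .
qed

lemma coord_diag:
  assumes "A \<subseteq> {..<CARD('n1)}" "k < CARD('n1)" "l < CARD('n2)"
  shows "coord (\<Sum>i\<in>A. g i *\<^sub>R outer (u i) (v i)) k l = (if k = l \<and> k \<in> A then g k else 0)"
proof -
  have fin: "finite A" using assms finite_subset by blast
  have "coord (\<Sum>i\<in>A. g i *\<^sub>R outer (u i) (v i)) k l =
      (\<Sum>i\<in>A. if i = k then (if k = l then g i else 0) else 0)"
    unfolding coord_sum coord_scale using assms nn by (intro sum.cong) (auto simp: coord_outer)
  also have "\<dots> = (if k = l \<and> k \<in> A then g k else 0)" using fin by simp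
  finally show ?thesis .
qed

definition Ybar :: "('n1, 'n2) rmatrix" where
  "Ybar = (\<Sum>k<CARD('n1). sg k *\<^sub>R outer (u k) (v k))"

definition Xbar :: "('n1, 'n2) rmatrix" where
  "Xbar = (\<Sum>k<CARD('n1). ta k *\<^sub>R outer (u k) (v k))"

definition Emat :: "('n1, 'n2) rmatrix" where
  "Emat = (\<Sum>k<r. outer (u k) (v k))"

text \<open>The projection onto the orthogonal complement of \<open>T\<close>, given by coordinates;
  \<open>orth_proj_PN_null_comp\<close> and \<open>set_T_eq\<close> later identify it as
  such.\<close>

definition PN :: "('n1, 'n2) rmatrix \<Rightarrow> ('n1, 'n2) rmatrix" where
  "PN W = (\<Sum>k\<in>{r..<CARD('n1)}. \<Sum>l\<in>{r..<CARD('n2)}. coord W k l *\<^sub>R outer (u k) (v l))"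

lemma coord_Y: "k < CARD('n1) \<Longrightarrow> l < CARD('n2) \<Longrightarrow> coord Ybar k l = (if k = l then sg k else 0)"
  unfolding Ybar_def by (subst coord_diag) auto

lemma coord_X: "k < CARD('n1) \<Longrightarrow> l < CARD('n2) \<Longrightarrow> coord Xbar k l = (if k = l then ta k else 0)"
  unfolding Xbar_def by (subst coord_diag) auto

lemma coord_E: "k < CARD('n1) \<Longrightarrow> l < CARD('n2) \<Longrightarrow> coord Emat k l = (if k = l \<and> k < r then 1 else 0)"
  unfolding Emat_def using coord_diag[of "{..<r}" k l "\<lambda>_. 1"] rp pn by auto

lemma coord_PN: "k < CARD('n1) \<Longrightarrow> l < CARD('n2) \<Longrightarrow> coord (PN W) k l = (if r \<le> k \<and> r \<le> l then coord W k l else 0)"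
  unfolding PN_def by (subst coord_combo) auto

lemma PN_inner: "PN X \<bullet> Z = X \<bullet> PN Z"
  unfolding inner_coord by (intro sum.cong refl) (simp add: coord_PN)

lemma PN_PN [simp]: "PN (PN X) = PN X"
  by (rule coord_eqI) (simp add: coord_PN)

text \<open>The subgradient form of \<open>Ybar\<close> at \<open>Xbar\<close>: its first
  \<open>r\<close> singular values equal 1 because \<open>r \<le> p\<close>.\<close>

lemma Y_split: "Ybar = Emat + PN Ybar"
proof (rule coord_eqI)
  fix k l assume "k < CARD('n1)" "l < CARD('n2)"
  moreover have "k < r \<Longrightarrow> sg k = 1" using sg1 rp by auto
  ultimately show "coord Ybar k l = coord (Emat + PN Ybar) k l"
    by (auto simp: coord_simps coord_Y coord_E coord_PN)
qed

lemma coord_apply: "u k \<bullet> (X *v x) = (\<Sum>l<CARD('n2). coord X k l * (v l \<bullet> x))"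
  by (subst onb_outer_sum[OF v, of X])
    (simp add: sum_matrix_vector outer_mult_vec inner_sum_right coord_def mult.commute)

lemma Y_apply: "k < CARD('n1) \<Longrightarrow> u k \<bullet> (Ybar *v x) = sg k * (v k \<bullet> x)"
proof -
  assume k: "k < CARD('n1)"
  have "u k \<bullet> (Ybar *v x) = (\<Sum>l<CARD('n2). if l = k then sg k * (v l \<bullet> x) else 0)"
    unfolding coord_apply using k by (intro sum.cong) (auto simp: coord_Y)
  then show ?thesis using k nn by simp
qed

text \<open>The slack in the contraction inequality is diagonal in \<open>v\<close>. Indices from
  \<open>CARD('n1)\<close> on carry weight 1, by the default value 0 of \<open>sg\<close>.\<close>

lemma norm_Y_apply: "(norm x)\<^sup>2 - (norm (Ybar *v x))\<^sup>2 = (\<Sum>l<CARD('n2). (1 - (sg l)\<^sup>2) * (v l \<bullet> x)\<^sup>2)"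
proof -
  have "(norm (Ybar *v x))\<^sup>2 = (\<Sum>l<CARD('n1). (sg l)\<^sup>2 * (v l \<bullet> x)\<^sup>2)"
    unfolding onb_norm[OF u] by (simp add: Y_apply power_mult_distrib)
  also have "\<dots> = (\<Sum>l<CARD('n2). (sg l)\<^sup>2 * (v l \<bullet> x)\<^sup>2)"
    using nn sg0 by (intro sum.mono_neutral_left) auto
  finally show ?thesis unfolding onb_norm[OF v, of x]
    by (simp add: sum_subtractf left_diff_distrib)
qed

lemma sg_bounds: "0 \<le> sg k \<and> sg k \<le> 1"
  using sg1[of k] sg_less[of k] by (cases "k < p") auto

lemma gap_nonneg: "0 \<le> (1 - (sg l)\<^sup>2) * a\<^sup>2"
  using sg_bounds[of l] by (simp add: abs_square_le_1)

lemma gap_ge: "l < CARD('n2) \<Longrightarrow> (1 - (sg l)\<^sup>2) * (v l \<bullet> x)\<^sup>2 \<le> (norm x)\<^sup>2 - (norm (Ybar *v x))\<^sup>2"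
  unfolding norm_Y_apply using gap_nonneg by (intro member_le_sum) auto

lemma contraction_Y: "contraction Ybar"
  unfolding contraction_def
proof
  fix x
  have "0 \<le> (norm x)\<^sup>2 - (norm (Ybar *v x))\<^sup>2"
    unfolding norm_Y_apply using gap_nonneg by (intro sum_nonneg) auto
  then show "norm (Ybar *v x) \<le> norm x"
    using power2_le_imp_le[of "norm (Ybar *v x)" "norm x"] by simp
qed

text \<open>Since it vanishes at \<open>Xbar\<close> (\<open>gap_Xbar\<close>), this is the Bregman
  distance of the nuclear norm from \<open>Xbar\<close> with respect to the subgradient
  \<open>Ybar\<close>.\<close>

definition gap :: "('n1, 'n2) rmatrix \<Rightarrow> real" where
  "gap X = nuclear_norm X - Ybar \<bullet> X"

lemma gap_ge0: "0 \<le> gap X"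
  using inner_le_nuclear_norm[OF contraction_Y, of X] by (simp add: gap_def)

text \<open>Directions in which \<open>Ybar\<close> leaves the spectral unit ball only to second order.\<close>

definition admissible :: "('n1, 'n2) rmatrix \<Rightarrow> bool" where
  "admissible N \<longleftrightarrow> (\<exists>C\<ge>0. \<forall>t>0. \<forall>x. norm ((Ybar + t *\<^sub>R N) *v x) \<le> (1 + C * t\<^sup>2) * norm x)"

text \<open>Only the cross term of the expanded square needs care: the term in \<open>N x\<close>
  alone is bounded by \<open>K^2 t^2 (norm x)^2\<close>. Enlarging \<open>1 + D t^2\<close> to its
  square then permits taking roots.\<close>

lemma admissibleI:
  assumes "\<And>t x. t > 0 \<Longrightarrow> 2 * t * ((Ybar *v x) \<bullet> (N *v x)) \<le> (norm x)\<^sup>2 - (norm (Ybar *v x))\<^sup>2 + C * t\<^sup>2 * (norm x)\<^sup>2"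
    and C: "C \<ge> 0"
  shows "admissible N"
proof -
  have "bounded_linear ((*v) N)" by (simp add: matrix_vector_mul_bounded_linear)
  then obtain K where K: "\<And>x. norm (N *v x) \<le> norm x * K" "K > 0"
    using bounded_linear.pos_bounded by metis
  define D where "D = C + K\<^sup>2"
  have D: "D \<ge> 0" using C by (simp add: D_def)
  have "norm ((Ybar + t *\<^sub>R N) *v x) \<le> (1 + D * t\<^sup>2) * norm x" if "t > 0" for t x
  proof (rule power2_le_imp_le)
    have "(Ybar + t *\<^sub>R N) *v x = Ybar *v x + t *\<^sub>R (N *v x)"
      by (simp add: matrix_vector_mult_add_rdistrib scaleR_matrix_vector_assoc[symmetric])
    then have "(norm ((Ybar + t *\<^sub>R N) *v x))\<^sup>2 =
      (norm (Ybar *v x))\<^sup>2 + 2 * t * ((Ybar *v x) \<bullet> (N *v x)) + t\<^sup>2 * (norm (N *v x))\<^sup>2"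
      by (simp add: power2_norm_eq_inner inner_add_left inner_add_right inner_commute
          power2_eq_square[of t])
    also have "\<dots> \<le> (norm x)\<^sup>2 + C * t\<^sup>2 * (norm x)\<^sup>2 + t\<^sup>2 * (norm x * K)\<^sup>2"
    proof -
      have "t\<^sup>2 * (norm (N *v x))\<^sup>2 \<le> t\<^sup>2 * (norm x * K)\<^sup>2"
        using K(1)[of x] by (intro mult_left_mono power_mono) auto
      then show ?thesis using assms(1)[OF that, of x] by linarith
    qed
    also have "\<dots> = (1 + D * t\<^sup>2) * (norm x)\<^sup>2"
      by (simp add: D_def algebra_simps power2_eq_square)
    also have "\<dots> \<le> (1 + D * t\<^sup>2)\<^sup>2 * (norm x)\<^sup>2"
      using D by (intro mult_right_mono) (auto simp: power2_eq_square[of "1 + _"] algebra_simps)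
    finally show "(norm ((Ybar + t *\<^sub>R N) *v x))\<^sup>2 \<le> ((1 + D * t\<^sup>2) * norm x)\<^sup>2"
      by (simp add: power_mult_distrib)
  qed (use D in auto)
  with D show ?thesis unfolding admissible_def by blast
qed

text \<open>On the leading block \<open>Ybar\<close> maps \<open>v k\<close> to \<open>u k\<close>,
  so the cross term is \<open>(v i . x) (v j . x)\<close> minus itself.\<close>

lemma admissible_skew:
  assumes "i < p" "j < p"
  shows "admissible (outer (u i) (v j) - outer (u j) (v i))"
proof (rule admissibleI[where C = 0])
  fix t :: real and x
  have ij: "i < CARD('n1)" "j < CARD('n1)" using assms pn by auto
  have "(Ybar *v x) \<bullet> ((outer (u i) (v j) - outer (u j) (v i)) *v x) = 0"
    using assms ij
    by (simp add: matrix_vector_mult_diff_rdistrib outer_mult_vec inner_diff_right inner_commute[of "Ybar *v x"] Y_apply sg1)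
  then show "2 * t * ((Ybar *v x) \<bullet> ((outer (u i) (v j) - outer (u j) (v i)) *v x))
      \<le> (norm x)\<^sup>2 - (norm (Ybar *v x))\<^sup>2 + 0 * t\<^sup>2 * (norm x)\<^sup>2"
    using contraction_Y by (simp add: contraction_def)
qed simp

text \<open>Complete the square, weighted so that the first term matches a given slack
  \<open>d\<close>.\<close>

lemma young: "d > 0 \<Longrightarrow> 2 * t * (s * a * b) \<le> d * a\<^sup>2 + t\<^sup>2 * s\<^sup>2 / d * (b::real)\<^sup>2"
proof -
  assume d: "d > 0"
  have "0 \<le> (d * a - t * s * b)\<^sup>2 / d" using d by simp
  also have "\<dots> = d * a\<^sup>2 + t\<^sup>2 * s\<^sup>2 / d * b\<^sup>2 - 2 * t * (s * a * b)"
    using d by (simp add: power2_eq_square field_simps)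
  finally show ?thesis by simp
qed

lemma v_coord_le: "l < CARD('n2) \<Longrightarrow> (v l \<bullet> x)\<^sup>2 \<le> (norm x)\<^sup>2"
  unfolding onb_norm[OF v, of x] by (intro member_le_sum) auto

text \<open>At least one of the two indices has positive slack \<open>1 - sg^2\<close>, which
  absorbs the cross term by \<open>young\<close>. Both signs of \<open>s\<close> are covered, so
  these tests will give equations.\<close>

lemma admissible_off:
  assumes ij: "i < CARD('n1)" "j < CARD('n2)" and off: "p \<le> i \<or> p \<le> j"
  shows "admissible (s *\<^sub>R outer (u i) (v j))"
proof -
  have in2: "i < CARD('n2)" using ij nn by simp
  have eq: "(Ybar *v x) \<bullet> ((s *\<^sub>R outer (u i) (v j)) *v x) = (s * sg i) * (v i \<bullet> x) * (v j \<bullet> x)" for x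
    using ij by (simp add: scaleR_matrix_vector_assoc[symmetric] outer_mult_vec inner_commute[of "Ybar *v x"] Y_apply)
  \<comment> \<open>\<open>Ybar\<close> turns the left index \<open>i\<close> into the right index
    \<open>i\<close>, so the product is symmetric; \<open>a\<close> names the factor with slack and
    \<open>b\<close> the other.\<close>
  obtain a b where ab: "a < CARD('n2)" "b < CARD('n2)" "p \<le> a"
    and eq2: "\<And>x. (v i \<bullet> x) * (v j \<bullet> x) = (v a \<bullet> x) * (v b \<bullet> x)"
  proof (cases "p \<le> i")
    case True then show ?thesis using that[of i j] in2 ij by simp
  next
    case False then show ?thesis using that[of j i] in2 ij off by (simp add: mult.commute)
  qed
  define d where "d = 1 - (sg a)\<^sup>2"
  have d: "d > 0" using sg_less[OF ab(3)] by (simp add: d_def abs_square_less_1)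
  show ?thesis
  proof (rule admissibleI[where C = "(s * sg i)\<^sup>2 / d"])
    fix t :: real and x assume t: "t > 0"
    have "2 * t * ((Ybar *v x) \<bullet> ((s *\<^sub>R outer (u i) (v j)) *v x)) = 2 * t * ((s * sg i) * (v a \<bullet> x) * (v b \<bullet> x))"
      unfolding eq using eq2[of x] by simp
    also have "\<dots> \<le> d * (v a \<bullet> x)\<^sup>2 + t\<^sup>2 * (s * sg i)\<^sup>2 / d * (v b \<bullet> x)\<^sup>2"
      by (rule young[OF d])
    also have "\<dots> \<le> (norm x)\<^sup>2 - (norm (Ybar *v x))\<^sup>2 + t\<^sup>2 * (s * sg i)\<^sup>2 / d * (norm x)\<^sup>2"
      using gap_ge[OF ab(1), of x] v_coord_le[OF ab(2), of x] d
      by (intro add_mono mult_left_mono) (auto simp: d_def)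
    finally show "2 * t * ((Ybar *v x) \<bullet> ((s *\<^sub>R outer (u i) (v j)) *v x))
      \<le> (norm x)\<^sup>2 - (norm (Ybar *v x))\<^sup>2 + (s * sg i)\<^sup>2 / d * t\<^sup>2 * (norm x)\<^sup>2"
      by (simp add: mult_ac)
  qed (use d in auto)
qed

text \<open>Matched combinations on the left and the right: as \<open>sg\<close> is 1 below
  \<open>p\<close>, \<open>Ybar\<close> sends \<open>vcomb a\<close> to
  \<open>ucomb a\<close>.\<close>

definition ucomb :: "(nat \<Rightarrow> real) \<Rightarrow> 'n1 rvec" where "ucomb a = (\<Sum>k<p. a k *\<^sub>R u k)"
definition vcomb :: "(nat \<Rightarrow> real) \<Rightarrow> 'n2 rvec" where "vcomb a = (\<Sum>k<p. a k *\<^sub>R v k)"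

text \<open>The cross term is minus the square of \<open>vcomb a . x\<close>, so these directions
  point into the unit ball to first order.\<close>

lemma admissible_neg: "admissible (- outer (ucomb a) (vcomb a))"
proof (rule admissibleI[where C = 0])
  fix t :: real and x assume t: "t > 0"
  have "(Ybar *v x) \<bullet> ucomb a = (\<Sum>k<p. a k * (u k \<bullet> (Ybar *v x)))"
    by (simp add: ucomb_def inner_sum_right inner_commute)
  also have "\<dots> = vcomb a \<bullet> x"
    unfolding vcomb_def inner_sum_left using pn by (intro sum.cong) (auto simp: Y_apply sg1)
  finally have e: "(Ybar *v x) \<bullet> ucomb a = vcomb a \<bullet> x" .
  have "(- outer (ucomb a) (vcomb a)) *v x = - (outer (ucomb a) (vcomb a) *v x)"
    using matrix_vector_mult_diff_rdistrib[of 0 "outer (ucomb a) (vcomb a)" x] by simp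
  then have "(Ybar *v x) \<bullet> (- outer (ucomb a) (vcomb a) *v x) = - ((vcomb a \<bullet> x) * (vcomb a \<bullet> x))"
    using e by (simp add: outer_mult_vec)
  then have "2 * t * ((Ybar *v x) \<bullet> (- outer (ucomb a) (vcomb a) *v x)) \<le> 0"
    using t by (simp add: mult_nonneg_nonpos)
  then show "2 * t * ((Ybar *v x) \<bullet> (- outer (ucomb a) (vcomb a) *v x))
      \<le> (norm x)\<^sup>2 - (norm (Ybar *v x))\<^sup>2 + 0 * t\<^sup>2 * (norm x)\<^sup>2"
    using power_mono[of "norm (Ybar *v x)" "norm x" 2] contraction_Y[unfolded contraction_def]
    by (simp only: mult_zero_left add_0_right norm_ge_zero) (smt (verit) norm_ge_zero)
qed simp

text \<open>Dividing \<open>Ybar + t N\<close> by \<open>1 + C t^2\<close> gives a contraction to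
  test against. \<open>C\<close> is chosen before \<open>t\<close> and \<open>X\<close>, as it must
  stay fixed along a sequence.\<close>

lemma admissible_test:
  assumes "admissible N"
  shows "\<exists>C\<ge>0. \<forall>t X. t > 0 \<longrightarrow> t * (N \<bullet> X) - C * t\<^sup>2 * (Ybar \<bullet> X) \<le> (1 + C * t\<^sup>2) * gap X"
proof -
  obtain C where C: "C \<ge> 0" and b: "\<And>t x. t > 0 \<Longrightarrow> norm ((Ybar + t *\<^sub>R N) *v x) \<le> (1 + C * t\<^sup>2) * norm x"
    using assms by (auto simp: admissible_def)
  have "t * (N \<bullet> X) - C * t\<^sup>2 * (Ybar \<bullet> X) \<le> (1 + C * t\<^sup>2) * gap X" if t: "t > 0" for t X
  proof -
    define D where "D = 1 + C * t\<^sup>2"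
    have D: "D > 0" using C by (simp add: D_def add_pos_nonneg)
    have "norm (((1 / D) *\<^sub>R (Ybar + t *\<^sub>R N)) *v x) \<le> norm x" for x
    proof -
      have "norm (((1 / D) *\<^sub>R (Ybar + t *\<^sub>R N)) *v x) = norm ((Ybar + t *\<^sub>R N) *v x) / D"
        unfolding scaleR_matrix_vector_assoc[symmetric] using D by simp
      then show ?thesis using b[OF t, of x] D by (simp add: D_def[symmetric] pos_divide_le_eq mult.commute)
    qed
    then have "contraction ((1 / D) *\<^sub>R (Ybar + t *\<^sub>R N))" by (simp add: contraction_def)
    from inner_le_nuclear_norm[OF this, of X]
    have "Ybar \<bullet> X + t * (N \<bullet> X) \<le> D * nuclear_norm X"
      using D by (simp add: inner_add_left field_simps)
    then show ?thesis by (simp add: gap_def D_def algebra_simps)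
  qed
  with C show ?thesis by blast
qed

text \<open>\<open>N . X0 = 0\<close> removes the first-order term, so the whole inequality lives at
  the scale \<open>t^2\<close>. What remains is linear in \<open>W\<close> up to an error
  \<open>C s^2\<close>, beaten by a small \<open>s\<close>.\<close>

lemma gap_cone:
  assumes N: "admissible N" and NX: "N \<bullet> X0 = 0"
    and t: "\<And>n. t n > 0" and t0: "t \<longlonglongrightarrow> 0" and W: "Wn \<longlonglongrightarrow> W"
    and e: "\<And>n. gap (X0 + t n *\<^sub>R Wn n) \<le> e n * (t n)\<^sup>2" and e0: "e \<longlonglongrightarrow> 0"
  shows "N \<bullet> W \<le> 0"
proof -
  obtain C where C: "C \<ge> 0" and
    b: "\<And>t X. t > 0 \<Longrightarrow> t * (N \<bullet> X) - C * t\<^sup>2 * (Ybar \<bullet> X) \<le> (1 + C * t\<^sup>2) * gap X"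
    using admissible_test[OF N] by blast
  \<comment> \<open>The test is applied with step \<open>s * t n\<close>; division by the square of
    \<open>t n\<close> and the limit in \<open>n\<close> leave an inequality in the free parameter
    \<open>s\<close>.\<close>
  have main: "s * (N \<bullet> W) - C * s\<^sup>2 * (Ybar \<bullet> X0) \<le> 0" if s: "s > 0" for s
  proof -
    have "s * (N \<bullet> Wn n) - C * s\<^sup>2 * (Ybar \<bullet> (X0 + t n *\<^sub>R Wn n)) \<le> (1 + C * (s * t n)\<^sup>2) * e n" for n
    proof -
      have "(t n)\<^sup>2 * (s * (N \<bullet> Wn n) - C * s\<^sup>2 * (Ybar \<bullet> (X0 + t n *\<^sub>R Wn n))) =
        s * t n * (N \<bullet> (X0 + t n *\<^sub>R Wn n)) - C * (s * t n)\<^sup>2 * (Ybar \<bullet> (X0 + t n *\<^sub>R Wn n))"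
        using NX by (simp add: inner_add_right power2_eq_square algebra_simps)
      also have "\<dots> \<le> (1 + C * (s * t n)\<^sup>2) * gap (X0 + t n *\<^sub>R Wn n)"
        by (rule b) (use s t in simp)
      also have "\<dots> \<le> (1 + C * (s * t n)\<^sup>2) * (e n * (t n)\<^sup>2)"
        using e C by (intro mult_left_mono) auto
      finally have "(t n)\<^sup>2 * (s * (N \<bullet> Wn n) - C * s\<^sup>2 * (Ybar \<bullet> (X0 + t n *\<^sub>R Wn n))) \<le>
        (t n)\<^sup>2 * ((1 + C * (s * t n)\<^sup>2) * e n)" by (simp add: mult_ac)
      then show ?thesis using t[of n] by simp
    qed
    moreover have "(\<lambda>n. s * (N \<bullet> Wn n) - C * s\<^sup>2 * (Ybar \<bullet> (X0 + t n *\<^sub>R Wn n))) \<longlonglongrightarrow>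
        s * (N \<bullet> W) - C * s\<^sup>2 * (Ybar \<bullet> (X0 + 0 *\<^sub>R W))"
      by (intro tendsto_intros t0 W)
    moreover have "(\<lambda>n. (1 + C * (s * t n)\<^sup>2) * e n) \<longlonglongrightarrow> (1 + C * (s * 0)\<^sup>2) * 0"
      by (intro tendsto_intros t0 e0)
    ultimately show ?thesis using LIMSEQ_le[of _ _ "\<lambda>n. (1 + C * (s * t n)\<^sup>2) * e n"] by fastforce
  qed
  show ?thesis
  proof (rule ccontr)
    assume "\<not> ?thesis"
    then have pos: "N \<bullet> W > 0" by simp
    \<comment> \<open>Being larger than \<open>C (Ybar . X0)\<close> by at least 1, \<open>K\<close>
      makes the quadratic error at \<open>s = N . W / K\<close> smaller than \<open>N . W\<close>
      itself.\<close>
    define K where "K = C * \<bar>Ybar \<bullet> X0\<bar> + 1"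
    have K: "K > 0" using C by (simp add: K_def add_nonneg_pos)
    define s where "s = (N \<bullet> W) / K"
    have s: "s > 0" using pos K by (simp add: s_def)
    have "s * (N \<bullet> W) \<le> s * (s * (C * (Ybar \<bullet> X0)))" using main[OF s] by (simp add: power2_eq_square mult_ac)
    then have "N \<bullet> W \<le> s * (C * (Ybar \<bullet> X0))" using s by simp
    also have "\<dots> \<le> s * (K - 1)" using s C by (intro mult_left_mono) (auto simp: K_def intro: mult_left_mono)
    also have "\<dots> < s * K" using s by simp
    also have "\<dots> = N \<bullet> W" using K by (simp add: s_def)
    finally show False by simp
  qed
qed

end

section \<open>The normal cone and its tangent cone\<close>

lemma norm_matrix_vector_le: "norm (X *v x) \<le> norm X * norm x" for X :: "real^'n^'m"
proof -
  have "(norm (X *v x))\<^sup>2 = (\<Sum>i\<in>UNIV. (X $ i \<bullet> x)\<^sup>2)"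
    by (simp add: power2_norm_eq_inner inner_vec_def matrix_vector_mult_def) (simp add: power2_eq_square)
  also have "\<dots> \<le> (\<Sum>i\<in>UNIV. (X $ i \<bullet> X $ i) * (x \<bullet> x))"
    by (intro sum_mono Cauchy_Schwarz_ineq)
  also have "\<dots> = (X \<bullet> X) * (x \<bullet> x)" by (simp add: inner_vec_def[of X] sum_distrib_right)
  also have "\<dots> = (norm X * norm x)\<^sup>2" by (simp add: power_mult_distrib power2_norm_eq_inner)
  finally show ?thesis using power2_le_imp_le[of "norm (X *v x)" "norm X * norm x"] by simp
qed

text \<open>Test with \<open>X\<close> divided by its Frobenius norm, a contraction because that
  norm dominates the spectral one. The use is definiteness: a vanishing nuclear norm forces
  \<open>X = 0\<close>.\<close>

lemma norm_le_nuclear_norm: "norm X \<le> nuclear_norm X"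
  for X :: "('n1::{finite,linorder}, 'n2::{finite,linorder}) rmatrix"
proof (cases "X = 0")
  case True
  have "contraction (0 :: ('n1, 'n2) rmatrix)" by (simp add: contraction_def)
  from inner_le_nuclear_norm[OF this, of X] True show ?thesis by simp
next
  case False
  have "norm (((1 / norm X) *\<^sub>R X) *v x) \<le> norm x" for x
  proof -
    have "norm (((1 / norm X) *\<^sub>R X) *v x) = norm (X *v x) / norm X"
      unfolding scaleR_matrix_vector_assoc[symmetric] by simp
    then show ?thesis using norm_matrix_vector_le[of X x] False by (simp add: pos_divide_le_eq mult.commute)
  qed
  then have "contraction ((1 / norm X) *\<^sub>R X)" by (simp add: contraction_def)
  from inner_le_nuclear_norm[OF this, of X] show ?thesis
    using False by (simp add: dot_square_norm power2_eq_square)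
qed

lemma nuclear_norm_nonneg: "0 \<le> nuclear_norm X"
  using norm_le_nuclear_norm[of X] norm_ge_zero[of X] by linarith

lemma nuclear_norm_scale_le:
  fixes X :: "('n1::{finite,linorder}, 'n2::{finite,linorder}) rmatrix"
  assumes "t \<ge> 0"
  shows "nuclear_norm (t *\<^sub>R X) \<le> t * nuclear_norm X"
proof -
  obtain Z where "contraction Z" "Z \<bullet> (t *\<^sub>R X) = nuclear_norm (t *\<^sub>R X)"
    using nuclear_norm_attained by blast
  then show ?thesis using inner_le_nuclear_norm[of Z X] assms
    by (metis inner_scaleR_right mult_left_mono)
qed

lemma nuclear_norm_zero [simp]: "nuclear_norm (0 :: ('n1::{finite,linorder}, 'n2::{finite,linorder}) rmatrix) = 0"
  using nuclear_norm_scale_le[of 0 "0 :: ('n1, 'n2) rmatrix"] nuclear_norm_nonneg[of "0 :: ('n1, 'n2) rmatrix"] by simp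

lemma onb_expand_cart:
  fixes u :: "nat \<Rightarrow> real ^ 'n"
  assumes "onb u"
  shows "x = (\<Sum>k<CARD('n). (u k \<bullet> x) *\<^sub>R u k)"
  by (rule onb_expand[OF assms, simplified])

lemma onb_eqI:
  fixes u :: "nat \<Rightarrow> 'a::euclidean_space"
  assumes "onb u" "\<And>k. k < DIM('a) \<Longrightarrow> u k \<bullet> x = u k \<bullet> y"
  shows "x = y"
proof -
  have "(norm (x - y))\<^sup>2 = 0"
    unfolding onb_norm[OF assms(1)] using assms(2) by (simp add: inner_diff_right)
  then show ?thesis by simp
qed

context svd_frame
begin

text \<open>The bilinear form of the leading \<open>p\<close> by \<open>p\<close> block in the
  matched bases (see \<open>BW_coord\<close>).\<close>

definition BW :: "('n1, 'n2) rmatrix \<Rightarrow> (nat \<Rightarrow> real) \<Rightarrow> (nat \<Rightarrow> real) \<Rightarrow> real" where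
  "BW W a b = ucomb a \<bullet> (W *v vcomb b)"

lemma BW_coord: "BW W a b = (\<Sum>k<p. \<Sum>l<p. a k * b l * coord W k l)"
  unfolding BW_def ucomb_def vcomb_def coord_def
  by (simp add: inner_sum_left inner_sum_right linear_sum[OF matrix_vector_mul_linear]
      matrix_vector_mult_scaleR sum_distrib_left mult_ac) (rule sum.swap)

lemma BW_add: "BW (X + Z) a b = BW X a b + BW Z a b"
  by (simp add: BW_coord coord_add distrib_left sum.distrib)

lemma BW_scale: "BW (s *\<^sub>R X) a b = s * BW X a b"
  by (simp add: BW_coord coord_scale sum_distrib_left mult_ac)

lemma norm_ucomb: "(norm (ucomb a))\<^sup>2 = (\<Sum>k<p. (a k)\<^sup>2)"
proof -
  have "u k \<bullet> ucomb a = (if k < p then a k else 0)" if "k < CARD('n1)" for k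
  proof -
    have "u k \<bullet> ucomb a = (\<Sum>l<p. if l = k then a l else 0)"
      unfolding ucomb_def inner_sum_right using that pn by (intro sum.cong) (auto simp: uu)
    then show ?thesis by simp
  qed
  then have "(norm (ucomb a))\<^sup>2 = (\<Sum>k<CARD('n1). (if k < p then a k else 0)\<^sup>2)"
    by (simp add: onb_norm[OF u])
  also have "\<dots> = (\<Sum>k<p. (a k)\<^sup>2)"
    using pn by (intro sum.mono_neutral_cong_right) auto
  finally show ?thesis .
qed

lemma norm_vcomb: "(norm (vcomb a))\<^sup>2 = (\<Sum>k<p. (a k)\<^sup>2)"
proof -
  have "v k \<bullet> vcomb a = (if k < p then a k else 0)" if "k < CARD('n2)" for k
  proof -
    have "v k \<bullet> vcomb a = (\<Sum>l<p. if l = k then a l else 0)"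
      unfolding vcomb_def inner_sum_right using that pn nn by (intro sum.cong) (auto simp: vv)
    then show ?thesis by simp
  qed
  then have "(norm (vcomb a))\<^sup>2 = (\<Sum>k<CARD('n2). (if k < p then a k else 0)\<^sup>2)"
    by (simp add: onb_norm[OF v])
  also have "\<dots> = (\<Sum>k<p. (a k)\<^sup>2)"
    using pn nn by (intro sum.mono_neutral_cong_right) auto
  finally show ?thesis .
qed

lemma norm_vcomb_eq: "norm (vcomb a) = norm (ucomb a)"
  using norm_vcomb[of a] norm_ucomb[of a] by (metis norm_ge_zero power2_eq_imp_eq)

text \<open>The linear span of the normal cone, which adds only semidefiniteness.\<close>

definition supported :: "('n1, 'n2) rmatrix \<Rightarrow> bool" where
  "supported W \<longleftrightarrow> (\<forall>k<p. \<forall>l<p. coord W k l = coord W l k) \<and>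
     (\<forall>k<CARD('n1). \<forall>l<CARD('n2). p \<le> k \<or> p \<le> l \<longrightarrow> coord W k l = 0)"

text \<open>The normal cone to the spectral unit ball at \<open>Ybar\<close>, and the tangent cone at \<open>Xbar\<close> to it.\<close>

definition in_cone :: "('n1, 'n2) rmatrix \<Rightarrow> bool" where
  "in_cone X \<longleftrightarrow> supported X \<and> (\<forall>a. 0 \<le> BW X a a)"

definition in_tangent :: "('n1, 'n2) rmatrix \<Rightarrow> bool" where
  "in_tangent W \<longleftrightarrow> supported W \<and> (\<forall>a. (\<forall>k<r. a k = 0) \<longrightarrow> 0 \<le> BW W a a)"

lemma inner_outer_coord: "outer (u k) (v l) \<bullet> W = coord W k l"
  by (simp add: inner_commute[of _ W] inner_outer coord_def)

text \<open>Each family of admissible directions yields one condition. The first two families are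
  orthogonal to any supported \<open>X0\<close>; only the third requires
  \<open>BW X0 a a = 0\<close>. With \<open>X0 = 0\<close> this characterises the cone, with
  \<open>X0 = Xbar\<close> its tangent cone.\<close>

lemma supported_of_tests:
  assumes test: "\<And>N. admissible N \<Longrightarrow> N \<bullet> X0 = 0 \<Longrightarrow> N \<bullet> W \<le> 0"
    and X0: "supported X0"
  shows "supported W" and "BW X0 a a = 0 \<Longrightarrow> 0 \<le> BW W a a"
proof -
  have sym: "coord W i j \<le> coord W j i" if "i < p" "j < p" for i j
    using test[OF admissible_skew[OF that]] that X0
    by (simp add: inner_diff_left inner_outer_coord supported_def)
  have off: "coord W i j = 0" if ij: "i < CARD('n1)" "j < CARD('n2)" "p \<le> i \<or> p \<le> j" for i j
  proof -
    have "coord X0 i j = 0" using X0 ij by (auto simp: supported_def)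
    then have "s * coord W i j \<le> 0" for s
      using test[OF admissible_off[OF ij, of s]] by (simp add: inner_outer_coord)
    from this[of 1] this[of "-1"] show ?thesis by simp
  qed
  have "coord W i j = coord W j i" if "i < p" "j < p" for i j
    using sym[OF that] sym[OF that(2,1)] by simp
  with off show "supported W" unfolding supported_def by simp
  have "outer (ucomb a) (vcomb a) \<bullet> Z = BW Z a a" for Z
    by (simp add: inner_commute[of _ Z] inner_outer BW_def)
  then show "0 \<le> BW W a a" if "BW X0 a a = 0"
    using test[OF admissible_neg[of a]] that by simp
qed

text \<open>A positive semidefinite matrix has nuclear norm equal to its trace, and the pairing with
  \<open>Ybar\<close> is the trace of the leading block.\<close>

lemma gap_eq_0_if_in_cone:
  assumes X: "in_cone X"
  shows "gap X = 0"
proof -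
  let ?t = Finite_Cartesian_Product.transpose
  \<comment> \<open>The partial isometry sending \<open>v k\<close> to \<open>u k\<close> for
    \<open>k < p\<close>. Multiplying by its transpose turns the rectangular \<open>X\<close> into a
    square matrix \<open>S\<close> on the left space, where the spectral theorem applies.\<close>
  define J where "J = (\<Sum>k\<in>{..<p}. 1 *\<^sub>R outer (u k) (v k))"
  have cJ: "coord J k l = (if k = l \<and> k < p then 1 else 0)" if "k < CARD('n1)" "l < CARD('n2)" for k l
    unfolding J_def using that pn by (subst coord_diag) auto
  have Jt: "u k v* J = (if k < p then v k else 0)" if k: "k < CARD('n1)" for k
  proof -
    have "x \<bullet> (u k v* J) = x \<bullet> (if k < p then v k else 0)" for x
    proof -
      have "x \<bullet> (u k v* J) = u k \<bullet> (J *v x)" by (simp add: inner_commute[of x] dot_lmul_matrix)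
      also have "\<dots> = (\<Sum>l<CARD('n2). if k = l then (if k < p then v k \<bullet> x else 0) else 0)"
        unfolding coord_apply using k by (intro sum.cong) (auto simp: cJ)
      also have "\<dots> = x \<bullet> (if k < p then v k else 0)"
        using k nn by (simp add: inner_commute)
      finally show ?thesis .
    qed
    then show ?thesis using vector_eq_ldot by blast
  qed
  define S where "S = X ** ?t J"
  have Su: "S *v u k = (if k < p then X *v v k else 0)" if "k < CARD('n1)" for k
    using Jt[OF that] by (simp add: S_def matrix_vector_mul_assoc[symmetric])
  have X0: "coord X k l = 0" if "k < CARD('n1)" "l < CARD('n2)" "p \<le> k \<or> p \<le> l" for k l
    using X that by (auto simp: in_cone_def supported_def)
  have cS: "u k \<bullet> (S *v u l) = u l \<bullet> (S *v u k)" if "k < CARD('n1)" "l < CARD('n1)" for k l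
  proof (cases "k < p \<and> l < p")
    case True
    then have "coord X k l = coord X l k" using X by (auto simp: in_cone_def supported_def)
    then show ?thesis using True that by (simp add: Su coord_def)
  next
    case False
    have "u i \<bullet> (S *v u j) = 0" if "i < CARD('n1)" "j < CARD('n1)" "\<not> (i < p \<and> j < p)" for i j
      using X0[of i j] that nn by (auto simp: Su coord_def)
    from this[of k l] this[of l k] show ?thesis using False that by auto
  qed
  have mS: "?t S = S"
  proof -
    have "u k \<bullet> (?t S *v x) = u k \<bullet> (S *v x)" if k: "k < CARD('n1)" for k x
    proof -
      have "u k \<bullet> (?t S *v x) = (S *v u k) \<bullet> x"
        by (simp add: inner_commute[of "u k"] dot_lmul_matrix inner_commute[of x])
      also have "\<dots> = (\<Sum>l<CARD('n1). (u l \<bullet> x) * (u l \<bullet> (S *v u k)))"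
        unfolding onb_inner[OF u, of "S *v u k" x] by (simp add: mult.commute)
      also have "\<dots> = (\<Sum>l<CARD('n1). (u l \<bullet> x) * (u k \<bullet> (S *v u l)))"
        using cS k by (intro sum.cong) auto
      also have "\<dots> = u k \<bullet> (S *v (\<Sum>l<CARD('n1). (u l \<bullet> x) *\<^sub>R u l))"
        by (simp add: linear_sum[OF matrix_vector_mul_linear] matrix_vector_mult_scaleR inner_sum_right)
      also have "(\<Sum>l<CARD('n1). (u l \<bullet> x) *\<^sub>R u l) = x"
        by (rule onb_expand_cart[OF u, symmetric])
      finally show ?thesis .
    qed
    then have "?t S *v x = S *v x" for x
      by (intro onb_eqI[OF u]) simp
    then show ?thesis by (subst matrix_eq) blast
  qed
  have vS: "x v* S = S *v x" for x using arg_cong[OF mS, of "\<lambda>A. A *v x"] by simp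
  from mS obtain q d where q: "onb q" and eig: "\<And>k. k < CARD('n1) \<Longrightarrow> S *v q k = d k *\<^sub>R q k"
    using symmetric_matrix_eigenbasis by blast
  have psd: "0 \<le> x \<bullet> (S *v x)" for x
  proof -
    define a where "a k = u k \<bullet> x" for k
    have Sx: "S *v x = X *v vcomb a"
    proof -
      have "S *v x = S *v (\<Sum>l<CARD('n1). a l *\<^sub>R u l)"
        unfolding a_def by (rule arg_cong[where f = "(*v) S"]) (rule onb_expand_cart[OF u])
      also have "\<dots> = (\<Sum>l<CARD('n1). a l *\<^sub>R (if l < p then X *v v l else 0))"
        by (simp add: linear_sum[OF matrix_vector_mul_linear] matrix_vector_mult_scaleR Su)
      also have "\<dots> = (\<Sum>l<p. a l *\<^sub>R (X *v v l))"
        using pn by (intro sum.mono_neutral_cong_right) auto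
      also have "\<dots> = X *v vcomb a"
        by (simp add: vcomb_def linear_sum[OF matrix_vector_mul_linear] matrix_vector_mult_scaleR)
      finally show ?thesis .
    qed
    have "x \<bullet> (X *v vcomb a) = (\<Sum>k<CARD('n1). a k * (u k \<bullet> (X *v vcomb a)))"
      by (simp add: onb_inner[OF u, of x] a_def)
    also have "\<dots> = (\<Sum>k<p. a k * (u k \<bullet> (X *v vcomb a)))"
      using pn X0 by (intro sum.mono_neutral_right) (auto simp: coord_apply)
    also have "\<dots> = BW X a a" by (simp add: BW_def ucomb_def inner_sum_left)
    finally show ?thesis using X Sx by (simp add: in_cone_def)
  qed
  have d: "0 \<le> d k" if "k < CARD('n1)" for k
    using psd[of "q k"] eig[OF that] q that by (simp add: onb_def)
  \<comment> \<open>Polar decomposition: \<open>X = S J\<close> with \<open>S\<close> symmetric,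
    hence \<open>X^T q = J^T S q = d J^T q\<close> for an eigenvector \<open>q\<close>.\<close>
  have XT: "q k v* X = d k *\<^sub>R (q k v* J)" if k: "k < CARD('n1)" for k
  proof -
    have XSJ: "X *v v l = S *v (J *v v l)" if l: "l < CARD('n2)" for l
    proof -
      have "J *v v l = (if l < p then u l else 0)"
      proof -
        have "J *v v l = (\<Sum>k<CARD('n1). (u k \<bullet> (J *v v l)) *\<^sub>R u k)"
          by (rule onb_expand_cart[OF u])
        also have "\<dots> = (\<Sum>k<CARD('n1). if k = l then (if l < p then u l else 0) else 0)"
          using l by (intro sum.cong refl) (auto simp: coord_def[symmetric] cJ)
        also have "\<dots> = (if l < p then u l else 0)" using pn by auto
        finally show ?thesis .
      qed
      moreover have "X *v v l = 0" if "p \<le> l"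
        using X0 l that by (intro onb_eqI[OF u]) (simp add: coord_def[symmetric])
      ultimately show ?thesis using Su[of l] pn by auto
    qed
    have "x \<bullet> (q k v* X) = x \<bullet> (d k *\<^sub>R (q k v* J))" for x
    proof -
      have "X = (\<Sum>l<CARD('n2). outer (X *v v l) (v l))" by (rule onb_outer_sum[OF v])
      also have "\<dots> = (\<Sum>l<CARD('n2). outer ((S ** J) *v v l) (v l))"
        using XSJ by (intro sum.cong refl) (simp add: matrix_vector_mul_assoc[symmetric])
      also have "\<dots> = S ** J" by (rule onb_outer_sum[OF v, symmetric])
      finally have "X *v x = S *v (J *v x)" by (simp add: matrix_vector_mul_assoc)
      then have "x \<bullet> (q k v* X) = q k \<bullet> (S *v (J *v x))"
        by (simp add: inner_commute[of x] dot_lmul_matrix)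
      also have "\<dots> = (S *v q k) \<bullet> (J *v x)"
        using transpose_dot[of S "q k" "J *v x"] mS by simp
      also have "\<dots> = x \<bullet> (d k *\<^sub>R (q k v* J))"
        using eig[OF k] by (simp add: inner_commute[of x] dot_lmul_matrix)
      finally show ?thesis .
    qed
    then show ?thesis using vector_eq_ldot by blast
  qed
  have nJ: "norm (x v* J) \<le> norm x" for x
  proof -
    have c: "v l \<bullet> (x v* J) = (if l < p then u l \<bullet> x else 0)" if l: "l < CARD('n2)" for l
    proof -
      have "v l \<bullet> (x v* J) = x \<bullet> (J *v v l)" by (simp add: inner_commute[of "v l"] dot_lmul_matrix)
      also have "\<dots> = (\<Sum>k<CARD('n1). (u k \<bullet> x) * (u k \<bullet> (J *v v l)))" by (simp add: onb_inner[OF u, of x])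
      also have "\<dots> = (\<Sum>k<CARD('n1). if k = l then (if l < p then u l \<bullet> x else 0) else 0)"
        using l by (intro sum.cong refl) (auto simp: coord_def[symmetric] cJ)
      also have "\<dots> = (if l < p then u l \<bullet> x else 0)" using pn by auto
      finally show ?thesis .
    qed
    have "(norm (x v* J))\<^sup>2 = (\<Sum>l<CARD('n2). (if l < p then u l \<bullet> x else 0)\<^sup>2)"
      by (simp add: onb_norm[OF v] c)
    also have "\<dots> = (\<Sum>l<p. (u l \<bullet> x)\<^sup>2)"
      using pn nn by (intro sum.mono_neutral_cong_right) auto
    also have "\<dots> \<le> (norm x)\<^sup>2"
      unfolding onb_norm[OF u, of x] using pn by (simp add: sum_mono2)
    finally show ?thesis using power2_le_imp_le[of "norm (x v* J)" "norm x"] by simp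
  qed
  \<comment> \<open>Outside the leading block \<open>X\<close> vanishes and inside it
    \<open>sg\<close> is 1, so the pairing is the trace of \<open>S\<close>. Pairing
    \<open>S\<close> with the identity matrix moves the trace from the basis \<open>u\<close> to the
    eigenbasis \<open>q\<close>.\<close>
  have tr: "Ybar \<bullet> X = (\<Sum>k<CARD('n1). d k)"
  proof -
    have "Ybar \<bullet> X = (\<Sum>k<CARD('n1). sg k * coord X k k)"
    proof -
      have "Ybar \<bullet> X = (\<Sum>k<CARD('n1). \<Sum>l<CARD('n2). if k = l then sg k * coord X k k else 0)"
        unfolding inner_coord by (intro sum.cong refl) (auto simp: coord_Y)
      also have "\<dots> = (\<Sum>k<CARD('n1). sg k * coord X k k)" using nn by (intro sum.cong) auto
      finally show ?thesis .
    qed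
    also have "\<dots> = (\<Sum>k<CARD('n1). u k \<bullet> (S *v u k))"
    proof (intro sum.cong refl)
      fix k assume "k \<in> {..<CARD('n1)}"
      then show "sg k * coord X k k = u k \<bullet> (S *v u k)"
        using X0[of k k] nn sg1[of k] by (cases "k < p") (auto simp: Su coord_def[symmetric])
    qed
    also have "\<dots> = (\<Sum>k<CARD('n1). u k \<bullet> (Finite_Cartesian_Product.mat 1 *v (u k v* S)))"
      by (simp add: vS)
    also have "\<dots> = (\<Sum>k<CARD('n1). q k \<bullet> (Finite_Cartesian_Product.mat 1 *v (q k v* S)))"
      by (rule trans[OF inner_onb_left[OF u, symmetric] inner_onb_left[OF q]])
    also have "\<dots> = (\<Sum>k<CARD('n1). q k \<bullet> (S *v q k))"
      by (simp add: vS)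
    also have "\<dots> = (\<Sum>k<CARD('n1). d k)"
      using eig q by (intro sum.cong) (auto simp: onb_def)
    finally show ?thesis .
  qed
  \<comment> \<open>For the dual maximiser each summand is \<open>d k\<close> times an inner product
    of vectors of length at most 1, so it cannot exceed the trace.\<close>
  obtain Z where Z: "contraction Z" "Z \<bullet> X = nuclear_norm X" by (rule nuclear_norm_attained[of X])
  have "q k \<bullet> (Z *v (q k v* X)) \<le> d k" if k: "k < CARD('n1)" for k
  proof -
    have q1: "norm (q k) = 1" using q k by (simp add: onb_def norm_eq_sqrt_inner)
    have "q k \<bullet> (Z *v (q k v* J)) \<le> norm (q k) * norm (Z *v (q k v* J))" by (rule norm_cauchy_schwarz)
    also have "\<dots> \<le> 1"
    proof -
      have "norm (Z *v (q k v* J)) \<le> norm (q k v* J)" using Z(1) by (simp add: contraction_def)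
      then show ?thesis using nJ[of "q k"] q1 by simp
    qed
    finally have "d k * (q k \<bullet> (Z *v (q k v* J))) \<le> d k * 1" using d[OF k] by (intro mult_left_mono)
    then show ?thesis using XT[OF k] by (simp add: matrix_vector_mult_scaleR)
  qed
  then have "Z \<bullet> X \<le> Ybar \<bullet> X"
    unfolding inner_onb_left[OF q, of Z X] tr by (intro sum_mono) auto
  with Z gap_ge0[of X] show ?thesis by (simp add: gap_def)
qed


lemma supported_Xbar: "supported Xbar"
  using rp pn nn ta0 by (auto simp: supported_def coord_X)

lemma BW_Xbar: "BW Xbar a a = (\<Sum>k<p. ta k * (a k)\<^sup>2)"
proof -
  have "BW Xbar a a = (\<Sum>k<p. \<Sum>l<p. if k = l then ta k * (a k)\<^sup>2 else 0)"
    unfolding BW_coord using pn nn by (intro sum.cong refl) (auto simp: coord_X power2_eq_square)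
  then show ?thesis by simp
qed

lemma ta_nonneg: "0 \<le> ta k"
  using ta_pos[of k] ta0[of k] by (cases "k < r") auto

lemma in_cone_Xbar: "in_cone Xbar"
  unfolding in_cone_def using supported_Xbar ta_nonneg by (auto simp: BW_Xbar intro!: sum_nonneg)

lemma gap_Xbar: "gap Xbar = 0"
  by (rule gap_eq_0_if_in_cone[OF in_cone_Xbar])

lemma gap_scale_le: "t \<ge> 0 \<Longrightarrow> gap (t *\<^sub>R X) \<le> t * gap X"
  using nuclear_norm_scale_le[of t X] by (simp add: gap_def right_diff_distrib)

text \<open>A vanishing gap persists on the ray through \<open>X\<close>, so \<open>gap_cone\<close>
  applies at the base point 0 with constant direction \<open>X\<close> and zero error.\<close>

lemma in_cone_if_gap_0:
  assumes "gap X = 0"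
  shows "in_cone X"
proof -
  have test: "N \<bullet> X \<le> 0" if "admissible N" for N
  proof (rule gap_cone[of N 0 "\<lambda>n. 1 / real (Suc n)" "\<lambda>_. X" X "\<lambda>_. 0"])
    show "admissible N" by (rule that)
    show "(\<lambda>n. 1 / real (Suc n)) \<longlonglongrightarrow> 0" by (rule LIMSEQ_Suc[OF lim_1_over_n])
    show "gap (0 + (1 / real (Suc n)) *\<^sub>R X) \<le> 0 * (1 / real (Suc n))\<^sup>2" for n
      using gap_scale_le[of "1 / real (Suc n)" X] assms by simp
  qed auto
  have "supported (0 :: ('n1, 'n2) rmatrix)" by (simp add: supported_def)
  from supported_of_tests[OF test this] show ?thesis
    by (simp add: in_cone_def BW_coord)
qed

text \<open>Coordinate form of \<open>\<E>\<close>, identified with it in \<open>set_E_eq\<close>.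
  The zero conditions on rows and columns have different ranges because the matrices are
  rectangular.\<close>

definition calE :: "('n1, 'n2) rmatrix set" where
  "calE = {W. \<forall>k<r. (\<forall>l<p. coord W k l = coord W l k) \<and> (\<forall>l. p \<le> l \<and> l < CARD('n2) \<longrightarrow> coord W k l = 0) \<and>
     (\<forall>l. p \<le> l \<and> l < CARD('n1) \<longrightarrow> coord W l k = 0)}"

definition calC :: "('n1, 'n2) rmatrix set" where
  "calC = {W. Emat \<bullet> W + nuclear_norm (PN W) = 0}"

lemma subspace_calE: "subspace calE"
  unfolding subspace_def calE_def by (auto simp: coord_simps intro!: arg_cong2[where f = "(+)"])

lemma inner_Y_split: "Ybar \<bullet> W = Emat \<bullet> W + Ybar \<bullet> PN W"
  using arg_cong[OF Y_split, of "\<lambda>Y. Y \<bullet> W"] by (simp add: inner_add_left PN_inner)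

text \<open>\<open>Y_split\<close> trades \<open>Emat . W\<close> for \<open>- Ybar . PN W\<close>;
  this is where orthogonality of the kernel to \<open>Ybar\<close> enters.\<close>

lemma calC_iff_gap: "Ybar \<bullet> W = 0 \<Longrightarrow> W \<in> calC \<longleftrightarrow> gap (PN W) = 0"
  using inner_Y_split[of W] by (auto simp: calC_def gap_def)

lemma BW_PN: "BW (PN W) a a = BW W (\<lambda>k. if r \<le> k then a k else 0) (\<lambda>k. if r \<le> k then a k else 0)"
  unfolding BW_coord using pn nn by (intro sum.cong refl) (auto simp: coord_PN)

text \<open>\<open>calE\<close> controls the coordinates with an index below \<open>r\<close>, and
  \<open>calC\<close> places the remaining block \<open>PN W\<close> in the cone. Coefficients
  vanishing below \<open>r\<close> see exactly that block.\<close>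

lemma in_tangent_iff:
  assumes "Ybar \<bullet> W = 0"
  shows "W \<in> calE \<inter> calC \<longleftrightarrow> in_tangent W"
proof
  assume "W \<in> calE \<inter> calC"
  then have E: "W \<in> calE" and K: "in_cone (PN W)"
    using calC_iff_gap[OF assms] in_cone_if_gap_0 by auto
  have sym: "coord W k l = coord W l k" if kl: "k < p" "l < p" for k l
  proof (cases "k < r \<or> l < r")
    case True
    then show ?thesis using E kl by (auto simp: calE_def)
  next
    case False
    have "coord (PN W) k l = coord (PN W) l k" using K kl by (auto simp: in_cone_def supported_def)
    then show ?thesis using kl False pn nn by (simp add: coord_PN)
  qed
  have zero: "coord W k l = 0" if kl: "k < CARD('n1)" "l < CARD('n2)" "p \<le> k \<or> p \<le> l" for k l
  proof (cases "k < r \<or> l < r")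
    case True
    then show ?thesis using E kl rp by (auto simp: calE_def)
  next
    case False
    have "coord (PN W) k l = 0" using K kl by (auto simp: in_cone_def supported_def)
    then show ?thesis using kl False by (simp add: coord_PN)
  qed
  have "0 \<le> BW W a a" if a: "\<forall>k<r. a k = 0" for a
  proof -
    have "(\<lambda>k. if r \<le> k then a k else 0) = a" using a by force
    moreover have "0 \<le> BW (PN W) a a" using K by (simp add: in_cone_def)
    ultimately show ?thesis using BW_PN[of W a] by simp
  qed
  with sym zero show "in_tangent W" by (simp add: in_tangent_def supported_def)
next
  assume W: "in_tangent W"
  have E: "W \<in> calE"
    using W rp pn nn unfolding calE_def in_tangent_def supported_def by auto
  have "supported (PN W)"
    using W pn nn by (auto simp: in_tangent_def supported_def coord_PN)
  moreover have "0 \<le> BW (PN W) a a" for a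
    using W unfolding BW_PN in_tangent_def by auto
  ultimately have "in_cone (PN W)" by (simp add: in_cone_def)
  then show "W \<in> calE \<inter> calC"
    using E calC_iff_gap[OF assms] gap_eq_0_if_in_cone by simp
qed

text \<open>The identity on the part of the leading block where \<open>Xbar\<close> vanishes, the
  only place that has no positive diagonal of its own.\<close>

definition Jmat :: "('n1, 'n2) rmatrix" where
  "Jmat = (\<Sum>k\<in>{r..<p}. 1 *\<^sub>R outer (u k) (v k))"

lemma coord_J: "k < CARD('n1) \<Longrightarrow> l < CARD('n2) \<Longrightarrow> coord Jmat k l = (if k = l \<and> r \<le> k \<and> k < p then 1 else 0)"
  unfolding Jmat_def using pn by (subst coord_diag) auto

lemma BW_J: "BW Jmat a a = (\<Sum>k<p. if r \<le> k then (a k)\<^sup>2 else 0)"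
proof -
  have "BW Jmat a a = (\<Sum>k<p. \<Sum>l<p. if k = l then (if r \<le> k then (a k)\<^sup>2 else 0) else 0)"
    unfolding BW_coord using pn nn by (intro sum.cong refl) (auto simp: coord_J power2_eq_square)
  then show ?thesis by simp
qed

lemma ucomb_add: "ucomb (\<lambda>k. a k + b k) = ucomb a + ucomb b"
  by (simp add: ucomb_def scaleR_left_distrib sum.distrib)

lemma vcomb_add: "vcomb (\<lambda>k. a k + b k) = vcomb a + vcomb b"
  by (simp add: vcomb_def scaleR_left_distrib sum.distrib)

text \<open>The tangent direction is corrected to second order by a multiple of \<open>Jmat\<close> (a Schur complement bound).\<close>

lemma cone_curve:
  assumes W: "in_tangent W"
  obtains b t0 where "0 \<le> b" "0 < t0" "\<And>t. 0 < t \<Longrightarrow> t < t0 \<Longrightarrow> in_cone (Xbar + t *\<^sub>R W + (t\<^sup>2 * b) *\<^sub>R Jmat)"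
proof -
  \<comment> \<open>A positive lower bound for the nonzero singular values of \<open>Xbar\<close>;
    the inserted 1 keeps the minimum meaningful when \<open>r = 0\<close>.\<close>
  define s where "s = Min (insert 1 (ta ` {..<r}))"
  have s: "0 < s" using ta_pos by (auto simp: s_def)
  have s_le: "s \<le> ta k" if "k < r" for k using that by (auto simp: s_def)
  define m where "m = norm W"
  have m: "0 \<le> m" by (simp add: m_def)
  \<comment> \<open>With \<open>t < t0\<close> the term \<open>t m A^2\<close> consumes at most half
    of \<open>s A^2\<close>. The value of \<open>b\<close> is the one that completes the square of
    the other half with the cross term \<open>2 t m A Z\<close>.\<close>
  define b where "b = 2 * m\<^sup>2 / s"
  define t0 where "t0 = s / (2 * m + 1)"
  have b: "0 \<le> b" using s by (simp add: b_def)
  have t0: "0 < t0" using s m by (simp add: t0_def)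
  have Wb: "\<bar>ucomb a \<bullet> (W *v vcomb a')\<bar> \<le> m * norm (ucomb a) * norm (ucomb a')" for a a'
  proof -
    have "\<bar>ucomb a \<bullet> (W *v vcomb a')\<bar> \<le> norm (ucomb a) * norm (W *v vcomb a')" by (rule Cauchy_Schwarz_ineq2)
    also have "\<dots> \<le> norm (ucomb a) * (m * norm (vcomb a'))"
      unfolding m_def by (intro mult_left_mono norm_matrix_vector_le) auto
    finally show ?thesis by (simp add: norm_vcomb_eq mult_ac)
  qed
  have "in_cone (Xbar + t *\<^sub>R W + (t\<^sup>2 * b) *\<^sub>R Jmat)" if t: "0 < t" "t < t0" for t
  proof -
    have "supported (Xbar + t *\<^sub>R W + (t\<^sup>2 * b) *\<^sub>R Jmat)"
      using W supported_Xbar pn nn unfolding in_tangent_def supported_def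
      by (auto simp: coord_simps coord_J)
    moreover have "0 \<le> BW (Xbar + t *\<^sub>R W + (t\<^sup>2 * b) *\<^sub>R Jmat) a a" for a
    proof -
      \<comment> \<open>The components below and from \<open>r\<close> on: \<open>Xbar\<close> is
        bounded below on the first, and the tangent condition applies to the second.\<close>
      define a1 where "a1 k = (if k < r then a k else 0)" for k
      define a2 where "a2 k = (if k < r then 0 else a k)" for k
      have aa: "a = (\<lambda>k. a1 k + a2 k)" by (auto simp: a1_def a2_def)
      define A where "A = norm (ucomb a1)"
      define Z where "Z = norm (ucomb a2)"
      have "BW Xbar a a \<ge> s * A\<^sup>2"
        unfolding BW_Xbar A_def norm_ucomb sum_distrib_left
        using s_le ta_nonneg by (intro sum_mono) (auto simp: a1_def mult_right_mono)
      moreover have "BW Jmat a a = Z\<^sup>2"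
        unfolding BW_J Z_def norm_ucomb by (intro sum.cong refl) (auto simp: a2_def)
      moreover have "BW W a a \<ge> - m * A\<^sup>2 - 2 * m * A * Z"
      proof -
        have "BW W a a = ucomb a1 \<bullet> (W *v vcomb a1) + ucomb a1 \<bullet> (W *v vcomb a2)
           + ucomb a2 \<bullet> (W *v vcomb a1) + BW W a2 a2"
          unfolding BW_def aa ucomb_add vcomb_add
          by (simp add: matrix_vector_right_distrib inner_add_left inner_add_right)
        moreover have "0 \<le> BW W a2 a2" using W by (simp add: in_tangent_def a2_def)
        ultimately show ?thesis
          using Wb[of a1 a1] Wb[of a1 a2] Wb[of a2 a1]
          by (simp add: A_def[symmetric] Z_def[symmetric] power2_eq_square abs_le_iff mult_ac)
      qed
      ultimately have "BW (Xbar + t *\<^sub>R W + (t\<^sup>2 * b) *\<^sub>R Jmat) a a \<ge>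
          s * A\<^sup>2 + t * (- m * A\<^sup>2 - 2 * m * A * Z) + t\<^sup>2 * b * Z\<^sup>2"
        unfolding BW_add BW_scale using t b by (intro add_mono mult_left_mono) auto
      moreover have "t * m * A\<^sup>2 \<le> s / 2 * A\<^sup>2"
      proof (intro mult_right_mono)
        have "t * m \<le> t0 * m" using t m by (intro mult_right_mono) auto
        also have "\<dots> \<le> s / 2" using s m by (simp add: t0_def field_simps)
        finally show "t * m \<le> s / 2" .
      qed simp
      moreover have "s / 2 * A\<^sup>2 - 2 * t * m * A * Z + t\<^sup>2 * b * Z\<^sup>2 = s / 2 * (A - 2 * t * m * Z / s)\<^sup>2"
        using s by (simp add: b_def power2_eq_square field_simps)
      moreover have "0 \<le> s / 2 * (A - 2 * t * m * Z / s)\<^sup>2" using s by simp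
      ultimately show ?thesis by (simp add: algebra_simps)
    qed
    ultimately show ?thesis by (simp add: in_cone_def)
  qed
  with b t0 that show ?thesis by blast
qed

end

section \<open>Quadratic growth\<close>

text \<open>Compactness of the sphere gives a coercivity constant \<open>l\<close> for the
  derivative of \<open>g\<close> at \<open>x0\<close>. Linearisation costs \<open>l / 2\<close>
  nearby, and integrating the remaining slope leaves \<open>l / 4\<close>. Membership in
  \<open>S\<close> is part of the conclusion because it keeps the extended-valued function
  finite.\<close>

lemma second_order_lower_bound:
  fixes f :: "'a::euclidean_space \<Rightarrow> real"
  assumes S: "open S" "x0 \<in> S" and f: "\<And>x. x \<in> S \<Longrightarrow> GDERIV f x :> g x"
    and g: "(g has_derivative H) (at x0)" and pd: "\<And>v. v \<noteq> 0 \<Longrightarrow> 0 < v \<bullet> H v"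
  shows "\<exists>k>0. \<exists>d>0. \<forall>y. norm (y - x0) \<le> d \<longrightarrow>
    y \<in> S \<and> f x0 + g x0 \<bullet> (y - x0) + k * (norm (y - x0))\<^sup>2 \<le> f y"
proof -
  have lin: "linear H" using g has_derivative_linear by blast
  have ne: "sphere (0::'a) 1 \<noteq> {}" by simp
  have "continuous_on (sphere 0 1) H"
    using lin linear_continuous_on linear_conv_bounded_linear by blast
  then have "continuous_on (sphere 0 1) (\<lambda>v. v \<bullet> H v)" by (intro continuous_intros)
  from continuous_attains_inf[OF compact_sphere ne this]
  obtain e where e: "e \<in> sphere 0 1" and inf: "\<forall>v\<in>sphere 0 1. e \<bullet> H e \<le> v \<bullet> H v" by blast
  define l where "l = e \<bullet> H e"
  have "e \<noteq> 0" using e by auto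
  then have l: "0 < l" using pd[of e] by (simp add: l_def)
  have coercive: "l * (norm v)\<^sup>2 \<le> v \<bullet> H v" for v
  proof (cases "v = 0")
    case False
    have "(1 / norm v) *\<^sub>R v \<in> sphere 0 1" using False by simp
    from bspec[OF inf this] have "l \<le> (v \<bullet> H v) / (norm v)\<^sup>2"
      unfolding l_def by (simp add: linear_scale[OF lin] power2_eq_square)
    then show ?thesis using False by (simp add: pos_le_divide_eq)
  qed (simp add: linear_0[OF lin])
  have "0 < l / 2" using l by simp
  then obtain d1 where d1: "0 < d1" and
    rem: "\<And>y. norm (y - x0) < d1 \<Longrightarrow> norm (g y - g x0 - H (y - x0)) \<le> l / 2 * norm (y - x0)"
    using g unfolding has_derivative_at_alt by blast
  obtain d2 where d2: "0 < d2" "ball x0 d2 \<subseteq> S" using S openE by blast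
  define d where "d = min d1 d2 / 2"
  have d: "0 < d" "d < d1" "d < d2" using d1 d2(1) by (auto simp: d_def)
  have "y \<in> S \<and> f x0 + g x0 \<bullet> (y - x0) + l / 4 * (norm (y - x0))\<^sup>2 \<le> f y" if y: "norm (y - x0) \<le> d" for y
  proof -
    define w where "w = y - x0"
    have inS: "x0 + s *\<^sub>R w \<in> S" and sw: "norm (s *\<^sub>R w) < d1" if "0 \<le> s" "s \<le> 1" for s
    proof -
      have "norm (s *\<^sub>R w) \<le> norm w" using that mult_right_mono[of s 1 "norm w"] by simp
      then have "norm (s *\<^sub>R w) \<le> d" using y by (simp add: w_def)
      then show "norm (s *\<^sub>R w) < d1" "x0 + s *\<^sub>R w \<in> S" using d d2(2) by (auto simp: dist_norm)
    qed
    \<comment> \<open>\<open>f\<close> along the segment minus the varying part of the claimed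
      bound; monotonicity on [0, 1] takes the place of a Taylor formula.\<close>
    define F where "F s = f (x0 + s *\<^sub>R w) - s * (g x0 \<bullet> w) - l / 4 * s\<^sup>2 * (norm w)\<^sup>2" for s
    have "F 0 \<le> F 1"
    proof (rule DERIV_nonneg_imp_nondecreasing[where f = F])
      fix s :: real assume s: "0 \<le> s" "s \<le> 1"
      have "(f has_derivative (\<lambda>h. h \<bullet> g (x0 + s *\<^sub>R w))) (at (x0 + s *\<^sub>R w))"
        using f[OF inS[OF s]] by (simp add: gderiv_def)
      then have "((\<lambda>s. f (x0 + s *\<^sub>R w)) has_derivative (\<lambda>h. (h *\<^sub>R w) \<bullet> g (x0 + s *\<^sub>R w))) (at s)"
        by (rule has_derivative_compose[rotated]) (auto intro!: derivative_eq_intros)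
      then have "((\<lambda>s. f (x0 + s *\<^sub>R w)) has_real_derivative (w \<bullet> g (x0 + s *\<^sub>R w))) (at s)"
        by (simp add: has_field_derivative_def mult_commute_abs)
      then have "(F has_real_derivative (w \<bullet> g (x0 + s *\<^sub>R w) - g x0 \<bullet> w - l / 2 * s * (norm w)\<^sup>2)) (at s)"
        unfolding F_def by (auto intro!: derivative_eq_intros)
      moreover have "0 \<le> w \<bullet> g (x0 + s *\<^sub>R w) - g x0 \<bullet> w - l / 2 * s * (norm w)\<^sup>2"
      proof -
        let ?r = "g (x0 + s *\<^sub>R w) - g x0 - H (s *\<^sub>R w)"
        have "\<bar>w \<bullet> ?r\<bar> \<le> norm w * norm ?r" by (rule Cauchy_Schwarz_ineq2)
        also have "\<dots> \<le> norm w * (l / 2 * norm (s *\<^sub>R w))"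
          using rem[of "x0 + s *\<^sub>R w"] sw[OF s] by (intro mult_left_mono) auto
        also have "\<dots> = l / 2 * s * (norm w)\<^sup>2" using s by (simp add: power2_eq_square)
        finally have "- (l / 2 * s * (norm w)\<^sup>2) \<le> w \<bullet> ?r" by linarith
        moreover have "w \<bullet> ?r = w \<bullet> g (x0 + s *\<^sub>R w) - g x0 \<bullet> w - s * (w \<bullet> H w)"
          by (simp add: inner_diff_right linear_scale[OF lin] inner_commute)
        moreover have "s * (l * (norm w)\<^sup>2) \<le> s * (w \<bullet> H w)" using coercive s by (intro mult_left_mono)
        ultimately show ?thesis by (simp add: algebra_simps)
      qed
      ultimately show "\<exists>y. (F has_real_derivative y) (at s) \<and> 0 \<le> y" by blast
    qed simp
    then have "f x0 + g x0 \<bullet> w + l / 4 * (norm w)\<^sup>2 \<le> f y" by (simp add: F_def w_def)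
    then show ?thesis using inS[of 1] by (simp add: w_def)
  qed
  moreover have "0 < l / 4" using l by simp
  ultimately show ?thesis using d(1) by blast
qed

context svd_frame
begin

text \<open>As \<open>Phi W = 0\<close>, \<open>Phi\<close> moves along the curve only by
  \<open>t^2 b Phi Jmat\<close>. The linear term of \<open>f\<close> cancels against
  \<open>mu (Ybar . X)\<close>, and a first-order remainder at distance O(t^2) is already
  o(t^2).\<close>

lemma kernel_trivial_if_growth:
  fixes Phi :: "('n1, 'n2) rmatrix \<Rightarrow> 'b::euclidean_space"
  assumes lin: "linear Phi" and f: "GDERIV f (Phi Xbar) :> g" and mu: "0 < mu"
    and Y: "Ybar = - (1 / mu) *\<^sub>R adjoint Phi g"
    and S: "open S" "Phi Xbar \<in> S" and c: "0 < c" and eps: "0 < eps"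
    and growth: "\<And>X. norm (X - Xbar) \<le> eps \<Longrightarrow> Phi X \<in> S \<Longrightarrow>
      c * (norm (X - Xbar))\<^sup>2 \<le> (f (Phi X) + mu * nuclear_norm X) - (f (Phi Xbar) + mu * nuclear_norm Xbar)"
    and W: "Phi W = 0" "in_tangent W"
  shows "W = 0"
proof (rule ccontr)
  assume W0: "W \<noteq> 0"
  obtain b t0 where b: "0 \<le> b" and t0: "0 < t0" and
    K: "\<And>t. 0 < t \<Longrightarrow> t < t0 \<Longrightarrow> in_cone (Xbar + t *\<^sub>R W + (t\<^sup>2 * b) *\<^sub>R Jmat)"
    using cone_curve[OF W(2)] by metis
  define j where "j = Phi Jmat"
  define Xt where "Xt t = Xbar + t *\<^sub>R W + (t\<^sup>2 * b) *\<^sub>R Jmat" for t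
  have YPhi: "mu * (Ybar \<bullet> X) = - (g \<bullet> Phi X)" for X
    using mu adjoint_works[OF lin, of X g] by (simp add: Y inner_commute)
  have PX: "Phi (Xt t) = Phi Xbar + (t\<^sup>2 * b) *\<^sub>R j" for t
    using W(1) by (simp add: Xt_def j_def linear_add[OF lin] linear_scale[OF lin])
  \<comment> \<open>Chosen so that the remainder \<open>e b (norm j) t^2\<close> is at most half of
    \<open>c (norm W)^2 t^2\<close>; the added 1 avoids division by zero.\<close>
  define e where "e = c * (norm W)\<^sup>2 / (2 * (b * norm j + 1))"
  have bj: "0 \<le> b * norm j" using b by simp
  have e: "0 < e" using c W0 bj by (simp add: e_def)
  obtain d where d: "0 < d" and
    rem: "\<And>y. norm (y - Phi Xbar) < d \<Longrightarrow>
      norm (f y - f (Phi Xbar) - (y - Phi Xbar) \<bullet> g) \<le> e * norm (y - Phi Xbar)"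
    using f e unfolding gderiv_def has_derivative_at_alt by blast
  have lim_t: "((\<lambda>t. t) \<longlongrightarrow> (0::real)) (at_right 0)" by (rule tendsto_ident_at)
  have limX: "(Xt \<longlongrightarrow> Xbar + 0 *\<^sub>R W + (0\<^sup>2 * b) *\<^sub>R Jmat) (at_right 0)"
    unfolding Xt_def by (intro tendsto_intros lim_t)
  then have "((\<lambda>t. norm (Xt t - Xbar)) \<longlongrightarrow> norm (Xbar - Xbar)) (at_right 0)"
    by (intro tendsto_intros) simp
  then have ev1: "\<forall>\<^sub>F t in at_right 0. norm (Xt t - Xbar) < eps"
    using eps by (intro order_tendstoD(2)[where y = "norm (Xbar - Xbar)"]) auto
  have limP: "((\<lambda>t. Phi (Xt t)) \<longlongrightarrow> Phi Xbar + (0\<^sup>2 * b) *\<^sub>R j) (at_right 0)"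
    unfolding PX by (intro tendsto_intros lim_t)
  then have ev2: "\<forall>\<^sub>F t in at_right 0. Phi (Xt t) \<in> S"
    using S by (intro topological_tendstoD) auto
  have "((\<lambda>t. norm (Phi (Xt t) - Phi Xbar)) \<longlongrightarrow> norm (Phi Xbar - Phi Xbar)) (at_right 0)"
    using limP by (intro tendsto_intros) simp
  then have ev3: "\<forall>\<^sub>F t in at_right 0. norm (Phi (Xt t) - Phi Xbar) < d"
    using d by (intro order_tendstoD(2)[where y = "norm (Phi Xbar - Phi Xbar)"]) auto
  have ev4: "\<forall>\<^sub>F t in at_right 0. 0 < t \<and> t < t0"
    using t0 by (auto simp: eventually_at_right_field intro!: exI[of _ t0])
  have ev: "\<forall>\<^sub>F t in at_right 0. c * (norm (W + (t * b) *\<^sub>R Jmat))\<^sup>2 \<le> e * (b * norm j)"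
    using ev1 ev2 ev3 ev4
  proof eventually_elim
    case (elim t)
    then have t: "0 < t" "t < t0" by auto
    have gap0: "gap (Xt t) = 0" unfolding Xt_def by (rule gap_eq_0_if_in_cone[OF K[OF t]])
    have "Xt t - Xbar = t *\<^sub>R (W + (t * b) *\<^sub>R Jmat)"
      by (simp add: Xt_def power2_eq_square scaleR_right_distrib mult.assoc)
    then have nX: "(norm (Xt t - Xbar))\<^sup>2 = t\<^sup>2 * (norm (W + (t * b) *\<^sub>R Jmat))\<^sup>2"
      by (simp add: power_mult_distrib)
    have "c * (norm (Xt t - Xbar))\<^sup>2 \<le>
        (f (Phi (Xt t)) + mu * nuclear_norm (Xt t)) - (f (Phi Xbar) + mu * nuclear_norm Xbar)"
      using elim by (intro growth) auto
    also have "\<dots> = f (Phi (Xt t)) - f (Phi Xbar) + (mu * (Ybar \<bullet> Xt t) - mu * (Ybar \<bullet> Xbar))"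
      using gap0 gap_Xbar by (simp add: gap_def)
    also have "\<dots> = f (Phi (Xt t)) - f (Phi Xbar) - (Phi (Xt t) - Phi Xbar) \<bullet> g"
      unfolding YPhi by (simp add: inner_diff_left inner_diff_right inner_commute)
    also have "\<dots> \<le> e * norm (Phi (Xt t) - Phi Xbar)" using rem[of "Phi (Xt t)"] elim by simp
    also have "\<dots> = t\<^sup>2 * (e * (b * norm j))" using b by (simp add: PX)
    finally show ?case using t by (simp add: nX mult.left_commute[of c])
  qed
  have "((\<lambda>t. c * (norm (W + (t * b) *\<^sub>R Jmat))\<^sup>2) \<longlongrightarrow> c * (norm (W + (0 * b) *\<^sub>R Jmat))\<^sup>2) (at_right 0)"
    by (intro tendsto_intros lim_t)
  then have "c * (norm (W + (0 * b) *\<^sub>R Jmat))\<^sup>2 \<le> e * (b * norm j)"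
    by (rule tendsto_upperbound[OF _ ev]) simp
  then have "c * (norm W)\<^sup>2 \<le> e * (b * norm j)" by simp
  also have "\<dots> \<le> e * (b * norm j + 1)" using e by simp
  also have "\<dots> = c * (norm W)\<^sup>2 / 2"
  proof -
    have cancel: "K / (2 * B) * B = K / 2" if "B \<noteq> 0" for K B :: real using that by simp
    have "b * norm j + 1 \<noteq> 0" using bj by linarith
    then show ?thesis unfolding e_def by (rule cancel)
  qed
  finally show False using c W0 by simp
qed

text \<open>The linear part of \<open>f\<close> cancels against \<open>mu (Ybar . X)\<close>,
  leaving a quadratic term in \<open>Phi\<close> and the gap. Both are nonnegative and share one
  small upper bound: the first sends the limit direction into the kernel, the second into the
  tangent cone.\<close>

lemma growth_if_kernel_trivial:
  fixes Phi :: "('n1, 'n2) rmatrix \<Rightarrow> 'b::euclidean_space"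
  assumes lin: "linear Phi" and mu: "0 < mu"
    and Y: "Ybar = - (1 / mu) *\<^sub>R adjoint Phi g"
    and k: "0 < k" and d: "0 < d"
    and low: "\<And>y. norm (y - Phi Xbar) \<le> d \<Longrightarrow>
      f (Phi Xbar) + g \<bullet> (y - Phi Xbar) + k * (norm (y - Phi Xbar))\<^sup>2 \<le> f y"
    and ker: "\<And>W. Phi W = 0 \<Longrightarrow> in_tangent W \<Longrightarrow> W = 0"
  shows "\<exists>c>0. \<exists>eps>0. \<forall>X. norm (X - Xbar) \<le> eps \<longrightarrow> norm (Phi X - Phi Xbar) \<le> d \<longrightarrow>
      c * (norm (X - Xbar))\<^sup>2 \<le> (f (Phi X) + mu * nuclear_norm X) - (f (Phi Xbar) + mu * nuclear_norm Xbar)"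
proof (rule ccontr)
  assume neg: "\<not> ?thesis"
  have YPhi: "mu * (Ybar \<bullet> X) = - (g \<bullet> Phi X)" for X
    using mu adjoint_works[OF lin, of X g] by (simp add: Y inner_commute)
  have "\<forall>n. \<exists>X. norm (X - Xbar) \<le> 1 / real (Suc n) \<and> norm (Phi X - Phi Xbar) \<le> d \<and>
      (f (Phi X) + mu * nuclear_norm X) - (f (Phi Xbar) + mu * nuclear_norm Xbar) <
      1 / real (Suc n) * (norm (X - Xbar))\<^sup>2"
  proof
    fix n
    have pos: "0 < 1 / real (Suc n)" by simp
    have "\<not> (\<forall>X. norm (X - Xbar) \<le> 1 / real (Suc n) \<longrightarrow> norm (Phi X - Phi Xbar) \<le> d \<longrightarrow>
      1 / real (Suc n) * (norm (X - Xbar))\<^sup>2 \<le>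
        (f (Phi X) + mu * nuclear_norm X) - (f (Phi Xbar) + mu * nuclear_norm Xbar))"
      using neg pos by blast
    then show "\<exists>X. norm (X - Xbar) \<le> 1 / real (Suc n) \<and> norm (Phi X - Phi Xbar) \<le> d \<and>
      (f (Phi X) + mu * nuclear_norm X) - (f (Phi Xbar) + mu * nuclear_norm Xbar) <
      1 / real (Suc n) * (norm (X - Xbar))\<^sup>2"
      by (simp only: not_all not_imp not_le)
  qed
  from choice[OF this] obtain X where
    X1: "\<And>n. norm (X n - Xbar) \<le> 1 / real (Suc n)" and X2: "\<And>n. norm (Phi (X n) - Phi Xbar) \<le> d" and
    X3: "\<And>n. (f (Phi (X n)) + mu * nuclear_norm (X n)) - (f (Phi Xbar) + mu * nuclear_norm Xbar) <
      1 / real (Suc n) * (norm (X n - Xbar))\<^sup>2" by blast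
  define t where "t n = norm (X n - Xbar)" for n
  define Wn where "Wn n = (1 / t n) *\<^sub>R (X n - Xbar)" for n
  \<comment> \<open>The strictness of \<open>X3\<close> excludes \<open>X n = Xbar\<close>, so the
    increments can be normalised.\<close>
  have t: "0 < t n" for n
  proof (rule ccontr)
    assume "\<not> 0 < t n"
    then have "X n = Xbar" by (simp add: t_def)
    with X3[of n] show False by simp
  qed
  have Xn: "X n = Xbar + t n *\<^sub>R Wn n" for n using t[of n] by (simp add: Wn_def)
  have key: "k * (norm (Phi (Wn n)))\<^sup>2 * (t n)\<^sup>2 + mu * gap (X n) \<le> 1 / real (Suc n) * (t n)\<^sup>2" for n
  proof -
    have dP: "Phi (X n) - Phi Xbar = t n *\<^sub>R Phi (Wn n)"
      unfolding Xn by (simp add: linear_add[OF lin] linear_scale[OF lin])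
    have "f (Phi Xbar) + g \<bullet> (Phi (X n) - Phi Xbar) + k * (norm (Phi (X n) - Phi Xbar))\<^sup>2 \<le> f (Phi (X n))"
      by (rule low[OF X2])
    moreover have "mu * nuclear_norm (X n) = mu * gap (X n) - g \<bullet> Phi (X n)"
      using YPhi[of "X n"] by (simp add: gap_def right_diff_distrib)
    moreover have "mu * nuclear_norm Xbar = - (g \<bullet> Phi Xbar)"
      using YPhi[of Xbar] gap_Xbar by (simp add: gap_def)
    moreover have "k * (norm (Phi (X n) - Phi Xbar))\<^sup>2 = k * (norm (Phi (Wn n)))\<^sup>2 * (t n)\<^sup>2"
      by (simp add: dP power_mult_distrib)
    moreover have "(f (Phi (X n)) + mu * nuclear_norm (X n)) - (f (Phi Xbar) + mu * nuclear_norm Xbar) <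
      1 / real (Suc n) * (t n)\<^sup>2" using X3[of n] by (simp add: t_def)
    ultimately show ?thesis by (simp add: inner_diff_right)
  qed
  have "Wn n \<in> sphere 0 1" for n using t[of n] by (simp add: Wn_def t_def)
  then obtain W \<rho> where W: "W \<in> sphere 0 1" and rho: "strict_mono (\<rho> :: nat \<Rightarrow> nat)" and lim: "(Wn \<circ> \<rho>) \<longlonglongrightarrow> W"
    using compact_sphere[of "0 :: ('n1, 'n2) rmatrix" 1] unfolding compact_def by meson
  have inv0: "(\<lambda>n. 1 / real (Suc n)) \<longlonglongrightarrow> 0" by (rule LIMSEQ_Suc[OF lim_1_over_n])
  then have inv\<rho>: "(\<lambda>n. 1 / real (Suc (\<rho> n))) \<longlonglongrightarrow> 0"
    using LIMSEQ_subseq_LIMSEQ[OF _ rho, of "\<lambda>n. 1 / real (Suc n)"] by (simp add: o_def)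
  have "t \<longlonglongrightarrow> 0"
    by (rule tendsto_sandwich[OF _ _ tendsto_const inv0])
      (use t[THEN less_imp_le] X1 in \<open>auto simp: t_def intro!: always_eventually\<close>)
  then have t\<rho>: "(\<lambda>n. t (\<rho> n)) \<longlonglongrightarrow> 0"
    using LIMSEQ_subseq_LIMSEQ[OF _ rho, of t] by (simp add: o_def)
  have "Phi W = 0"
  proof -
    have cont: "isCont Phi W" using lin linear_continuous_at linear_conv_bounded_linear by blast
    have "(\<lambda>n. Phi (Wn (\<rho> n))) \<longlonglongrightarrow> Phi W"
      using isCont_tendsto_compose[OF cont lim] by (simp add: o_def)
    then have "(\<lambda>n. k * (norm (Phi (Wn (\<rho> n))))\<^sup>2) \<longlonglongrightarrow> k * (norm (Phi W))\<^sup>2"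
      by (intro tendsto_intros)
    moreover have "k * (norm (Phi (Wn (\<rho> n))))\<^sup>2 \<le> 1 / real (Suc (\<rho> n))" for n
    proof -
      have "0 \<le> mu * gap (X (\<rho> n))" using mu gap_ge0 by simp
      with key[of "\<rho> n"] have "k * (norm (Phi (Wn (\<rho> n))))\<^sup>2 * (t (\<rho> n))\<^sup>2 \<le> 1 / real (Suc (\<rho> n)) * (t (\<rho> n))\<^sup>2"
        by linarith
      then show ?thesis using t[of "\<rho> n"] by (simp only: mult_le_cancel_right_pos zero_less_power)
    qed
    ultimately have "k * (norm (Phi W))\<^sup>2 \<le> 0" using LIMSEQ_le[OF _ inv\<rho>] by blast
    then show ?thesis using k by (simp add: mult_le_0_iff)
  qed
  moreover have "in_tangent W"
  proof -
    have test: "N \<bullet> W \<le> 0" if "admissible N" "N \<bullet> Xbar = 0" for N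
    proof (rule gap_cone[OF that, of "\<lambda>n. t (\<rho> n)" "\<lambda>n. Wn (\<rho> n)" W "\<lambda>n. (1 / mu) * (1 / real (Suc (\<rho> n)))"])
      show "(\<lambda>n. Wn (\<rho> n)) \<longlonglongrightarrow> W" using lim by (simp add: o_def)
      show "(\<lambda>n. (1 / mu) * (1 / real (Suc (\<rho> n)))) \<longlonglongrightarrow> 0" using tendsto_mult_right_zero[OF inv\<rho>] .
      show "gap (Xbar + t (\<rho> n) *\<^sub>R Wn (\<rho> n)) \<le> (1 / mu) * (1 / real (Suc (\<rho> n))) * (t (\<rho> n))\<^sup>2" for n
      proof -
        have "0 \<le> k * (norm (Phi (Wn (\<rho> n))))\<^sup>2 * (t (\<rho> n))\<^sup>2" using k by simp
        with key[of "\<rho> n"] have "mu * gap (X (\<rho> n)) \<le> 1 / real (Suc (\<rho> n)) * (t (\<rho> n))\<^sup>2" by linarith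
        from mult_left_mono[OF this, of "1 / mu"] show ?thesis using mu by (simp add: Xn[symmetric])
      qed
    qed (use t t\<rho> in auto)
    have "BW Xbar a a = 0" if "\<forall>k<r. a k = 0" for a
      unfolding BW_Xbar using that ta0 by (intro sum.neutral) (metis mult_eq_0_iff not_le power_zero_numeral)
    with supported_of_tests[OF test supported_Xbar] show ?thesis
      by (simp add: in_tangent_def)
  qed
  ultimately have "W = 0" by (rule ker)
  with W show False by simp
qed

end

section \<open>Source conditions by separation\<close>

context svd_frame
begin

text \<open>\<open>PN\<close> compresses a matrix between two orthogonal projections;
  \<open>x'\<close> is the projection of \<open>x\<close> on the right.\<close>

lemma contraction_PN:
  assumes "contraction Z"
  shows "contraction (PN Z)"
  unfolding contraction_def
proof
  fix x
  define x' where "x' = (\<Sum>l\<in>{r..<CARD('n2)}. (v l \<bullet> x) *\<^sub>R v l)"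
  have vx': "v l \<bullet> x' = (if r \<le> l then v l \<bullet> x else 0)" if "l < CARD('n2)" for l
  proof -
    have "v l \<bullet> x' = (\<Sum>m\<in>{r..<CARD('n2)}. if m = l then v m \<bullet> x else 0)"
      unfolding x'_def inner_sum_right using that by (intro sum.cong) (auto simp: vv)
    then show ?thesis using that by simp
  qed
  have "(norm x')\<^sup>2 \<le> (norm x)\<^sup>2"
    unfolding onb_norm[OF v] by (intro sum_mono) (auto simp: vx')
  then have nx': "norm x' \<le> norm x" using power2_le_imp_le[of "norm x'" "norm x"] by simp
  have uPN: "u k \<bullet> (PN Z *v x) = (if r \<le> k then u k \<bullet> (Z *v x') else 0)" if "k < CARD('n1)" for k
    unfolding coord_apply using that by (auto simp: coord_PN vx' intro!: sum.cong)
  have "(norm (PN Z *v x))\<^sup>2 \<le> (norm (Z *v x'))\<^sup>2"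
    unfolding onb_norm[OF u] by (intro sum_mono) (auto simp: uPN)
  then have "norm (PN Z *v x) \<le> norm (Z *v x')"
    using power2_le_imp_le[of "norm (PN Z *v x)" "norm (Z *v x')"] by simp
  also have "\<dots> \<le> norm x'" using assms by (simp add: contraction_def)
  finally show "norm (PN Z *v x) \<le> norm x" using nx' by simp
qed

text \<open>A maximiser for \<open>PN W\<close> may be compressed by the self-adjoint
  \<open>PN\<close>, so the supremum is attained inside the complement of \<open>T\<close>.\<close>

lemma nuclear_norm_PN_attained: "\<exists>Z. contraction Z \<and> PN Z = Z \<and> Z \<bullet> W = nuclear_norm (PN W)"
proof -
  obtain Z where Z: "contraction Z" "Z \<bullet> PN W = nuclear_norm (PN W)"
    by (rule nuclear_norm_attained[of "PN W"])
  then show ?thesis using contraction_PN[OF Z(1)] PN_inner[of Z W] by (intro exI[of _ "PN Z"]) simp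
qed

text \<open>If no \<open>N\<close> works, 0 lies outside the convex set \<open>S\<close>, and a
  separating vector \<open>a\<close> must annihilate the subspace summand, so \<open>a\<close> lies
  in \<open>L\<close>. Optimising over \<open>N\<close> then puts \<open>- a\<close> in
  \<open>calC\<close>. Conversely, a strict contraction attains the nuclear norm of
  \<open>PN W\<close> only if \<open>PN W = 0\<close>, and injectivity finishes.\<close>

lemma source_condition_iff:
  assumes L: "subspace L" and YL: "\<And>W. W \<in> L \<Longrightarrow> Ybar \<bullet> W = 0"
  shows "L \<inter> calC = {0} \<longleftrightarrow> (\<forall>W\<in>L. PN W = 0 \<longrightarrow> W = 0) \<and>
    (\<exists>N. PN N = N \<and> (\<exists>\<rho><1. \<forall>x. norm (N *v x) \<le> \<rho> * norm x) \<and> (\<forall>W\<in>L. (Emat + N) \<bullet> W = 0))"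
    (is "?ii \<longleftrightarrow> ?a \<and> (\<exists>N. ?b N)")
proof
  assume ii: ?ii
  have "W = 0" if W: "W \<in> L" "PN W = 0" for W
  proof -
    have "W \<in> calC" using calC_iff_gap[OF YL[OF W(1)]] W(2) by (simp add: gap_def)
    with W ii show ?thesis by blast
  qed
  moreover have "\<exists>N. ?b N"
  proof (rule ccontr)
    assume no: "\<not> (\<exists>N. ?b N)"
    \<comment> \<open>Strict contractions form the open unit ball of the complement of
      \<open>T\<close>, so \<open>S\<close> need not be closed; the separation used for it asks only
      for convexity.\<close>
    define B where "B = {N. PN N = N \<and> (\<exists>\<rho><1. \<forall>x. norm (N *v x) \<le> \<rho> * norm x)}"
    define S where "S = {Emat + N + l | N l. N \<in> B \<and> l \<in> L\<^sup>\<bottom>}"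
    have "0 \<notin> S"
    proof
      assume "0 \<in> S"
      then obtain N l where Nl: "N \<in> B" "l \<in> L\<^sup>\<bottom>" "Emat + N + l = 0" unfolding S_def by force
      then have "Emat + N = - l" using add_eq_0_iff2 by blast
      then have "(Emat + N) \<bullet> W = 0" if "W \<in> L" for W
        using Nl(2) that by (simp add: orthogonal_comp_def real_inner_class.orthogonal_def inner_commute[of l])
      with Nl(1) no show False unfolding B_def by blast
    qed
    moreover have "convex S"
    proof (rule convexI)
      fix x y and s t :: real
      assume "x \<in> S" "y \<in> S" and st: "0 \<le> s" "0 \<le> t" "s + t = 1"
      then obtain N l N' l' where N: "N \<in> B" "l \<in> L\<^sup>\<bottom>" "x = Emat + N + l"
        and N': "N' \<in> B" "l' \<in> L\<^sup>\<bottom>" "y = Emat + N' + l'" unfolding S_def by blast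
      obtain \<rho> where \<rho>: "\<rho> < 1" "\<And>x. norm (N *v x) \<le> \<rho> * norm x" using N(1) unfolding B_def by blast
      obtain \<rho>' where \<rho>': "\<rho>' < 1" "\<And>x. norm (N' *v x) \<le> \<rho>' * norm x" using N'(1) unfolding B_def by blast
      define R where "R = max \<rho> \<rho>'"
      have R: "R < 1" using \<rho>(1) \<rho>'(1) by (simp add: R_def)
      have NR: "norm (N *v x) \<le> R * norm x" "norm (N' *v x) \<le> R * norm x" for x
        using \<rho>(2)[of x] \<rho>'(2)[of x] mult_right_mono[of \<rho> R "norm x"] mult_right_mono[of \<rho>' R "norm x"]
        by (auto simp: R_def)
      have "norm ((s *\<^sub>R N + t *\<^sub>R N') *v x) \<le> R * norm x" for x
      proof -
        have "norm ((s *\<^sub>R N + t *\<^sub>R N') *v x) = norm (s *\<^sub>R (N *v x) + t *\<^sub>R (N' *v x))"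
          by (simp add: matrix_vector_mult_add_rdistrib scaleR_matrix_vector_assoc[symmetric])
        also have "\<dots> \<le> s * norm (N *v x) + t * norm (N' *v x)"
          using norm_triangle_ineq[of "s *\<^sub>R (N *v x)" "t *\<^sub>R (N' *v x)"] st by simp
        also have "\<dots> \<le> s * (R * norm x) + t * (R * norm x)"
          using NR st by (intro add_mono mult_left_mono) auto
        also have "\<dots> = (s + t) * (R * norm x)" by (simp add: distrib_right)
        finally show ?thesis using st by simp
      qed
      moreover have "PN (s *\<^sub>R N + t *\<^sub>R N') = s *\<^sub>R PN N + t *\<^sub>R PN N'"
        by (rule coord_eqI) (simp add: coord_PN coord_simps)
      ultimately have "s *\<^sub>R N + t *\<^sub>R N' \<in> B" using R N(1) N'(1) unfolding B_def by auto
      moreover have "s *\<^sub>R l + t *\<^sub>R l' \<in> L\<^sup>\<bottom>"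
        using N(2) N'(2) by (intro subspace_add subspace_scale subspace_orthogonal_comp)
      moreover have "s *\<^sub>R x + t *\<^sub>R y = Emat + (s *\<^sub>R N + t *\<^sub>R N') + (s *\<^sub>R l + t *\<^sub>R l')"
      proof -
        have "s *\<^sub>R Emat + t *\<^sub>R Emat = Emat" using st(3) by (metis scaleR_left_distrib scaleR_one)
        then show ?thesis unfolding N(3) N'(3) by (simp add: scaleR_right_distrib algebra_simps)
      qed
      ultimately show "s *\<^sub>R x + t *\<^sub>R y \<in> S" unfolding S_def by blast
    qed
    ultimately obtain a where a0: "a \<noteq> 0" and a: "\<And>x. x \<in> S \<Longrightarrow> 0 \<le> a \<bullet> x"
      using separating_hyperplane_set_0[of S] by blast
    have B0: "0 \<in> B" unfolding B_def by (auto intro!: coord_eqI simp: coord_PN exI[of _ 0])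
    have "a \<bullet> l = 0" if l: "l \<in> L\<^sup>\<bottom>" for l
    proof -
      have *: "0 \<le> a \<bullet> Emat + s * (a \<bullet> l)" for s
      proof -
        have "s *\<^sub>R l \<in> L\<^sup>\<bottom>" using l by (intro subspace_scale subspace_orthogonal_comp)
        then have "Emat + 0 + s *\<^sub>R l \<in> S" unfolding S_def using B0 by blast
        from a[OF this] show ?thesis by (simp add: inner_add_right)
      qed
      show ?thesis
      proof (rule ccontr)
        assume nz: "a \<bullet> l \<noteq> 0"
        have "(- (a \<bullet> Emat + 1) / (a \<bullet> l)) * (a \<bullet> l) = - (a \<bullet> Emat + 1)" using nz by simp
        with *[of "- (a \<bullet> Emat + 1) / (a \<bullet> l)"] show False by linarith
      qed
    qed
    then have "a \<in> L\<^sup>\<bottom>\<^sup>\<bottom>"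
      by (simp add: orthogonal_comp_def[of "L\<^sup>\<bottom>"] real_inner_class.orthogonal_def inner_commute)
    then have aL: "a \<in> L" using orthogonal_comp_self[OF L] by simp
    then have maL: "- a \<in> L" using L by (simp add: subspace_neg)
    obtain Z where Z: "contraction Z" "PN Z = Z" "Z \<bullet> (- a) = nuclear_norm (PN (- a))"
      using nuclear_norm_PN_attained[of "- a"] by blast
    \<comment> \<open>The maximiser \<open>Z\<close> lies on the boundary of the ball in general;
      the factor \<open>1 - s\<close> brings it inside \<open>B\<close>, and \<open>s\<close> then
      tends to 0.\<close>
    have "(1 - s) * nuclear_norm (PN (- a)) \<le> a \<bullet> Emat" if s: "0 < s" "s < 1" for s
    proof -
      have "norm (((1 - s) *\<^sub>R Z) *v x) \<le> (1 - s) * norm x" for x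
        using Z(1) s unfolding scaleR_matrix_vector_assoc[symmetric] by (simp add: contraction_def)
      moreover have "PN ((1 - s) *\<^sub>R Z) = (1 - s) *\<^sub>R PN Z"
        by (rule coord_eqI) (simp add: coord_PN coord_simps)
      ultimately have "(1 - s) *\<^sub>R Z \<in> B" using s Z(2) unfolding B_def by (auto intro!: exI[of _ "1 - s"])
      moreover have "0 \<in> L\<^sup>\<bottom>" by (intro subspace_0 subspace_orthogonal_comp)
      ultimately have "Emat + (1 - s) *\<^sub>R Z + 0 \<in> S" unfolding S_def by blast
      from a[OF this] have "0 \<le> a \<bullet> Emat + (1 - s) * (a \<bullet> Z)" by (simp add: inner_add_right)
      moreover have "nuclear_norm (PN (- a)) = - (a \<bullet> Z)" using Z(3) by (simp add: inner_commute)
      ultimately show ?thesis by simp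
    qed
    then have ev: "\<forall>\<^sub>F s in at_right 0. (1 - s) * nuclear_norm (PN (- a)) \<le> a \<bullet> Emat"
      by (auto simp: eventually_at_right_field intro!: exI[of _ 1])
    have "((\<lambda>s::real. (1 - s) * nuclear_norm (PN (- a))) \<longlongrightarrow> (1 - 0) * nuclear_norm (PN (- a))) (at_right 0)"
      by (intro tendsto_intros)
    then have "(1 - 0) * nuclear_norm (PN (- a)) \<le> a \<bullet> Emat"
      by (rule tendsto_upperbound[OF _ ev]) simp
    then have le: "Emat \<bullet> (- a) + nuclear_norm (PN (- a)) \<le> 0" by (simp add: inner_commute)
    \<comment> \<open>As \<open>Ybar\<close> is orthogonal to \<open>L\<close>, the left side of
      \<open>le\<close> equals the gap of \<open>PN (- a)\<close>. It is nonnegative, so the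
      inequality is an equality.\<close>
    have "Emat \<bullet> (- a) = - (Ybar \<bullet> PN (- a))" using inner_Y_split[of "- a"] YL[OF maL] by simp
    with le gap_ge0[of "PN (- a)"] have "- a \<in> calC" by (simp add: calC_def gap_def)
    with ii maL have "- a = 0" by blast
    with a0 show False by simp
  qed
  ultimately show "?a \<and> (\<exists>N. ?b N)" by blast
next
  assume R: "?a \<and> (\<exists>N. ?b N)"
  then obtain N \<rho> where N: "PN N = N" "\<rho> < 1" "\<And>x. norm (N *v x) \<le> \<rho> * norm x"
    "\<And>W. W \<in> L \<Longrightarrow> (Emat + N) \<bullet> W = 0" by blast
  \<comment> \<open>The maximum with 1/2 permits division, since \<open>\<rho>\<close> may be
    0.\<close>
  define s where "s = max \<rho> (1 / 2)"
  have s: "0 < s" "s < 1" using N(2) by (auto simp: s_def)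
  have "W = 0" if W: "W \<in> L" "W \<in> calC" for W
  proof -
    have "norm (((1 / s) *\<^sub>R N) *v x) \<le> norm x" for x
    proof -
      have "norm (N *v x) \<le> s * norm x"
        using N(3)[of x] mult_right_mono[of \<rho> s "norm x"] by (simp add: s_def)
      then show ?thesis using s unfolding scaleR_matrix_vector_assoc[symmetric]
        by (simp add: pos_divide_le_eq mult.commute)
    qed
    then have "contraction ((1 / s) *\<^sub>R N)" by (simp add: contraction_def)
    from inner_le_nuclear_norm[OF this, of "PN W"]
    have "N \<bullet> PN W \<le> s * nuclear_norm (PN W)" using s by (simp add: pos_divide_le_eq mult.commute)
    moreover have "N \<bullet> PN W = nuclear_norm (PN W)"
      using N(4)[OF W(1)] W(2) PN_inner[of N W] N(1) by (simp add: calC_def inner_add_left)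
    ultimately have "(1 - s) * nuclear_norm (PN W) \<le> 0" by (simp add: left_diff_distrib)
    then have "nuclear_norm (PN W) \<le> 0" using s by (simp add: mult_le_0_iff)
    then have "norm (PN W) \<le> 0" using norm_le_nuclear_norm[of "PN W"] by linarith
    then have "PN W = 0" by simp
    with R W(1) show ?thesis by blast
  qed
  moreover have "0 \<in> calC"
  proof -
    have "PN 0 = 0" by (rule coord_eqI) (simp add: coord_PN)
    then show ?thesis by (simp add: calC_def)
  qed
  ultimately show ?ii using subspace_0[OF L] by blast
qed

end

section \<open>Translation of the matrix definitions\<close>

lemma sum_lessThan_split: "r \<le> n \<Longrightarrow> (\<Sum>k<n. f k) = (\<Sum>k<r. f k) + (\<Sum>k<n-r. f (r + k))" for f :: "nat \<Rightarrow> 'a::comm_monoid_add"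
  using sum.atLeastLessThan_concat[of 0 r n f] sum.shift_bounds_nat_ivl[of f 0 r "n - r"]
  by (simp add: atLeast0LessThan add.commute)

text \<open>A downward closed set of indices is an initial segment, hence determined by its
  cardinality. Applied to the nonzero and to the unit singular values, it turns \<open>r\<close> and
  \<open>p\<close> into index bounds.\<close>

lemma down_closed_iff:
  fixes n :: nat
  assumes dc: "\<And>i j. i \<le> j \<Longrightarrow> j < n \<Longrightarrow> P j \<Longrightarrow> P i" and k: "k < n"
  shows "P k \<longleftrightarrow> k < card {i. i < n \<and> P i}"
proof
  assume "P k"
  then have "{..k} \<subseteq> {i. i < n \<and> P i}" using dc k by auto
  from card_mono[OF _ this] show "k < card {i. i < n \<and> P i}" by simp
next
  assume c: "k < card {i. i < n \<and> P i}"
  show "P k"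
  proof (rule ccontr)
    assume "\<not> P k"
    then have "{i. i < n \<and> P i} \<subseteq> {..<k}" using dc by (metis (mono_tags, lifting) lessThan_iff mem_Collect_eq not_le subsetI)
    from card_mono[OF _ this] c show False by simp
  qed
qed

text \<open>The list consists of real roots of a characteristic polynomial, so its length is not
  known beforehand and \<open>!\<close> might be out of range. A factorisation shows that its
  multiset consists of the absolute values of \<open>s ! k\<close> for \<open>k < m\<close>, which
  gives length and signs together; the order comes from sorting.\<close>

lemma SVD_pairs_singular_values:
  assumes A: "A \<in> carrier_mat m n" and mn: "m \<le> n" and UV: "(U, V) \<in> SVD_pairs A"
  defines "s \<equiv> singular_values A"
  shows "length s = m" "i < m \<Longrightarrow> 0 \<le> s ! i" "i \<le> j \<Longrightarrow> j < m \<Longrightarrow> s ! j \<le> s ! i"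
proof -
  let ?D = "Diag m n s"
  have U: "U \<in> orthogonal_mats m" and V: "V \<in> orthogonal_mats n" and Aeq: "A = U * ?D * V\<^sup>T"
    using UV A by (auto simp: SVD_pairs_def s_def)
  have Uc: "U \<in> carrier_mat m m" and Vc: "V \<in> carrier_mat n n" and VV: "V\<^sup>T * V = 1\<^sub>m n"
    using U V by (auto simp: orthogonal_mats_def)
  have Dc: "?D \<in> carrier_mat m n" by (simp add: Diag_def)
  have DD: "?D * ?D\<^sup>T = mat_diag m (\<lambda>k. (s ! k)\<^sup>2)"
  proof (rule eq_matI)
    fix i j assume "i < dim_row (mat_diag m (\<lambda>k. (s ! k)\<^sup>2))" "j < dim_col (mat_diag m (\<lambda>k. (s ! k)\<^sup>2))"
    then have ij: "i < m" "j < m" by (auto simp: mat_diag_def)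
    have "(?D * ?D\<^sup>T) $$ (i, j) = (\<Sum>k<n. (if i = k then s ! i else 0) * (if j = k then s ! j else 0))"
      using ij by (simp add: Diag_def scalar_prod_def atLeast0LessThan)
    also have "\<dots> = (\<Sum>k<n. if k = i then s ! i * (if j = i then s ! j else 0) else 0)"
      by (intro sum.cong) auto
    also have "\<dots> = mat_diag m (\<lambda>k. (s ! k)\<^sup>2) $$ (i, j)"
      using ij mn by (simp add: mat_diag_def power2_eq_square)
    finally show "(?D * ?D\<^sup>T) $$ (i, j) = mat_diag m (\<lambda>k. (s ! k)\<^sup>2) $$ (i, j)" .
  qed (auto simp: mat_diag_def Diag_def)
  have UDc: "U * ?D \<in> carrier_mat m n" and Vt: "V\<^sup>T \<in> carrier_mat n n" and Ut: "U\<^sup>T \<in> carrier_mat m m"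
    and Dt: "?D\<^sup>T \<in> carrier_mat n m" using Uc Vc Dc by auto
  have Xc: "?D\<^sup>T * U\<^sup>T \<in> carrier_mat n m" using Dt Ut by simp
  have "A\<^sup>T = V * (?D\<^sup>T * U\<^sup>T)"
    unfolding Aeq transpose_mult[OF UDc Vt] transpose_mult[OF Uc Dc] by simp
  then have "A * A\<^sup>T = (U * ?D * V\<^sup>T) * (V * (?D\<^sup>T * U\<^sup>T))" by (simp only: Aeq[symmetric])
  also have "\<dots> = U * ?D * (V\<^sup>T * (V * (?D\<^sup>T * U\<^sup>T)))"
    by (rule assoc_mult_mat[OF UDc Vt mult_carrier_mat[OF Vc Xc]])
  also have "V\<^sup>T * (V * (?D\<^sup>T * U\<^sup>T)) = ?D\<^sup>T * U\<^sup>T"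
    unfolding assoc_mult_mat[OF Vt Vc Xc, symmetric] VV by (rule left_mult_one_mat[OF Xc])
  also have "U * ?D * (?D\<^sup>T * U\<^sup>T) = U * (?D * (?D\<^sup>T * U\<^sup>T))"
    by (rule assoc_mult_mat[OF Uc Dc Xc])
  also have "\<dots> = U * ((?D * ?D\<^sup>T) * U\<^sup>T)" unfolding assoc_mult_mat[OF Dc Dt Ut] ..
  also have "\<dots> = U * (?D * ?D\<^sup>T) * U\<^sup>T"
    by (rule assoc_mult_mat[OF Uc _ Ut, symmetric]) (use Dc Dt in simp)
  finally have "A * A\<^sup>T = U * mat_diag m (\<lambda>k. (s ! k)\<^sup>2) * U\<^sup>T" by (simp only: DD)
  from mset_singular_values[OF A U this]
  have ms: "mset s = image_mset (\<lambda>k. \<bar>s ! k\<bar>) (mset_set {..<m})" by (simp add: s_def)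
  then show len: "length s = m" by (metis card_lessThan size_image_mset size_mset size_mset_set)
  show "0 \<le> s ! i" if "i < m" for i
  proof -
    have "s ! i \<in># mset s" using that len by simp
    then show ?thesis unfolding ms by auto
  qed
  show "s ! j \<le> s ! i" if "i \<le> j" "j < m" for i j
  proof -
    have "sorted (rev s)" by (simp add: s_def singular_values_def)
    then show ?thesis using that len by (metis sorted_rev_nth_mono)
  qed
qed

text \<open>The range is spanned by the \<open>u k\<close> with nonzero coefficient:
  \<open>v k\<close> divided by \<open>s k\<close> is a preimage of \<open>u k\<close>.\<close>

lemma rank_diag:
  fixes X :: "real^'n^'m"
  assumes u: "onb u" and v: "onb v" and mn: "CARD('m) \<le> CARD('n)"
    and X: "X = (\<Sum>k<CARD('m). s k *\<^sub>R outer (u k) (v k))"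
  shows "rank X = card {k. k < CARD('m) \<and> s k \<noteq> 0}"
proof -
  let ?K = "{k. k < CARD('m) \<and> s k \<noteq> 0}"
  have uu: "k < CARD('m) \<Longrightarrow> l < CARD('m) \<Longrightarrow> u k \<bullet> u l = (if k = l then 1 else 0)" for k l
    using u by (simp add: onb_def)
  have inj: "inj_on u ?K"
  proof (rule inj_onI)
    fix k l assume "k \<in> ?K" "l \<in> ?K" "u k = u l"
    then show "k = l" using uu[of k l] uu[of l l] by (auto split: if_splits)
  qed
  have "pairwise real_inner_class.orthogonal (u ` ?K)"
    by (auto simp: pairwise_def real_inner_class.orthogonal_def uu)
  moreover have "0 \<notin> u ` ?K"
  proof
    assume "0 \<in> u ` ?K"
    then obtain k where "k < CARD('m)" "u k = 0" by auto
    then show False using uu[of k k] by simp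
  qed
  ultimately have ind: "independent (u ` ?K)" by (rule pairwise_orthogonal_independent)
  have Xx: "X *v x = (\<Sum>k<CARD('m). (s k * (v k \<bullet> x)) *\<^sub>R u k)" for x
    by (simp add: X sum_matrix_vector scaleR_matrix_vector_assoc[symmetric] outer_mult_vec)
  have "range ((*v) X) = span (u ` ?K)"
  proof
    show "range ((*v) X) \<subseteq> span (u ` ?K)"
    proof
      fix y assume "y \<in> range ((*v) X)"
      then obtain x where y: "y = (\<Sum>k<CARD('m). (s k * (v k \<bullet> x)) *\<^sub>R u k)" using Xx by auto
      have "(s k * (v k \<bullet> x)) *\<^sub>R u k \<in> span (u ` ?K)" if "k < CARD('m)" for k
        using that by (cases "s k = 0") (auto intro: span_scale[OF span_base] simp: span_0)
      then show "y \<in> span (u ` ?K)" unfolding y by (intro span_sum) auto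
    qed
    have "u k \<in> range ((*v) X)" if k: "k \<in> ?K" for k
    proof -
      have "X *v ((1 / s k) *\<^sub>R v k) = (\<Sum>l<CARD('m). if l = k then u k else 0)"
        unfolding Xx using k mn v by (intro sum.cong refl) (auto simp: onb_def)
      also have "\<dots> = u k" using k by simp
      finally show ?thesis by (metis rangeI)
    qed
    then show "span (u ` ?K) \<subseteq> range ((*v) X)"
      by (intro span_minimal) (auto simp: linear_subspace_image[OF matrix_vector_mul_linear])
  qed
  then have "rank X = card (u ` ?K)"
    using ind by (simp add: rank_dim_range dim_eq_card_independent)
  then show ?thesis using card_image[OF inj] by simp
qed

lemma vcol_surj: "\<exists>M\<in>carrier_mat CARD('n) r. \<forall>k<r. vcol M k = (f k :: 'n::{finite,linorder} rvec)"
proof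
  let ?M = "Matrix.mat CARD('n) r (\<lambda>(i, k). (f k :: 'n rvec) $ inv_into UNIV pos i)"
  show "\<forall>k<r. vcol ?M k = f k"
    by (simp add: vcol_def Finite_Cartesian_Product.vec_eq_iff)
qed simp

lemma of_mat_mult_transpose:
  assumes P: "P \<in> carrier_mat CARD('n1) a" and Q: "Q \<in> carrier_mat CARD('n2) a"
  shows "of_mat (P * Q\<^sup>T) = (\<Sum>k<a.
    (outer (vcol P k) (vcol Q k) :: ('n1::{finite,linorder}, 'n2::{finite,linorder}) rmatrix))"
proof -
  have "of_mat (P * Q\<^sup>T) = (of_mat (P * 1\<^sub>m a * Q\<^sup>T) :: ('n1, 'n2) rmatrix)" using P by simp
  also have "\<dots> = (\<Sum>k<a. \<Sum>l<a. (if k = l then 1 else 0) *\<^sub>R outer (vcol P k) (vcol Q l))"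
    by (subst of_mat_triple[OF P one_carrier_mat Q]) (intro sum.cong refl, auto)
  also have "\<dots> = (\<Sum>k<a. \<Sum>l<a. if k = l then outer (vcol P k) (vcol Q k) else 0)"
    by (intro sum.cong refl) auto
  finally show ?thesis by simp
qed

lemma of_mat_add:
  assumes "A \<in> carrier_mat CARD('n1) CARD('n2)" "B \<in> carrier_mat CARD('n1) CARD('n2)"
  shows "of_mat (A + B) = (of_mat A + of_mat B :: ('n1::{finite,linorder}, 'n2::{finite,linorder}) rmatrix)"
  using assms by (simp add: of_mat_def Finite_Cartesian_Product.vec_eq_iff)

lemma first_cols_carrier: "U \<in> carrier_mat n n \<Longrightarrow> r \<le> n \<Longrightarrow> first_cols r U \<in> carrier_mat n r"
  by (auto simp: first_cols_def)

lemma other_cols_carrier: "U \<in> carrier_mat n n \<Longrightarrow> r \<le> n \<Longrightarrow> other_cols r U \<in> carrier_mat n (n - r)"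
  by (auto simp: other_cols_def)

lemma vcol_first_cols:
  assumes "U \<in> carrier_mat CARD('n) CARD('n)" "r \<le> CARD('n)" "k < r"
  shows "vcol (first_cols r U) k = (vcol U k :: 'n::{finite,linorder} rvec)"
  using assms by (simp add: vcol_def first_cols_def mat_of_cols_def Finite_Cartesian_Product.vec_eq_iff)

lemma vcol_other_cols:
  assumes "U \<in> carrier_mat CARD('n) CARD('n)" "r \<le> CARD('n)" "k < CARD('n) - r"
  shows "vcol (other_cols r U) k = (vcol U (r + k) :: 'n::{finite,linorder} rvec)"
  using assms by (simp add: vcol_def other_cols_def mat_of_cols_def Finite_Cartesian_Product.vec_eq_iff)

lemma append_cols_carrier:
  "A \<in> carrier_mat n a \<Longrightarrow> B \<in> carrier_mat n b \<Longrightarrow> append_cols A B \<in> carrier_mat n (a + b)"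
  by (auto simp: append_cols_def)

lemma vcol_append_cols:
  assumes "A \<in> carrier_mat CARD('n) a" "B \<in> carrier_mat CARD('n) b" "k < a + b"
  shows "vcol (append_cols A B) k = (if k < a then vcol A k else vcol B (k - a) :: 'n::{finite,linorder} rvec)"
  using assms by (auto simp: vcol_def append_cols_def mat_of_cols_def Finite_Cartesian_Product.vec_eq_iff nth_append)

text \<open>An orthogonal change of the trailing columns keeps them orthonormal and inside the
  complement of the leading ones. This is how \<open>Ub\<close> and \<open>Vb\<close> arise from
  \<open>U\<close> and \<open>V\<close>.\<close>

lemma orthogonal_mats_append:
  assumes U: "U \<in> orthogonal_mats CARD('n)" and r: "r \<le> CARD('n)" and Q: "Q \<in> orthogonal_mats (CARD('n) - r)"
  defines "W \<equiv> append_cols (first_cols r U) (other_cols r U * Q)"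
  shows "W \<in> carrier_mat CARD('n) CARD('n)" "onb (vcol W :: nat \<Rightarrow> 'n::{finite,linorder} rvec)"
    "k < r \<Longrightarrow> vcol W k = (vcol U k :: 'n rvec)"
    "k < CARD('n) - r \<Longrightarrow> vcol W (r + k) = (vcol (other_cols r U * Q) k :: 'n rvec)"
proof -
  let ?n = "CARD('n)" and ?J = "other_cols r U"
  have Uc: "U \<in> carrier_mat ?n ?n" and Qc: "Q \<in> carrier_mat (?n - r) (?n - r)" and QQ: "Q\<^sup>T * Q = 1\<^sub>m (?n - r)"
    using U Q by (auto simp: orthogonal_mats_def)
  have Jc: "?J \<in> carrier_mat ?n (?n - r)" by (rule other_cols_carrier[OF Uc r])
  have JQ: "?J * Q \<in> carrier_mat ?n (?n - r)" using Jc Qc by simp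
  note Ic = first_cols_carrier[OF Uc r]
  show Wc: "W \<in> carrier_mat ?n ?n" using append_cols_carrier[OF Ic JQ] r by (simp add: W_def)
  have uo: "vcol U k \<bullet> (vcol U l :: 'n rvec) = (if k = l then 1 else 0)" if "k < ?n" "l < ?n" for k l
    using onb_vcol[OF U] that by (simp add: onb_def)
  have W1: "vcol W k = (vcol U k :: 'n rvec)" if "k < r" for k
    using that r vcol_append_cols[OF Ic JQ, of k] vcol_first_cols[OF Uc r, of k] by (simp add: W_def)
  have W2: "vcol W (r + k) = (vcol (?J * Q) k :: 'n rvec)" if "k < ?n - r" for k
    using that r vcol_append_cols[OF Ic JQ, of "r + k"] by (simp add: W_def)
  show "k < r \<Longrightarrow> vcol W k = (vcol U k :: 'n rvec)" by (rule W1)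
  show "k < ?n - r \<Longrightarrow> vcol W (r + k) = (vcol (?J * Q) k :: 'n rvec)" by (rule W2)
  have JJ: "?J\<^sup>T * ?J = 1\<^sub>m (?n - r)"
  proof (rule eq_matI)
    fix k l assume "k < dim_row (1\<^sub>m (?n - r))" "l < dim_col (1\<^sub>m (?n - r))"
    then have kl: "k < ?n - r" "l < ?n - r" by auto
    have "(?J\<^sup>T * ?J) $$ (k, l) = vcol ?J k \<bullet> (vcol ?J l :: 'n rvec)" by (rule vcol_inner[symmetric, OF Jc Jc kl])
    then show "(?J\<^sup>T * ?J) $$ (k, l) = 1\<^sub>m (?n - r) $$ (k, l)"
      using kl by (simp add: vcol_other_cols[OF Uc r] uo)
  qed (use Jc in auto)
  have "(?J * Q)\<^sup>T * (?J * Q) = Q\<^sup>T * (?J\<^sup>T * (?J * Q))"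
    using Jc Qc by (simp add: transpose_mult[OF Jc Qc] assoc_mult_mat[of _ "?n - r" "?n - r" _ ?n _ "?n - r"])
  also have "\<dots> = Q\<^sup>T * ((?J\<^sup>T * ?J) * Q)"
    using Jc Qc by (simp add: assoc_mult_mat[of _ "?n - r" ?n _ "?n - r" _ "?n - r"])
  also have "\<dots> = 1\<^sub>m (?n - r)" using Qc QQ by (simp add: JJ)
  finally have JQJQ: "(?J * Q)\<^sup>T * (?J * Q) = 1\<^sub>m (?n - r)" .
  have lin: "vcol (?J * Q) k = (\<Sum>m<?n - r. Q $$ (m, k) *\<^sub>R (vcol U (r + m) :: 'n rvec))" if k: "k < ?n - r" for k
  proof -
    have "(\<Sum>m<?n - r. Q $$ (m, k) *\<^sub>R (vcol U (r + m) :: 'n rvec)) = (\<Sum>m<?n - r. Q $$ (m, k) *\<^sub>R vcol ?J m)"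
      by (intro sum.cong refl) (simp add: vcol_other_cols[OF Uc r])
    also have "\<dots> = vcol (?J * Q) k"
      using k Jc Qc by (simp add: vcol_def Finite_Cartesian_Product.vec_eq_iff scalar_prod_def atLeast0LessThan mult.commute)
    finally show ?thesis by simp
  qed
  have cross: "vcol U k \<bullet> (vcol (?J * Q) l :: 'n rvec) = 0" if "k < r" "l < ?n - r" for k l
    using that r by (simp add: lin inner_sum_right uo)
  show "onb (vcol W :: nat \<Rightarrow> 'n rvec)"
    unfolding onb_def
  proof (intro allI impI)
    fix k l assume "k < DIM('n rvec)" "l < DIM('n rvec)"
    then have kl: "k < ?n" "l < ?n" by auto
    show "vcol W k \<bullet> (vcol W l :: 'n rvec) = (if k = l then 1 else 0)"
    proof (cases "k < r"; cases "l < r")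
      assume "k < r" "l < r"
      then show ?thesis using W1 uo kl by simp
    next
      assume "k < r" "\<not> l < r"
      then show ?thesis using W1[of k] W2[of "l - r"] cross[of k "l - r"] kl by simp
    next
      assume "\<not> k < r" "l < r"
      then show ?thesis using W1[of l] W2[of "k - r"] cross[of l "k - r"] kl by (simp add: inner_commute)
    next
      assume "\<not> k < r" "\<not> l < r"
      moreover have "vcol (?J * Q) (k - r) \<bullet> (vcol (?J * Q) (l - r) :: 'n rvec) = 1\<^sub>m (?n - r) $$ (k - r, l - r)"
        using kl calculation by (subst vcol_inner[OF JQ JQ]) (auto simp: JQJQ)
      ultimately show ?thesis using W2[of "k - r"] W2[of "l - r"] kl by auto
    qed
  qed
qed

text \<open>Splits the subgradient form into \<open>E\<close> and a part in the complement of
  \<open>T\<close>.\<close>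

lemma of_mat_id_block:
  fixes U V :: "real mat"
  assumes U: "U \<in> carrier_mat CARD('n1) CARD('n1)" and V: "V \<in> carrier_mat CARD('n2) CARD('n2)"
    and r: "r \<le> CARD('n1)" "r \<le> CARD('n2)" and Z: "Z \<in> carrier_mat (CARD('n1) - r) (CARD('n2) - r)"
  shows "(of_mat (U * id_block r Z * V\<^sup>T) :: ('n1::{finite,linorder}, 'n2::{finite,linorder}) rmatrix) =
    of_mat (first_cols r U * (first_cols r V)\<^sup>T) + of_mat (other_cols r U * Z * (other_cols r V)\<^sup>T)"
proof -
  let ?n1 = "CARD('n1)" and ?n2 = "CARD('n2)"
  have Bc: "id_block r Z \<in> carrier_mat ?n1 ?n2" using Z r by (auto simp: id_block_def)
  define o' where "o' k l = (outer (vcol U k) (vcol V l) :: ('n1, 'n2) rmatrix)" for k l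
  have e: "id_block r Z $$ (k, l) = (if k < r then (if k = l then 1 else 0) else if l < r then 0 else Z $$ (k - r, l - r))"
    if "k < ?n1" "l < ?n2" for k l
    using that Z r by (auto simp: id_block_def)
  have "(of_mat (U * id_block r Z * V\<^sup>T) :: ('n1, 'n2) rmatrix) = (\<Sum>k<?n1. \<Sum>l<?n2. id_block r Z $$ (k, l) *\<^sub>R o' k l)"
    unfolding o'_def by (rule of_mat_triple[OF U Bc V])
  also have "\<dots> = (\<Sum>k<r. \<Sum>l<?n2. id_block r Z $$ (k, l) *\<^sub>R o' k l) +
      (\<Sum>k<?n1 - r. \<Sum>l<?n2. id_block r Z $$ (r + k, l) *\<^sub>R o' (r + k) l)"
    by (rule sum_lessThan_split[OF r(1)])
  also have "(\<Sum>k<r. \<Sum>l<?n2. id_block r Z $$ (k, l) *\<^sub>R o' k l) = (\<Sum>k<r. \<Sum>l<?n2. if k = l then o' k k else 0)"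
    using r by (intro sum.cong refl) (auto simp: e)
  also have "\<dots> = (\<Sum>k<r. o' k k)" using r by (intro sum.cong) auto
  also have "\<dots> = of_mat (first_cols r U * (first_cols r V)\<^sup>T)"
    unfolding of_mat_mult_transpose[OF first_cols_carrier[OF U r(1)] first_cols_carrier[OF V r(2)]]
    by (intro sum.cong refl) (simp add: o'_def vcol_first_cols[OF U r(1)] vcol_first_cols[OF V r(2)])
  also have "(\<Sum>k<?n1 - r. \<Sum>l<?n2. id_block r Z $$ (r + k, l) *\<^sub>R o' (r + k) l) =
      (\<Sum>k<?n1 - r. \<Sum>l<?n2 - r. Z $$ (k, l) *\<^sub>R o' (r + k) (r + l))"
  proof (rule sum.cong[OF refl])
    fix k assume k: "k \<in> {..<?n1 - r}"
    have "(\<Sum>l<r. id_block r Z $$ (r + k, l) *\<^sub>R o' (r + k) l) = 0"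
      using k r by (intro sum.neutral) (auto simp: e)
    moreover have "(\<Sum>l<?n2 - r. id_block r Z $$ (r + k, r + l) *\<^sub>R o' (r + k) (r + l)) =
        (\<Sum>l<?n2 - r. Z $$ (k, l) *\<^sub>R o' (r + k) (r + l))"
      using k r by (intro sum.cong) (auto simp: e)
    ultimately show "(\<Sum>l<?n2. id_block r Z $$ (r + k, l) *\<^sub>R o' (r + k) l) =
      (\<Sum>l<?n2 - r. Z $$ (k, l) *\<^sub>R o' (r + k) (r + l))"
      by (simp add: sum_lessThan_split[OF r(2)])
  qed
  also have "\<dots> = of_mat (other_cols r U * Z * (other_cols r V)\<^sup>T)"
    unfolding of_mat_triple[OF other_cols_carrier[OF U r(1)] Z other_cols_carrier[OF V r(2)]]
    by (intro sum.cong refl) (simp add: o'_def vcol_other_cols[OF U r(1)] vcol_other_cols[OF V r(2)])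
  finally show ?thesis .
qed

lemma norm_orthonormal_comb:
  fixes a :: "nat \<Rightarrow> 'a::real_inner"
  assumes "\<And>k l. k < m \<Longrightarrow> l < m \<Longrightarrow> a k \<bullet> a l = (if k = l then 1 else 0)"
  shows "(norm (\<Sum>k<m. f k *\<^sub>R a k))\<^sup>2 = (\<Sum>k<m. (f k)\<^sup>2)"
proof -
  have "(norm (\<Sum>k<m. f k *\<^sub>R a k))\<^sup>2 = (\<Sum>k<m. \<Sum>l<m. f k * (f l * (a k \<bullet> a l)))"
    unfolding power2_norm_eq_inner inner_sum_left inner_sum_right
    by (simp, subst sum.swap, simp add: mult_ac)
  also have "\<dots> = (\<Sum>k<m. \<Sum>l<m. if l = k then (f k)\<^sup>2 else 0)"
    using assms by (intro sum.cong refl) (auto simp: power2_eq_square)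
  finally show ?thesis by simp
qed

text \<open>\<open>Z\<close> is the matrix of \<open>N\<close> in the orthonormal families
  \<open>a\<close> and \<open>b\<close>. These need not be bases: Bessel's inequality handles the
  part of \<open>x\<close> outside the span of \<open>b\<close>. Nonnegativity of
  \<open>\<rho>\<close> matters because the defining supremum runs over the ball rather than the
  sphere.\<close>

lemma spectral_norm_outer_sum:
  fixes a :: "nat \<Rightarrow> real ^ 'm" and b :: "nat \<Rightarrow> real ^ 'n"
  assumes a: "\<And>k l. k < m \<Longrightarrow> l < m \<Longrightarrow> a k \<bullet> a l = (if k = l then 1 else 0)"
    and b: "\<And>k l. k < n \<Longrightarrow> l < n \<Longrightarrow> b k \<bullet> b l = (if k = l then 1 else 0)"
    and Z: "Z \<in> carrier_mat m n"
    and N: "N = (\<Sum>k<m. \<Sum>l<n. Z $$ (k, l) *\<^sub>R outer (a k) (b l))"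
  shows "norm (N *v x) \<le> spectral_norm Z * norm x"
    and "(\<And>x. norm (N *v x) \<le> \<rho> * norm x) \<Longrightarrow> 0 \<le> \<rho> \<Longrightarrow> spectral_norm Z \<le> \<rho>"
proof -
  define S :: "real Matrix.vec set" where "S = {x \<in> carrier_vec (dim_col Z). scalar_prod x x \<le> 1}"
  define F where "F x = sqrt (scalar_prod (Z *\<^sub>v x) (Z *\<^sub>v x))" for x
  have sn: "spectral_norm Z = (SUP x\<in>S. F x)" by (simp add: spectral_norm_def S_def F_def)
  have Nx: "N *v x = (\<Sum>k<m. (\<Sum>l<n. Z $$ (k, l) * (b l \<bullet> x)) *\<^sub>R a k)" for x
    by (simp add: N sum_matrix_vector scaleR_matrix_vector_assoc[symmetric] outer_mult_vec scaleR_left.sum)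
  have Fy: "F y = norm (N *v x)" if y: "y \<in> carrier_vec n" and yx: "\<And>l. l < n \<Longrightarrow> vec_index y l = b l \<bullet> x" for x y
  proof -
    have "scalar_prod (Z *\<^sub>v y) (Z *\<^sub>v y) = (\<Sum>k<m. (\<Sum>l<n. Z $$ (k, l) * (b l \<bullet> x))\<^sup>2)"
      using Z y yx by (simp add: scalar_prod_def atLeast0LessThan power2_eq_square)
    also have "\<dots> = (norm (N *v x))\<^sup>2" unfolding Nx by (rule norm_orthonormal_comb[OF a, symmetric])
    finally show ?thesis by (simp add: F_def)
  qed
  have FyS: "\<exists>x. norm x \<le> 1 \<and> F y = norm (N *v x)" if y: "y \<in> S" for y
  proof -
    have yc: "y \<in> carrier_vec n" using y Z by (auto simp: S_def)
    define x where "x = (\<Sum>l<n. vec_index y l *\<^sub>R b l)"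
    have "b l \<bullet> x = vec_index y l" if l: "l < n" for l
    proof -
      have "b l \<bullet> x = (\<Sum>k<n. if k = l then vec_index y k else 0)"
        unfolding x_def inner_sum_right using b l by (intro sum.cong) auto
      then show ?thesis using l by simp
    qed
    then have "F y = norm (N *v x)" using yc by (intro Fy) auto
    moreover have "(norm x)\<^sup>2 = (\<Sum>l<n. (vec_index y l)\<^sup>2)"
      unfolding x_def by (rule norm_orthonormal_comb[OF b])
    then have "(norm x)\<^sup>2 = scalar_prod y y"
      using yc by (simp add: scalar_prod_def atLeast0LessThan power2_eq_square)
    then have "(norm x)\<^sup>2 \<le> 1" using y by (simp add: S_def)
    then have "norm x \<le> 1" using power2_le_imp_le[of "norm x" 1] by simp
    ultimately show ?thesis by blast
  qed
  have bdd: "bdd_above (F ` S)"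
  proof (rule bdd_aboveI2)
    fix y assume "y \<in> S"
    then obtain x where x: "norm x \<le> 1" "F y = norm (N *v x)" using FyS by blast
    have "norm (N *v x) \<le> norm N * norm x" by (rule norm_matrix_vector_le)
    also have "\<dots> \<le> norm N * 1" using x by (intro mult_left_mono) auto
    finally show "F y \<le> norm N" using x by simp
  qed
  show "norm (N *v x) \<le> spectral_norm Z * norm x"
  proof (cases "x = 0")
    case False
    define z where "z = (1 / norm x) *\<^sub>R x"
    have z: "norm z = 1" using False by (simp add: z_def)
    define y where "y = Matrix.vec n (\<lambda>l. b l \<bullet> z)"
    have yc: "y \<in> carrier_vec n" by (simp add: y_def)
    have "scalar_prod y y = (\<Sum>l\<in>{..<n}. (b l \<bullet> z)\<^sup>2)"
      by (simp add: y_def scalar_prod_def atLeast0LessThan power2_eq_square)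
    also have "\<dots> \<le> (norm z)\<^sup>2" by (rule bessel) (auto simp: b)
    finally have "y \<in> S" using z yc Z by (simp add: S_def)
    moreover have "F y = norm (N *v z)" by (rule Fy[OF yc]) (simp add: y_def)
    ultimately have "norm (N *v z) \<le> spectral_norm Z" unfolding sn using bdd by (metis cSUP_upper)
    moreover have "norm (N *v z) = norm (N *v x) / norm x" by (simp add: z_def matrix_vector_mult_scaleR)
    ultimately show ?thesis using False by (simp add: pos_divide_le_eq)
  qed simp
  show "spectral_norm Z \<le> \<rho>" if le: "\<And>x. norm (N *v x) \<le> \<rho> * norm x" and \<rho>: "0 \<le> \<rho>"
    unfolding sn
  proof (rule cSUP_least)
    have "0\<^sub>v n \<in> S" using Z by (auto simp: S_def)
    then show "S \<noteq> {}" by blast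
    fix y assume "y \<in> S"
    then obtain x where x: "norm x \<le> 1" "F y = norm (N *v x)" using FyS by blast
    have "norm (N *v x) \<le> \<rho> * norm x" by (rule le)
    also have "\<dots> \<le> \<rho> * 1" using x \<rho> by (intro mult_left_mono)
    finally show "F y \<le> \<rho>" using x by simp
  qed
qed

lemma orth_proj_eqI:
  assumes S: "subspace S" and y: "y \<in> S" "x - y \<in> S\<^sup>\<bottom>"
  shows "orth_proj S x = y"
  unfolding orth_proj_def
proof (rule the_equality)
  fix z assume z: "z \<in> S \<and> x - z \<in> S\<^sup>\<bottom>"
  have "y - z \<in> S" using S y z by (simp add: subspace_diff)
  moreover have "(x - z) - (x - y) \<in> S\<^sup>\<bottom>" 
    by (rule subspace_diff[OF subspace_orthogonal_comp]) (use y z in auto)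
  ultimately have "(y - z) \<bullet> (y - z) = 0" by (simp add: orthogonal_comp_def real_inner_class.orthogonal_def)
  then show "z = y" by simp
qed (use y in simp)

text \<open>Rewrites membership in the sum of the source condition as orthogonality to
  \<open>Ker \<Phi> \<inter> S\<close>. The hard inclusion is proved for complements and then
  dualised, since in finite dimension a subspace is its own double complement.\<close>

lemma orthogonal_comp_Ker_Int:
  fixes \<Phi> :: "'a::euclidean_space \<Rightarrow> 'b::euclidean_space"
  assumes lin: "linear \<Phi>" and S: "subspace S"
  shows "(Ker \<Phi> \<inter> S)\<^sup>\<bottom> = {a + b | a b. a \<in> range (adjoint \<Phi>) \<and> b \<in> S\<^sup>\<bottom>}" (is "_ = ?Q")
proof
  have "subspace (range (adjoint \<Phi>))"
    using adjoint_linear[OF lin] by (intro linear_subspace_image) auto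
  then have Q: "subspace ?Q" by (intro subspace_sums subspace_orthogonal_comp)
  have "?Q\<^sup>\<bottom> \<subseteq> Ker \<Phi> \<inter> S"
  proof
    fix x assume x: "x \<in> ?Q\<^sup>\<bottom>"
    have "a \<in> ?Q" if "a \<in> range (adjoint \<Phi>)" for a
    proof -
      have "a + 0 \<in> ?Q" using that subspace_0[OF subspace_orthogonal_comp[of S]] by blast
      then show ?thesis by simp
    qed
    then have "x \<in> (range (adjoint \<Phi>))\<^sup>\<bottom>" using x by (auto simp: orthogonal_comp_def)
    then have "\<Phi> x = 0" using ker_orthogonal_comp_adjoint[OF lin] by auto
    moreover have "b \<in> ?Q" if "b \<in> S\<^sup>\<bottom>" for b
    proof -
      have "0 + b \<in> ?Q" using that subspace_0[OF \<open>subspace (range (adjoint \<Phi>))\<close>] by blast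
      then show ?thesis by simp
    qed
    then have "x \<in> S\<^sup>\<bottom>\<^sup>\<bottom>" using x unfolding orthogonal_comp_def[of ?Q] orthogonal_comp_def[of "S\<^sup>\<bottom>"] by auto
    then have "x \<in> S" using orthogonal_comp_self[OF S] by simp
    ultimately show "x \<in> Ker \<Phi> \<inter> S" by (simp add: Ker_def)
  qed
  then have "(Ker \<Phi> \<inter> S)\<^sup>\<bottom> \<subseteq> ?Q\<^sup>\<bottom>\<^sup>\<bottom>" by (rule orthogonal_comp_anti_mono)
  then show "(Ker \<Phi> \<inter> S)\<^sup>\<bottom> \<subseteq> ?Q" using orthogonal_comp_self[OF Q] by simp
  show "?Q \<subseteq> (Ker \<Phi> \<inter> S)\<^sup>\<bottom>"
  proof
    fix y assume "y \<in> ?Q"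
    then obtain w b where y: "y = adjoint \<Phi> w + b" "b \<in> S\<^sup>\<bottom>" by auto
    have "W \<bullet> y = 0" if "W \<in> Ker \<Phi> \<inter> S" for W
      using that y(2) adjoint_works[OF lin, of W w]
      by (simp add: y(1) inner_add_right Ker_def orthogonal_comp_def real_inner_class.orthogonal_def)
    then show "y \<in> (Ker \<Phi> \<inter> S)\<^sup>\<bottom>" by (simp add: orthogonal_comp_def real_inner_class.orthogonal_def)
  qed
qed

context svd_frame
begin

lemma PN_add: "PN (X + Z) = PN X + PN Z"
  by (rule coord_eqI) (simp add: coord_PN coord_simps)

lemma PN_diff: "PN (X - Z) = PN X - PN Z"
  by (rule coord_eqI) (simp add: coord_PN coord_simps)

lemma PN_scale: "PN (s *\<^sub>R X) = s *\<^sub>R PN X"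
  by (rule coord_eqI) (simp add: coord_PN coord_simps)

lemma PN_zero [simp]: "PN 0 = 0"
  using PN_scale[of 0 0] by simp

lemma subspace_PN_null: "subspace {W. PN W = 0}"
  by (auto simp: subspace_def PN_add PN_scale)

text \<open>\<open>PN\<close> is idempotent and self-adjoint, so its kernel and its fixed points are
  orthogonal complements.\<close>

lemma orthogonal_comp_PN_null: "{W. PN W = 0}\<^sup>\<bottom> = {W. PN W = W}"
proof
  show "{W. PN W = W} \<subseteq> {W. PN W = 0}\<^sup>\<bottom>"
  proof
    fix W assume W: "W \<in> {W. PN W = W}"
    have "X \<bullet> W = 0" if "PN X = 0" for X
      using PN_inner[of X W] W that by simp
    then show "W \<in> {W. PN W = 0}\<^sup>\<bottom>" by (simp add: orthogonal_comp_def real_inner_class.orthogonal_def)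
  qed
  show "{W. PN W = 0}\<^sup>\<bottom> \<subseteq> {W. PN W = W}"
  proof
    fix W assume W: "W \<in> {W. PN W = 0}\<^sup>\<bottom>"
    have *: "PN (W - PN W) = 0" by (simp add: PN_diff)
    then have "(W - PN W) \<bullet> W = 0" using W by (simp add: orthogonal_comp_def real_inner_class.orthogonal_def)
    moreover have "(W - PN W) \<bullet> PN W = 0" using PN_inner[of "W - PN W" W] * by simp
    ultimately have "(W - PN W) \<bullet> (W - PN W) = 0" by (simp add: inner_diff_right)
    then show "W \<in> {W. PN W = W}" by simp
  qed
qed

lemma orth_proj_PN_null: "orth_proj {W. PN W = 0} W = W - PN W"
  by (rule orth_proj_eqI[OF subspace_PN_null]) (simp_all add: PN_diff orthogonal_comp_PN_null)

lemma orth_proj_PN_null_comp: "orth_proj ({W. PN W = 0}\<^sup>\<bottom>) W = PN W"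
  by (rule orth_proj_eqI[OF subspace_orthogonal_comp])
    (simp_all add: orthogonal_comp_self[OF subspace_PN_null] PN_diff, simp add: orthogonal_comp_PN_null)

lemma set_C_eq: "set_C {W. PN W = 0} Emat = calC"
  by (simp add: set_C_def calC_def orth_proj_PN_null_comp)

lemma set_T_eq:
  assumes UI: "UI \<in> carrier_mat CARD('n1) r" "\<And>k. k < r \<Longrightarrow> vcol UI k = u k"
    and VI: "VI \<in> carrier_mat CARD('n2) r" "\<And>k. k < r \<Longrightarrow> vcol VI k = v k"
  shows "set_T r UI VI = {W. PN W = 0}"
proof -
  have form: "of_mat (UI * Y\<^sup>T + X * VI\<^sup>T) = (\<Sum>k<r. outer (u k) (vcol Y k)) + (\<Sum>k<r. outer (vcol X k) (v k))"
    if X: "X \<in> carrier_mat CARD('n1) r" and Y: "Y \<in> carrier_mat CARD('n2) r" for X Y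
  proof -
    have "UI * Y\<^sup>T \<in> carrier_mat CARD('n1) CARD('n2)" "X * VI\<^sup>T \<in> carrier_mat CARD('n1) CARD('n2)"
      using UI(1) VI(1) X Y by auto
    then show ?thesis
      by (simp add: of_mat_add of_mat_mult_transpose[OF UI(1) Y] of_mat_mult_transpose[OF X VI(1)] UI(2) VI(2))
  qed
  show ?thesis
  proof (intro equalityI subsetI)
    fix W :: "('n1, 'n2) rmatrix" assume "W \<in> set_T r UI VI"
    then obtain X Y where W: "X \<in> carrier_mat CARD('n1) r" "Y \<in> carrier_mat CARD('n2) r"
      "W = of_mat (UI * Y\<^sup>T + X * VI\<^sup>T)" unfolding set_T_def by auto
    have "coord W k l = 0" if "r \<le> k" "k < CARD('n1)" "r \<le> l" "l < CARD('n2)" for k l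
      unfolding W(3) form[OF W(1,2)] coord_add coord_sum
      using that by (simp add: coord_def outer_mult_vec uu vv)
    then have "PN W = 0" by (intro coord_eqI) (simp add: coord_PN)
    then show "W \<in> {W. PN W = 0}" by simp
  next
    fix W :: "('n1, 'n2) rmatrix" assume "W \<in> {W. PN W = 0}"
    then have W: "PN W = 0" by simp
    \<comment> \<open>\<open>X\<close> takes over the first \<open>r\<close> columns entirely, and
      \<open>Y\<close> only what the first \<open>r\<close> rows have beyond column
      \<open>r\<close>, so the common corner is counted once.\<close>
    obtain X where X: "X \<in> carrier_mat CARD('n1) r" "\<forall>k<r. vcol X k = W *v v k"
      using vcol_surj[of r "\<lambda>k. W *v v k"] by blast
    obtain Y where Y: "Y \<in> carrier_mat CARD('n2) r" "\<forall>k<r. vcol Y k = (\<Sum>l\<in>{r..<CARD('n2)}. coord W k l *\<^sub>R v l)"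
      using vcol_surj[of r "\<lambda>k. \<Sum>l\<in>{r..<CARD('n2)}. coord W k l *\<^sub>R v l"] by blast
    have "W = of_mat (UI * Y\<^sup>T + X * VI\<^sup>T)"
      unfolding form[OF X(1) Y(1)]
    proof (rule coord_eqI)
      fix k l assume kl: "k < CARD('n1)" "l < CARD('n2)"
      have rn: "r \<le> CARD('n1)" "r \<le> CARD('n2)" using rp pn nn by auto
      have 1: "coord (\<Sum>k<r. outer (u k) (vcol Y k)) k l = (if k < r \<and> r \<le> l then coord W k l else 0)"
      proof -
        have vY: "vcol Y i \<bullet> v l = (if r \<le> l then coord W i l else 0)" if "i < r" for i
        proof -
          have "vcol Y i \<bullet> v l = (\<Sum>m\<in>{r..<CARD('n2)}. if m = l then coord W i m else 0)"
            unfolding Y(2)[rule_format, OF that] inner_sum_left using kl by (intro sum.cong) (auto simp: vv)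
          then show ?thesis using kl by simp
        qed
        have "coord (\<Sum>k<r. outer (u k) (vcol Y k)) k l = (\<Sum>i<r. if i = k then (if r \<le> l then coord W k l else 0) else 0)"
          unfolding coord_sum using kl rn by (intro sum.cong refl) (auto simp: coord_def[of "outer _ _"] outer_mult_vec uu vY)
        then show ?thesis by simp
      qed
      have 2: "coord (\<Sum>k<r. outer (vcol X k) (v k)) k l = (if l < r then coord W k l else 0)"
      proof -
        have "coord (\<Sum>k<r. outer (vcol X k) (v k)) k l = (\<Sum>i<r. if i = l then coord W k l else 0)"
          unfolding coord_sum using kl rn by (intro sum.cong refl) (auto simp: coord_def outer_mult_vec vv X(2))
        then show ?thesis by simp
      qed
      have "coord (PN W) k l = 0" using W by simp
      then have "r \<le> k \<Longrightarrow> r \<le> l \<Longrightarrow> coord W k l = 0" using kl by (simp add: coord_PN)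
      then show "coord W k l = coord ((\<Sum>k<r. outer (u k) (vcol Y k)) + (\<Sum>k<r. outer (vcol X k) (v k))) k l"
        unfolding coord_add 1 2 by (auto simp: not_less)
    qed
    then show "W \<in> set_T r UI VI" unfolding set_T_def using X(1) Y(1) by blast
  qed
qed

text \<open>\<open>W - PN W\<close> has only coordinates with an index below \<open>r\<close>, so
  both sides constrain the same entries. \<open>B\<close> occupies columns \<open>r\<close> to
  \<open>p - 1\<close>, hence the shift by \<open>r\<close>.\<close>

lemma set_E_eq:
  assumes Ub: "Ub \<in> carrier_mat CARD('n1) CARD('n1)" "\<And>k. k < CARD('n1) \<Longrightarrow> vcol Ub k = u k"
    and Vb: "Vb \<in> carrier_mat CARD('n2) CARD('n2)" "\<And>k. k < CARD('n2) \<Longrightarrow> vcol Vb k = v k"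
  shows "set_E {W. PN W = 0} r p Ub Vb = calE"
proof -
  let ?B = "\<lambda>A B. ABBT_block CARD('n1) CARD('n2) r p A B"
  have pn2: "p \<le> CARD('n2)" using pn nn by simp
  have Bc: "?B A B \<in> carrier_mat CARD('n1) CARD('n2)"
    if "A \<in> carrier_mat r r" "B \<in> carrier_mat r (p - r)" for A B
    using that rp pn nn by (auto simp: ABBT_block_def)
  have Be: "?B A B $$ (k, l) = (if k < p \<and> l < p then
      (if k < r then (if l < r then A $$ (k, l) else B $$ (k, l - r)) else (if l < r then B $$ (l, k - r) else 0)) else 0)"
    if "A \<in> carrier_mat r r" "B \<in> carrier_mat r (p - r)" "k < CARD('n1)" "l < CARD('n2)" for A B k l
    using that rp pn nn by (auto simp: ABBT_block_def)
  have co: "coord (of_mat (Ub * ?B A B * Vb\<^sup>T)) k l = ?B A B $$ (k, l)"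
    if "A \<in> carrier_mat r r" "B \<in> carrier_mat r (p - r)" "k < CARD('n1)" "l < CARD('n2)" for A B k l
  proof -
    have "of_mat (Ub * ?B A B * Vb\<^sup>T) = (\<Sum>i\<in>{..<CARD('n1)}. \<Sum>j\<in>{..<CARD('n2)}. ?B A B $$ (i, j) *\<^sub>R outer (u i) (v j))"
      by (subst of_mat_triple[OF Ub(1) Bc[OF that(1,2)] Vb(1)]) (simp add: Ub(2) Vb(2))
    then show ?thesis using that by (simp add: coord_combo del: atLeastLessThan_iff)
  qed
  show ?thesis
  proof (intro equalityI subsetI)
    fix W :: "('n1, 'n2) rmatrix" assume "W \<in> set_E {W. PN W = 0} r p Ub Vb"
    then obtain A B where A: "A \<in> carrier_mat r r" "A\<^sup>T = A" and B: "B \<in> carrier_mat r (p - r)"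
      and e: "W - PN W = of_mat (Ub * ?B A B * Vb\<^sup>T)"
      unfolding set_E_def orth_proj_PN_null by blast
    have Asym: "A $$ (k, l) = A $$ (l, k)" if "k < r" "l < r" for k l
      using arg_cong[OF A(2), of "\<lambda>M. M $$ (k, l)"] A(1) that by simp
    have cW: "coord W k l = ?B A B $$ (k, l)" if "k < CARD('n1)" "l < CARD('n2)" "k < r \<or> l < r" for k l
      using arg_cong[OF e, of "\<lambda>X. coord X k l"] co[OF A(1) B that(1,2)] that by (auto simp: coord_diff coord_PN)
    show "W \<in> calE"
      unfolding calE_def using rp pn nn Asym by (auto simp: cW Be[OF A(1) B])
  next
    fix W :: "('n1, 'n2) rmatrix" assume W: "W \<in> calE"
    define A where "A = Matrix.mat r r (\<lambda>(k, l). coord W k l)"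
    define B where "B = Matrix.mat r (p - r) (\<lambda>(k, l). coord W k (r + l))"
    have Ac: "A \<in> carrier_mat r r" and Bc': "B \<in> carrier_mat r (p - r)" by (auto simp: A_def B_def)
    have sym: "coord W k l = coord W l k" if "k < r" "l < p" for k l using W that by (auto simp: calE_def)
    have z1: "coord W k l = 0" if "k < r" "p \<le> l" "l < CARD('n2)" for k l using W that by (auto simp: calE_def)
    have z2: "coord W k l = 0" if "l < r" "p \<le> k" "k < CARD('n1)" for k l using W that by (auto simp: calE_def)
    have "A\<^sup>T = A" using sym rp by (intro eq_matI) (auto simp: A_def)
    moreover have "W - PN W = of_mat (Ub * ?B A B * Vb\<^sup>T)"
    proof (rule coord_eqI)
      fix k l assume kl: "k < CARD('n1)" "l < CARD('n2)"
      show "coord (W - PN W) k l = coord (of_mat (Ub * ?B A B * Vb\<^sup>T)) k l"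
        unfolding co[OF Ac Bc' kl] Be[OF Ac Bc' kl]
        using kl rp z1[of k l] z2[of l k] sym[of l k]
        by (auto simp: coord_diff coord_PN A_def B_def)
    qed
    ultimately show "W \<in> set_E {W. PN W = 0} r p Ub Vb"
      unfolding set_E_def orth_proj_PN_null using Ac Bc' by blast
  qed
qed

end

lemma of_mat_Diag:
  assumes U: "U \<in> carrier_mat CARD('n1) a" and V: "V \<in> carrier_mat CARD('n2) b" and ab: "a \<le> b"
  shows "(of_mat (U * Diag a b s * V\<^sup>T) :: ('n1::{finite,linorder}, 'n2::{finite,linorder}) rmatrix) =
    (\<Sum>k<a. (s ! k) *\<^sub>R outer (vcol U k) (vcol V k))"
proof -
  have D: "Diag a b s \<in> carrier_mat a b" by (simp add: Diag_def)
  have "(of_mat (U * Diag a b s * V\<^sup>T) :: ('n1, 'n2) rmatrix) =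
      (\<Sum>k<a. \<Sum>l<b. if k = l then (s ! k) *\<^sub>R outer (vcol U k) (vcol V k) else 0)"
    unfolding of_mat_triple[OF U D V] by (intro sum.cong refl) (auto simp: Diag_def)
  also have "\<dots> = (\<Sum>k<a. (s ! k) *\<^sub>R outer (vcol U k) (vcol V k))"
    using ab by (intro sum.cong) auto
  finally show ?thesis .
qed

lemma mult_mat_regroup:
  fixes D :: "real mat"
  assumes P: "P \<in> carrier_mat m a" and Q: "Q \<in> carrier_mat a b" and D: "D \<in> carrier_mat b c"
    and R: "R \<in> carrier_mat d c" and S: "S \<in> carrier_mat n d"
  shows "P * (Q * D * R\<^sup>T) * S\<^sup>T = P * Q * D * (S * R)\<^sup>T"
proof -
  have t: "R\<^sup>T \<in> carrier_mat c d" "S\<^sup>T \<in> carrier_mat d n" "Q * D \<in> carrier_mat a c" "P * Q \<in> carrier_mat m b"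
    "P * Q * D \<in> carrier_mat m c"
    using assms by auto
  have "P * (Q * D * R\<^sup>T) = P * (Q * D) * R\<^sup>T" by (rule assoc_mult_mat[OF P t(3) t(1), symmetric])
  also have "P * (Q * D) = P * Q * D" by (rule assoc_mult_mat[OF P Q D, symmetric])
  finally have "P * (Q * D * R\<^sup>T) * S\<^sup>T = P * Q * D * R\<^sup>T * S\<^sup>T" by simp
  also have "\<dots> = P * Q * D * (R\<^sup>T * S\<^sup>T)" by (rule assoc_mult_mat[OF t(5) t(1) t(2)])
  finally show ?thesis by (simp add: transpose_mult[OF S R])
qed

lemma mset_singular_values_diag:
  fixes X :: "('n1::{finite,linorder}, 'n2::{finite,linorder}) rmatrix"
  assumes u: "onb u" and v: "onb v" and nn: "CARD('n1) \<le> CARD('n2)"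
    and X: "X = (\<Sum>k<CARD('n1). s k *\<^sub>R outer (u k) (v k))" and s: "\<And>k. k < CARD('n1) \<Longrightarrow> 0 \<le> s k"
  shows "mset (singular_values (to_mat X)) = image_mset s (mset_set {..<CARD('n1)})"
proof -
  have uu: "k < CARD('n1) \<Longrightarrow> l < CARD('n1) \<Longrightarrow> u k \<bullet> u l = (if k = l then 1 else 0)" for k l
    using u by (simp add: onb_def)
  have vv: "k < CARD('n2) \<Longrightarrow> l < CARD('n2) \<Longrightarrow> v k \<bullet> v l = (if k = l then 1 else 0)" for k l
    using v by (simp add: onb_def)
  have Xx: "X *v x = (\<Sum>k<CARD('n1). (s k * (v k \<bullet> x)) *\<^sub>R u k)" for x
    by (simp add: X sum_matrix_vector scaleR_matrix_vector_assoc[symmetric] outer_mult_vec)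
  have Xv: "X *v v k = s k *\<^sub>R u k" if "k < CARD('n1)" for k
  proof -
    have "X *v v k = (\<Sum>l<CARD('n1). if l = k then s k *\<^sub>R u k else 0)"
      unfolding Xx using that nn by (intro sum.cong) (auto simp: vv)
    then show ?thesis using that by simp
  qed
  have uX: "u k v* X = s k *\<^sub>R v k" if "k < CARD('n1)" for k
  proof -
    have "(u k v* X) \<bullet> x = (s k *\<^sub>R v k) \<bullet> x" for x
    proof -
      have "(u k v* X) \<bullet> x = u k \<bullet> (X *v x)" by (rule dot_lmul_matrix)
      also have "\<dots> = (\<Sum>l<CARD('n1). if l = k then s k * (v k \<bullet> x) else 0)"
        unfolding Xx inner_sum_right using that by (intro sum.cong) (auto simp: uu)
      finally show ?thesis using that by simp
    qed
    then show ?thesis using vector_eq_rdot by blast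
  qed
  have "X *v (u k v* X) = (s k)\<^sup>2 *\<^sub>R u k" if "k < CARD('n1)" for k
    using that by (simp add: uX Xv matrix_vector_mult_scaleR power2_eq_square)
  from mset_singular_values_eigen[OF u this]
  have "mset (singular_values (to_mat X)) = image_mset (\<lambda>k. sqrt ((s k)\<^sup>2)) (mset_set {..<CARD('n1)})" .
  also have "\<dots> = image_mset s (mset_set {..<CARD('n1)})"
    using s by (intro image_mset_cong) auto
  finally show ?thesis .
qed

text \<open>Counting depends only on the multiset of singular values, so the diagonal can be used in
  the order in which it comes.\<close>

lemma num_unit_sv_diag:
  fixes X :: "('n1::{finite,linorder}, 'n2::{finite,linorder}) rmatrix"
  assumes "onb u" "onb v" "CARD('n1) \<le> CARD('n2)"
    and "X = (\<Sum>k<CARD('n1). s k *\<^sub>R outer (u k) (v k))" "\<And>k. k < CARD('n1) \<Longrightarrow> 0 \<le> s k"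
  shows "num_unit_sv X = card {k. k < CARD('n1) \<and> s k = 1}"
proof -
  define xs where "xs = singular_values (to_mat X)"
  have ms: "mset xs = image_mset s (mset_set {..<CARD('n1)})"
    unfolding xs_def by (rule mset_singular_values_diag[OF assms])
  have len: "length xs = CARD('n1)"
    using arg_cong[OF ms, of size] by simp
  have "num_unit_sv X = length (filter (\<lambda>x. x = 1) xs)"
    by (simp add: num_unit_sv_def xs_def[symmetric] length_filter_conv_card len)
  also have "\<dots> = size (filter_mset (\<lambda>x. x = 1) (mset xs))" by (metis mset_filter size_mset)
  also have "\<dots> = card {k. k < CARD('n1) \<and> s k = 1}"
    by (simp add: ms filter_mset_image_mset)
  finally show ?thesis .
qed

context svd_frame
begin

text \<open>The complement of \<open>T\<close> depends only on the leading vectors, so any bases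
  that continue them describe it. The source conditions use the columns of \<open>U\<close> and
  \<open>V\<close>, whereas the frame uses the rotated ones.\<close>

lemma PN_fixed_iff:
  assumes a: "onb a" "\<And>k. k < r \<Longrightarrow> a k = u k" and b: "onb b" "\<And>k. k < r \<Longrightarrow> b k = v k"
  shows "PN N = N \<longleftrightarrow> (\<exists>z. N = (\<Sum>k<CARD('n1) - r. \<Sum>l<CARD('n2) - r. z k l *\<^sub>R outer (a (r + k)) (b (r + l))))"
proof
  have rn: "r \<le> CARD('n1)" "r \<le> CARD('n2)" using rp pn nn by auto
  {
    assume "\<exists>z. N = (\<Sum>k<CARD('n1) - r. \<Sum>l<CARD('n2) - r. z k l *\<^sub>R outer (a (r + k)) (b (r + l)))"
    then obtain z where N: "N = (\<Sum>k<CARD('n1) - r. \<Sum>l<CARD('n2) - r. z k l *\<^sub>R outer (a (r + k)) (b (r + l)))" ..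
    have ua: "u k \<bullet> a (r + i) = 0" if "k < r" "i < CARD('n1) - r" for k i
    proof -
      have "a k \<bullet> a (r + i) = 0" using a(1) that rn by (simp add: onb_def)
      then show ?thesis using a(2)[OF that(1)] by simp
    qed
    have bv: "b (r + i) \<bullet> v l = 0" if "l < r" "i < CARD('n2) - r" for l i
    proof -
      have "b (r + i) \<bullet> b l = 0" using b(1) that rn by (simp add: onb_def)
      then show ?thesis using b(2)[OF that(1)] by simp
    qed
    have "coord N k l = 0" if "k < r \<or> l < r" for k l
      unfolding N coord_sum coord_scale using that
      by (auto simp: coord_def outer_mult_vec ua bv intro!: sum.neutral)
    then show "PN N = N" by (intro coord_eqI) (auto simp: coord_PN not_le)
  next
    assume PN: "PN N = N"
    have c0: "coord N k l = 0" if "k < CARD('n1)" "l < CARD('n2)" "k < r \<or> l < r" for k l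
      using arg_cong[OF PN, of "\<lambda>X. coord X k l"] that by (auto simp: coord_PN not_le)
    have Nb: "N *v b l = 0" if "l < r" for l
    proof (rule onb_eqI[OF u])
      fix k assume "k < DIM('n1 rvec)"
      then show "u k \<bullet> (N *v b l) = u k \<bullet> 0"
        using c0[of k l] that rn b(2) by (simp add: coord_def[symmetric])
    qed
    have aN: "a k \<bullet> (N *v x) = 0" if "k < r" for k x
      using c0[of k] that rn a(2)[OF that] by (simp add: coord_apply)
    have "N = (\<Sum>l<CARD('n2). outer (N *v b l) (b l))" by (rule onb_outer_sum[OF b(1)])
    also have "\<dots> = (\<Sum>l<CARD('n2) - r. outer (N *v b (r + l)) (b (r + l)))"
      unfolding sum_lessThan_split[OF rn(2)] using Nb by (simp add: outer_def Finite_Cartesian_Product.vec_eq_iff)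
    also have "\<dots> = (\<Sum>l<CARD('n2) - r. \<Sum>k<CARD('n1) - r. (a (r + k) \<bullet> (N *v b (r + l))) *\<^sub>R outer (a (r + k)) (b (r + l)))"
    proof (intro sum.cong refl)
      fix l
      have "N *v b (r + l) = (\<Sum>k<CARD('n1). (a k \<bullet> (N *v b (r + l))) *\<^sub>R a k)" by (rule onb_expand_cart[OF a(1)])
      also have "\<dots> = (\<Sum>k<CARD('n1) - r. (a (r + k) \<bullet> (N *v b (r + l))) *\<^sub>R a (r + k))"
        unfolding sum_lessThan_split[OF rn(1)] using aN by simp
      finally have e: "N *v b (r + l) = (\<Sum>k<CARD('n1) - r. (a (r + k) \<bullet> (N *v b (r + l))) *\<^sub>R a (r + k))" .
      have o: "outer (\<Sum>k\<in>K. f k *\<^sub>R a (r + k)) y = (\<Sum>k\<in>K. f k *\<^sub>R outer (a (r + k)) y)" for f K and y :: "'n2 rvec"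
        by (simp add: outer_def Finite_Cartesian_Product.vec_eq_iff sum_distrib_left mult_ac)
      show "outer (N *v b (r + l)) (b (r + l)) =
        (\<Sum>k<CARD('n1) - r. (a (r + k) \<bullet> (N *v b (r + l))) *\<^sub>R outer (a (r + k)) (b (r + l)))"
        by (rule trans[OF arg_cong[OF e, of "\<lambda>y. outer y (b (r + l))"] o])
    qed
    also have "\<dots> = (\<Sum>k<CARD('n1) - r. \<Sum>l<CARD('n2) - r. (a (r + k) \<bullet> (N *v b (r + l))) *\<^sub>R outer (a (r + k)) (b (r + l)))"
      by (rule sum.swap)
    finally show "\<exists>z. N = (\<Sum>k<CARD('n1) - r. \<Sum>l<CARD('n2) - r. z k l *\<^sub>R outer (a (r + k)) (b (r + l)))"
      by (intro exI[of _ "\<lambda>k l. a (r + k) \<bullet> (N *v b (r + l))"])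
  }
qed

end

section \<open>Strong solutions\<close>

context svd_frame
begin

text \<open>Passes between the extended-valued objective and the real function \<open>f\<close>,
  which represents \<open>h\<close> on the interior of its domain.\<close>

lemma strong_solution_iff:
  fixes \<Phi> :: "('n1, 'n2) rmatrix \<Rightarrow> real ^ 'm"
  assumes lin: "linear \<Phi>" and mu: "0 < \<mu>" and conv: "proper_convex h"
    and C2: "C2_on (interior (effective_domain h)) (\<lambda>y. real_of_ereal (h y)) g H"
    and pd: "positive_definite (H (\<Phi> Xbar))" and X: "\<Phi> Xbar \<in> interior (effective_domain h)"
    and Y: "Ybar = - (1 / \<mu>) *\<^sub>R adjoint \<Phi> (g (\<Phi> Xbar))"
  shows "strong_solution (objective \<Phi> h \<mu>) Xbar \<longleftrightarrow> Ker \<Phi> \<inter> calE \<inter> calC = {0}"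
proof -
  define S where "S = interior (effective_domain h)"
  define f where "f y = real_of_ereal (h y)" for y
  have S: "open S" "\<Phi> Xbar \<in> S" using X by (auto simp: S_def)
  have hf: "h y = ereal (f y)" if "y \<in> S" for y
  proof -
    have "h y < \<infinity>" using that interior_subset[of "effective_domain h"] by (auto simp: S_def effective_domain_def)
    moreover have "h y \<noteq> -\<infinity>" using conv by (simp add: proper_convex_def)
    ultimately show ?thesis unfolding f_def by (cases "h y") auto
  qed
  have obj: "objective \<Phi> h \<mu> Z = ereal (f (\<Phi> Z) + \<mu> * nuclear_norm Z)" if "\<Phi> Z \<in> S" for Z
    using hf[OF that] by (simp add: objective_def)
  have gf: "GDERIV f y :> g y" if "y \<in> S" for y
    using C2 that by (simp add: C2_on_def S_def f_def[abs_def])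
  have gd: "(g has_derivative (\<lambda>w. H (\<Phi> Xbar) *v w)) (at (\<Phi> Xbar))"
    using C2 X by (simp add: C2_on_def)
  have YK: "Ybar \<bullet> W = 0" if "W \<in> Ker \<Phi>" for W
    using that adjoint_works[OF lin, of W "g (\<Phi> Xbar)"] by (simp add: Y Ker_def inner_commute)
  have zero: "0 \<in> Ker \<Phi> \<inter> calE \<inter> calC"
    using linear_0[OF lin] subspace_0[OF subspace_calE] by (simp add: Ker_def calC_def)
  show ?thesis
  proof
    assume "strong_solution (objective \<Phi> h \<mu>) Xbar"
    then obtain c e where c: "0 < c" and e: "0 < e" and growth:
      "\<forall>Z. norm (Z - Xbar) \<le> e \<longrightarrow> objective \<Phi> h \<mu> Z - objective \<Phi> h \<mu> Xbar \<ge> ereal (c * (norm (Z - Xbar))\<^sup>2)"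
      unfolding strong_solution_def by blast
    have "W = 0" if W: "W \<in> Ker \<Phi> \<inter> calE \<inter> calC" for W
    proof (rule kernel_trivial_if_growth[OF lin gf[OF S(2)] mu Y S c e])
      fix Z assume Z: "norm (Z - Xbar) \<le> e" "\<Phi> Z \<in> S"
      from growth Z(1) have "objective \<Phi> h \<mu> Z - objective \<Phi> h \<mu> Xbar \<ge> ereal (c * (norm (Z - Xbar))\<^sup>2)" by blast
      then show "c * (norm (Z - Xbar))\<^sup>2 \<le>
          (f (\<Phi> Z) + \<mu> * nuclear_norm Z) - (f (\<Phi> Xbar) + \<mu> * nuclear_norm Xbar)"
        unfolding obj[OF Z(2)] obj[OF S(2)] by simp
    next
      show "\<Phi> W = 0" using W by (simp add: Ker_def)
      show "in_tangent W" using W in_tangent_iff[OF YK] by blast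
    qed
    with zero show "Ker \<Phi> \<inter> calE \<inter> calC = {0}" by blast
  next
    assume ker: "Ker \<Phi> \<inter> calE \<inter> calC = {0}"
    have "0 < w \<bullet> (H (\<Phi> Xbar) *v w)" if "w \<noteq> 0" for w
      using pd that by (simp add: positive_definite_def)
    from second_order_lower_bound[OF S gf gd this]
    obtain k d where k: "0 < k" and d: "0 < d" and low: "\<forall>y. norm (y - \<Phi> Xbar) \<le> d \<longrightarrow>
        y \<in> S \<and> f (\<Phi> Xbar) + g (\<Phi> Xbar) \<bullet> (y - \<Phi> Xbar) + k * (norm (y - \<Phi> Xbar))\<^sup>2 \<le> f y" by blast
    have "\<exists>c>0. \<exists>eps>0. \<forall>Z. norm (Z - Xbar) \<le> eps \<longrightarrow> norm (\<Phi> Z - \<Phi> Xbar) \<le> d \<longrightarrow>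
      c * (norm (Z - Xbar))\<^sup>2 \<le> (f (\<Phi> Z) + \<mu> * nuclear_norm Z) - (f (\<Phi> Xbar) + \<mu> * nuclear_norm Xbar)"
    proof (rule growth_if_kernel_trivial[OF lin mu Y k d])
      show "f (\<Phi> Xbar) + g (\<Phi> Xbar) \<bullet> (y - \<Phi> Xbar) + k * (norm (y - \<Phi> Xbar))\<^sup>2 \<le> f y"
        if "norm (y - \<Phi> Xbar) \<le> d" for y using low that by blast
      fix W assume W: "\<Phi> W = 0" "in_tangent W"
      then have "W \<in> Ker \<Phi>" by (simp add: Ker_def)
      then have "W \<in> Ker \<Phi> \<inter> calE \<inter> calC" using in_tangent_iff[OF YK] W(2) by blast
      with ker show "W = 0" by blast
    qed
    then obtain c e where c: "0 < c" and e: "0 < e" and growth: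
      "\<forall>Z. norm (Z - Xbar) \<le> e \<longrightarrow> norm (\<Phi> Z - \<Phi> Xbar) \<le> d \<longrightarrow>
      c * (norm (Z - Xbar))\<^sup>2 \<le> (f (\<Phi> Z) + \<mu> * nuclear_norm Z) - (f (\<Phi> Xbar) + \<mu> * nuclear_norm Xbar)"
      by blast
    \<comment> \<open>Shrinking the radius to \<open>d / B\<close> keeps \<open>\<Phi> Z\<close>
      where the quadratic bound holds, and hence where the objective is finite.\<close>
    obtain B where B: "0 < B" and Bb: "\<forall>Z. norm (\<Phi> Z) \<le> B * norm Z"
      using linear_bounded_pos[OF lin] by blast
    have "ereal (c * (norm (Z - Xbar))\<^sup>2) \<le> objective \<Phi> h \<mu> Z - objective \<Phi> h \<mu> Xbar"
      if Z: "norm (Z - Xbar) \<le> min e (d / B)" for Z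
    proof -
      have "norm (\<Phi> Z - \<Phi> Xbar) \<le> B * norm (Z - Xbar)" using Bb by (metis linear_diff[OF lin])
      also have "\<dots> \<le> B * (d / B)" using Z B by (intro mult_left_mono) auto
      finally have *: "norm (\<Phi> Z - \<Phi> Xbar) \<le> d" using B by simp
      then have "\<Phi> Z \<in> S" using low by blast
      then show ?thesis unfolding obj[OF \<open>\<Phi> Z \<in> S\<close>] obj[OF S(2)] using growth Z * by simp
    qed
    moreover have "0 < min e (d / B)" using e d B by simp
    moreover have "\<bar>objective \<Phi> h \<mu> Xbar\<bar> \<noteq> \<infinity>" unfolding obj[OF S(2)] by simp
    ultimately show "strong_solution (objective \<Phi> h \<mu>) Xbar" unfolding strong_solution_def using c by blast
  qed
qed

end

section \<open>Reduction of the given data to a common singular frame of the minimiser and its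
  certificate\<close>

theorem theorem4p6:
  fixes \<Phi> :: "('n1::{finite,linorder}, 'n2::{finite,linorder}) rmatrix \<Rightarrow> real ^ 'm"
    and \<mu> :: real
    and h :: "real ^ 'm \<Rightarrow> ereal"
    and grad_h :: "real ^ 'm \<Rightarrow> real ^ 'm"
    and hess_h :: "real ^ 'm \<Rightarrow> real ^ 'm ^ 'm"
    and Xb Yb E :: "('n1, 'n2) rmatrix"
    and T \<E> \<C> :: "('n1, 'n2) rmatrix set"
    and U V UI UJ VI VK Wb Uh Vh Ub Vb :: "real mat"
    and r p :: nat
  assumes dims: "CARD('n1) \<le> CARD('n2)"
    and lin: "linear \<Phi>"
    and mu: "\<mu> > 0"
    and h_convex: "proper_convex h"
    and h_C2: "C2_on (interior (effective_domain h)) (\<lambda>y. real_of_ereal (h y)) grad_h hess_h"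
    and h_pos_def: "\<And>X. \<Phi> X \<in> interior (effective_domain h) \<Longrightarrow> positive_definite (hess_h (\<Phi> X))"
    and Xb_int: "\<Phi> Xb \<in> interior (effective_domain h)"
    and Xb_min: "\<And>X. objective \<Phi> h \<mu> Xb \<le> objective \<Phi> h \<mu> X"
    and Yb_eq: "Yb = - (1 / \<mu>) *\<^sub>R adjoint \<Phi> (grad_h (\<Phi> Xb))"
    and r_eq: "r = rank Xb"
    and UV: "(U, V) \<in> SVD_pairs (to_mat Xb)"
    and UI_eq: "UI = first_cols r U" and UJ_eq: "UJ = other_cols r U"
    and VI_eq: "VI = first_cols r V" and VK_eq: "VK = other_cols r V"
    and Wb_dim: "Wb \<in> carrier_mat (CARD('n1) - r) (CARD('n2) - r)"
    and Yb_Wb: "Yb = of_mat (U * id_block r Wb * V\<^sup>T)"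
    and Wb_norm: "spectral_norm Wb \<le> 1"
    and Wb_SVD: "(Uh, Vh) \<in> SVD_pairs Wb"
    and Ub_eq: "Ub = append_cols UI (UJ * Uh)" and Vb_eq: "Vb = append_cols VI (VK * Vh)"
    and E_eq: "E = of_mat (UI * VI\<^sup>T)"
    and p_eq: "p = num_unit_sv Yb"
    and T_eq: "T = set_T r UI VI"
    and calE_eq: "\<E> = set_E T r p Ub Vb"
    and calC_eq: "\<C> = set_C T E"
  shows "(strong_solution (objective \<Phi> h \<mu>) Xb \<longleftrightarrow> Ker \<Phi> \<inter> \<E> \<inter> \<C> = {0}) \<and>
    (strong_solution (objective \<Phi> h \<mu>) Xb \<longleftrightarrow>
       strong_restricted_injectivity \<Phi> \<E> T \<and> strong_nondegenerate_source \<Phi> \<E> r U V) \<and>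
    (\<forall>M :: ('n1, 'n2) rmatrix \<Rightarrow> 'q::euclidean_space.
       linear M \<and> range (adjoint M) = Ker \<Phi> \<inter> \<E> \<longrightarrow>
       (strong_solution (objective \<Phi> h \<mu>) Xb \<longleftrightarrow>
          strong_restricted_injectivity \<Phi> \<E> T \<and> zeta M E r UJ VK < 1))"
proof -
  let ?n1 = "CARD('n1)" and ?n2 = "CARD('n2)"
  define s where "s = singular_values (to_mat Xb)"
  have Uo: "U \<in> orthogonal_mats ?n1" and Vo: "V \<in> orthogonal_mats ?n2"
    and Xeq: "to_mat Xb = U * Diag ?n1 ?n2 s * V\<^sup>T"
    using UV by (auto simp: SVD_pairs_def s_def to_mat_def)
  have Uc: "U \<in> carrier_mat ?n1 ?n1" and Vc: "V \<in> carrier_mat ?n2 ?n2"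
    using Uo Vo by (auto simp: orthogonal_mats_def)
  define u0 :: "nat \<Rightarrow> 'n1 rvec" where "u0 = vcol U"
  define v0 :: "nat \<Rightarrow> 'n2 rvec" where "v0 = vcol V"
  have u0: "onb u0" and v0: "onb v0" unfolding u0_def v0_def by (rule onb_vcol[OF Uo], rule onb_vcol[OF Vo])
  have "Xb = of_mat (to_mat Xb)" by simp
  also have "\<dots> = (\<Sum>k<?n1. (s ! k) *\<^sub>R outer (u0 k) (v0 k))"
    unfolding Xeq u0_def v0_def by (rule of_mat_Diag[OF Uc Vc dims])
  finally have Xsum: "Xb = (\<Sum>k<?n1. (s ! k) *\<^sub>R outer (u0 k) (v0 k))" .
  note s_props = SVD_pairs_singular_values[OF to_mat_carrier dims UV, folded s_def]
  have r_card: "r = card {k. k < ?n1 \<and> s ! k \<noteq> 0}"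
    unfolding r_eq by (rule rank_diag[OF u0 v0 dims Xsum])
  have s_pos: "s ! k \<noteq> 0 \<longleftrightarrow> k < r" if "k < ?n1" for k
    unfolding r_card
  proof (rule down_closed_iff[OF _ that])
    fix i j assume "i \<le> j" "j < ?n1" "s ! j \<noteq> 0"
    then show "s ! i \<noteq> 0" using s_props(2)[of j] s_props(3)[of i j] by auto
  qed
  have r1: "r \<le> ?n1" unfolding r_card using card_mono[of "{..<?n1}" "{k. k < ?n1 \<and> s ! k \<noteq> 0}"] by auto
  have r2: "r \<le> ?n2" using r1 dims by simp
  have dims': "?n1 - r \<le> ?n2 - r" using dims by simp
  define w where "w = singular_values Wb"
  have Uho: "Uh \<in> orthogonal_mats (?n1 - r)" and Vho: "Vh \<in> orthogonal_mats (?n2 - r)"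
    and Weq: "Wb = Uh * Diag (?n1 - r) (?n2 - r) w * Vh\<^sup>T"
    using Wb_SVD Wb_dim by (auto simp: SVD_pairs_def w_def)
  have Uhc: "Uh \<in> carrier_mat (?n1 - r) (?n1 - r)" and Vhc: "Vh \<in> carrier_mat (?n2 - r) (?n2 - r)"
    using Uho Vho by (auto simp: orthogonal_mats_def)
  note w_props = SVD_pairs_singular_values[OF Wb_dim dims' Wb_SVD, folded w_def]
  note UJc = other_cols_carrier[OF Uc r1, folded UJ_eq]
  note VKc = other_cols_carrier[OF Vc r2, folded VK_eq]
  note UIc = first_cols_carrier[OF Uc r1, folded UI_eq]
  note VIc = first_cols_carrier[OF Vc r2, folded VI_eq]
  \<comment> \<open>Two pairs of bases coexist: \<open>u0\<close>, \<open>v0\<close> from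
    \<open>U\<close>, \<open>V\<close> carry the source conditions, while \<open>u\<close>,
    \<open>v\<close> also diagonalise \<open>Yb\<close> and carry \<open>\<E>\<close>. They agree
    below \<open>r\<close>.\<close>
  define u :: "nat \<Rightarrow> 'n1 rvec" where "u = vcol Ub"
  define v :: "nat \<Rightarrow> 'n2 rvec" where "v = vcol Vb"
  note Ub_props = orthogonal_mats_append[OF Uo r1 Uho, folded UI_eq UJ_eq, folded Ub_eq, folded u_def u0_def]
  note Vb_props = orthogonal_mats_append[OF Vo r2 Vho, folded VI_eq VK_eq, folded Vb_eq, folded v_def v0_def]
  define Nm :: "real mat \<Rightarrow> ('n1, 'n2) rmatrix" where "Nm Z = of_mat (UJ * Z * VK\<^sup>T)" for Z
  let ?Zc = "carrier_mat (?n1 - r) (?n2 - r) :: real mat set"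
  have Nm_sum: "Nm Z = (\<Sum>k<?n1 - r. \<Sum>l<?n2 - r. Z $$ (k, l) *\<^sub>R outer (u0 (r + k)) (v0 (r + l)))"
    if "Z \<in> ?Zc" for Z
    unfolding Nm_def of_mat_triple[OF UJc that VKc]
    by (intro sum.cong refl)
      (simp add: u0_def v0_def UJ_eq VK_eq vcol_other_cols[OF Uc r1] vcol_other_cols[OF Vc r2])
  have u0r: "u0 (r + k) \<bullet> u0 (r + l) = (if k = l then 1 else 0)" if "k < ?n1 - r" "l < ?n1 - r" for k l
    using u0 that by (simp add: onb_def)
  have v0r: "v0 (r + k) \<bullet> v0 (r + l) = (if k = l then 1 else 0)" if "k < ?n2 - r" "l < ?n2 - r" for k l
    using v0 that by (simp add: onb_def)
  have Nm_le: "norm (Nm Z *v x) \<le> spectral_norm Z * norm x" if "Z \<in> ?Zc" for Z x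
    by (rule spectral_norm_outer_sum(1)[OF u0r v0r that Nm_sum[OF that]])
  have Nm_ge: "spectral_norm Z \<le> \<rho>" if "Z \<in> ?Zc" "\<And>x. norm (Nm Z *v x) \<le> \<rho> * norm x" "0 \<le> \<rho>" for Z \<rho>
    by (rule spectral_norm_outer_sum(2)[OF u0r v0r that(1) Nm_sum[OF that(1)] that(2,3)])
  have id_block: "of_mat (U * id_block r Z * V\<^sup>T) = E + Nm Z" if "Z \<in> ?Zc" for Z
    unfolding E_eq Nm_def UI_eq VI_eq UJ_eq VK_eq by (rule of_mat_id_block[OF Uc Vc r1 r2 that])
  have E_sum: "E = (\<Sum>k<r. outer (u k) (v k))"
    unfolding E_eq of_mat_mult_transpose[OF UIc VIc]
    by (intro sum.cong refl)
      (simp add: UI_eq VI_eq vcol_first_cols[OF Uc r1] vcol_first_cols[OF Vc r2] Ub_props(3) Vb_props(3) u0_def v0_def)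
  have NW: "Nm Wb = (\<Sum>k<?n1 - r. (w ! k) *\<^sub>R outer (u (r + k)) (v (r + k)))"
  proof -
    have Dc: "Diag (?n1 - r) (?n2 - r) w \<in> ?Zc" by (simp add: Diag_def)
    have "UJ * Wb * VK\<^sup>T = (UJ * Uh) * Diag (?n1 - r) (?n2 - r) w * (VK * Vh)\<^sup>T"
      unfolding Weq by (rule mult_mat_regroup[OF UJc Uhc Dc Vhc VKc])
    then have "Nm Wb = of_mat ((UJ * Uh) * Diag (?n1 - r) (?n2 - r) w * (VK * Vh)\<^sup>T)" by (simp only: Nm_def)
    also have "\<dots> = (\<Sum>k<?n1 - r. (w ! k) *\<^sub>R outer (vcol (UJ * Uh) k) (vcol (VK * Vh) k))"
      using mult_carrier_mat[OF UJc Uhc] mult_carrier_mat[OF VKc Vhc] dims' by (rule of_mat_Diag)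
    also have "\<dots> = (\<Sum>k<?n1 - r. (w ! k) *\<^sub>R outer (u (r + k)) (v (r + k)))"
      using dims' by (intro sum.cong refl) (simp add: Ub_props(4) Vb_props(4))
    finally show ?thesis .
  qed
  define sg where "sg k = (if k < r then 1 else if k < ?n1 then w ! (k - r) else 0)" for k
  define ta where "ta k = (if k < ?n1 then s ! k else 0)" for k
  have Yb_sum: "Yb = (\<Sum>k<?n1. sg k *\<^sub>R outer (u k) (v k))"
  proof -
    have "Yb = E + Nm Wb" unfolding Yb_Wb by (rule id_block[OF Wb_dim])
    then show ?thesis
      unfolding E_sum NW sum_lessThan_split[OF r1]
      by (auto simp: sg_def intro!: arg_cong2[where f = "(+)"] sum.cong)
  qed
  \<comment> \<open>Evaluate at the right singular vector \<open>v (r + k)\<close>: its image has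
    length \<open>w ! k\<close>, bounded by the spectral norm of \<open>Wb\<close>.\<close>
  have w_le: "w ! k \<le> 1" if k: "k < ?n1 - r" for k
  proof -
    have vk: "v (r + k) \<bullet> v (r + k) = 1" "u (r + k) \<bullet> u (r + k) = 1"
      using Vb_props(2) Ub_props(2) k dims by (auto simp: onb_def)
    have "Nm Wb *v v (r + k) = (\<Sum>l<?n1 - r. if l = k then (w ! k) *\<^sub>R u (r + k) else 0)"
      unfolding NW sum_matrix_vector using Vb_props(2) k dims
      by (intro sum.cong refl) (auto simp: scaleR_matrix_vector_assoc[symmetric] outer_mult_vec onb_def)
    then have "norm (Nm Wb *v v (r + k)) = \<bar>w ! k\<bar>" using k vk by (simp add: norm_eq_sqrt_inner)
    moreover have "norm (Nm Wb *v v (r + k)) \<le> spectral_norm Wb * norm (v (r + k))" by (rule Nm_le[OF Wb_dim])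
    ultimately show ?thesis using Wb_norm vk by (simp add: norm_eq_sqrt_inner)
  qed
  have sg_nonneg: "0 \<le> sg k" for k using w_props(2) by (auto simp: sg_def)
  have p_card: "p = card {k. k < ?n1 \<and> sg k = 1}"
    unfolding p_eq by (rule num_unit_sv_diag[OF Ub_props(2) Vb_props(2) dims Yb_sum sg_nonneg])
  have sg_one: "sg k = 1 \<longleftrightarrow> k < p" if "k < ?n1" for k
    unfolding p_card
  proof (rule down_closed_iff[OF _ that])
    fix i j assume ij: "i \<le> j" "j < ?n1" "sg j = 1"
    show "sg i = 1"
    proof (cases "i < r")
      case False
      then have "w ! (j - r) = 1" "w ! (j - r) \<le> w ! (i - r)" "w ! (i - r) \<le> 1"
        using ij w_props(3)[of "i - r" "j - r"] w_le[of "i - r"] by (auto simp: sg_def)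
      then show ?thesis using False ij by (simp add: sg_def)
    qed (simp add: sg_def)
  qed
  have p1: "p \<le> ?n1" unfolding p_card using card_mono[of "{..<?n1}" "{k. k < ?n1 \<and> sg k = 1}"] by auto
  \<comment> \<open>If \<open>p < r\<close>, then \<open>sg p = 1\<close> by definition, which would
    make \<open>p\<close> smaller than itself.\<close>
  have rp: "r \<le> p"
  proof (rule ccontr)
    assume "\<not> r \<le> p"
    then show False using sg_one[of p] r1 by (simp add: sg_def)
  qed
  interpret svd_frame u v r p sg ta
  proof
    show "0 \<le> sg k \<and> sg k < 1" if "p \<le> k" for k
    proof (cases "k < ?n1")
      case True
      then have "sg k \<noteq> 1" using sg_one that by simp
      moreover have "sg k \<le> 1" using w_le[of "k - r"] True by (auto simp: sg_def)
      ultimately show ?thesis using sg_nonneg by simp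
    qed (use r1 in \<open>simp add: sg_def\<close>)
    show "0 < ta k" if "k < r" for k
      using that r1 s_pos[of k] s_props(2)[of k] by (simp add: ta_def)
    show "sg k = 1" if "k < p" for k using that p1 sg_one[of k] by simp
    show "sg k = 0" if "?n1 \<le> k" for k using that r1 by (simp add: sg_def)
    show "ta k = 0" if "r \<le> k" for k using that s_pos[of k] by (auto simp: ta_def)
  qed (use Ub_props(2) Vb_props(2) rp p1 dims in auto)
  have YbY: "Ybar = Yb" by (simp add: Ybar_def Yb_sum)
  \<comment> \<open>The two pairs of bases differ only from \<open>r\<close> on, where the singular
    values of \<open>Xb\<close> vanish.\<close>
  have XbX: "Xbar = Xb"
    unfolding Xbar_def Xsum
  proof (intro sum.cong refl)
    fix k assume "k \<in> {..<?n1}"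
    then show "ta k *\<^sub>R outer (u k) (v k) = (s ! k) *\<^sub>R outer (u0 k) (v0 k)"
      using s_pos[of k] Ub_props(3)[of k] Vb_props(3)[of k] by (cases "k < r") (auto simp: ta_def)
  qed
  have EE: "Emat = E" by (simp add: Emat_def E_sum)
  have TT: "T = {W. PN W = 0}"
    unfolding T_eq
    by (rule set_T_eq[OF UIc _ VIc])
      (simp_all add: UI_eq VI_eq vcol_first_cols[OF Uc r1] vcol_first_cols[OF Vc r2] Ub_props(3) Vb_props(3) u0_def v0_def)
  have EEE: "\<E> = calE"
    unfolding calE_eq TT by (rule set_E_eq[OF Ub_props(1) _ Vb_props(1)]) (simp_all add: u_def v_def)
  have CC: "\<C> = calC" unfolding calC_eq TT EE[symmetric] by (rule set_C_eq)
  define L where "L = Ker \<Phi> \<inter> calE"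
  have L: "subspace L"
  proof -
    have "Ker \<Phi> = \<Phi> -` {0}" by (auto simp: Ker_def)
    then have "subspace (Ker \<Phi>)" using linear_subspace_vimage[OF lin, of "{0}"] by (simp add: subspace_single_0)
    then show ?thesis unfolding L_def using subspace_calE by (rule subspace_inter)
  qed
  have YL: "Ybar \<bullet> W = 0" if "W \<in> L" for W
    using that adjoint_works[OF lin, of W "grad_h (\<Phi> Xb)"] by (simp add: YbY Yb_eq L_def Ker_def inner_commute)
  let ?source = "\<exists>N. PN N = N \<and> (\<exists>\<rho><1. \<forall>x. norm (N *v x) \<le> \<rho> * norm x) \<and> (\<forall>W\<in>L. (Emat + N) \<bullet> W = 0)"
  have i_ii: "strong_solution (objective \<Phi> h \<mu>) Xb \<longleftrightarrow> L \<inter> calC = {0}"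
    unfolding L_def XbX[symmetric]
    by (rule strong_solution_iff[OF lin mu h_convex h_C2]) (use h_pos_def Xb_int Yb_eq YbY XbX in auto)
  have SRI: "strong_restricted_injectivity \<Phi> \<E> T \<longleftrightarrow> (\<forall>W\<in>L. PN W = 0 \<longrightarrow> W = 0)"
    unfolding strong_restricted_injectivity_def EEE TT L_def[symmetric] using subspace_0[OF L] by auto
  have ii_iii: "L \<inter> calC = {0} \<longleftrightarrow> strong_restricted_injectivity \<Phi> \<E> T \<and> ?source"
    unfolding SRI by (rule source_condition_iff[OF L YL])
  have PN_fixed: "PN N = N \<longleftrightarrow>
      (\<exists>z. N = (\<Sum>k<?n1 - r. \<Sum>l<?n2 - r. z k l *\<^sub>R outer (u0 (r + k)) (v0 (r + l))))" for N
    by (rule PN_fixed_iff[OF u0 _ v0]) (simp_all add: Ub_props(3) Vb_props(3))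
  have PN_Nm: "PN (Nm Z) = Nm Z" if "Z \<in> ?Zc" for Z
    unfolding PN_fixed by (rule exI[of _ "\<lambda>k l. Z $$ (k, l)"]) (rule Nm_sum[OF that])
  have Nm_surj: "\<exists>Z\<in>?Zc. N = Nm Z" if PNN: "PN N = N" for N
  proof -
    obtain z where z: "N = (\<Sum>k<?n1 - r. \<Sum>l<?n2 - r. z k l *\<^sub>R outer (u0 (r + k)) (v0 (r + l)))"
      using PNN unfolding PN_fixed by blast
    define Z where "Z = Matrix.mat (?n1 - r) (?n2 - r) (\<lambda>(k, l). z k l)"
    have Zc: "Z \<in> ?Zc" by (simp add: Z_def)
    moreover have "N = Nm Z" unfolding Nm_sum[OF Zc] z by (intro sum.cong refl) (simp add: Z_def)
    ultimately show ?thesis by blast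
  qed
  have Nm_norm: "(\<exists>\<rho><1. \<forall>x. norm (Nm Z *v x) \<le> \<rho> * norm x) \<longleftrightarrow> spectral_norm Z < 1" if Z: "Z \<in> ?Zc" for Z
  proof
    assume "\<exists>\<rho><1. \<forall>x. norm (Nm Z *v x) \<le> \<rho> * norm x"
    then obtain \<rho> where \<rho>: "\<rho> < 1" "\<And>x. norm (Nm Z *v x) \<le> \<rho> * norm x" by blast
    \<comment> \<open>Passing to the positive part of \<open>\<rho>\<close> supplies the
      nonnegativity that \<open>Nm_ge\<close> requires.\<close>
    have "norm (Nm Z *v x) \<le> max \<rho> 0 * norm x" for x
      using \<rho>(2)[of x] mult_right_mono[of \<rho> "max \<rho> 0" "norm x"] by simp
    then have "spectral_norm Z \<le> max \<rho> 0" by (rule Nm_ge[OF Z]) simp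
    then show "spectral_norm Z < 1" using \<rho>(1) by simp
  qed (use Nm_le[OF Z] in blast)
  have source_Nm: "?source \<longleftrightarrow> (\<exists>Z\<in>?Zc. spectral_norm Z < 1 \<and> (\<forall>W\<in>L. (E + Nm Z) \<bullet> W = 0))"
  proof
    assume ?source
    then obtain N where N: "PN N = N" "\<exists>\<rho><1. \<forall>x. norm (N *v x) \<le> \<rho> * norm x" "\<forall>W\<in>L. (Emat + N) \<bullet> W = 0" by blast
    obtain Z where Z: "Z \<in> ?Zc" "N = Nm Z" using Nm_surj[OF N(1)] by blast
    have "spectral_norm Z < 1" by (rule iffD1[OF Nm_norm[OF Z(1)] N(2)[unfolded Z(2)]])
    then show "\<exists>Z\<in>?Zc. spectral_norm Z < 1 \<and> (\<forall>W\<in>L. (E + Nm Z) \<bullet> W = 0)"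
      using Z(1) N(3)[unfolded EE Z(2)] by blast
  next
    assume "\<exists>Z\<in>?Zc. spectral_norm Z < 1 \<and> (\<forall>W\<in>L. (E + Nm Z) \<bullet> W = 0)"
    then obtain Z where Z: "Z \<in> ?Zc" "spectral_norm Z < 1" "\<forall>W\<in>L. (E + Nm Z) \<bullet> W = 0" by blast
    show ?source
      unfolding EE by (intro exI[of _ "Nm Z"] conjI PN_Nm[OF Z(1)] iffD2[OF Nm_norm[OF Z(1)]] Z(2,3))
  qed
  have comp: "X \<in> {a + b | a b. a \<in> range (adjoint \<Phi>) \<and> b \<in> calE\<^sup>\<bottom>} \<longleftrightarrow> (\<forall>W\<in>L. X \<bullet> W = 0)" for X
    unfolding orthogonal_comp_Ker_Int[OF lin subspace_calE, symmetric] L_def[symmetric]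
    by (simp add: orthogonal_comp_def real_inner_class.orthogonal_def inner_commute)
  have SNSC: "strong_nondegenerate_source \<Phi> \<E> r U V \<longleftrightarrow> ?source"
  proof -
    have "strong_nondegenerate_source \<Phi> \<E> r U V \<longleftrightarrow>
        (\<exists>Z\<in>?Zc. of_mat (U * id_block r Z * V\<^sup>T) \<in> {a + b | a b. a \<in> range (adjoint \<Phi>) \<and> b \<in> calE\<^sup>\<bottom>} \<and>
          spectral_norm Z < 1)"
    proof -
      have "(\<exists>Y\<in>Q. \<exists>Z\<in>A. Y = F Z \<and> P Z) \<longleftrightarrow> (\<exists>Z\<in>A. F Z \<in> Q \<and> P Z)"
        for Q :: "('n1, 'n2) rmatrix set" and A :: "real mat set" and F P by blast
      then show ?thesis unfolding strong_nondegenerate_source_def EEE .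
    qed
    also have "\<dots> \<longleftrightarrow> (\<exists>Z\<in>?Zc. spectral_norm Z < 1 \<and> (\<forall>W\<in>L. (E + Nm Z) \<bullet> W = 0))"
      unfolding comp using id_block by (intro bex_cong refl) auto
    finally show ?thesis unfolding source_Nm .
  qed
  have zeta: "zeta M E r UJ VK < 1 \<longleftrightarrow> ?source"
    if M: "linear M" "range (adjoint M) = Ker \<Phi> \<inter> \<E>" for M :: "('n1, 'n2) rmatrix \<Rightarrow> 'q"
  proof -
    \<comment> \<open>The range of \<open>adjoint M\<close> is \<open>L\<close>, so feasibility of
      \<open>Z\<close> means that \<open>E + Nm Z\<close> is orthogonal to \<open>L\<close>, the
      same condition as in \<open>?source\<close>.\<close>
    have feas: "M (Nm Z) = - M E \<longleftrightarrow> (\<forall>W\<in>L. (E + Nm Z) \<bullet> W = 0)" for Z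
    proof -
      have "M (Nm Z) = - M E \<longleftrightarrow> M (E + Nm Z) = 0"
        unfolding linear_add[OF M(1)] by (simp add: eq_neg_iff_add_eq_0 add.commute)
      also have "\<dots> \<longleftrightarrow> (\<forall>q. M (E + Nm Z) \<bullet> q = 0)" using vector_eq_rdot[of "M (E + Nm Z)" 0] by simp
      also have "\<dots> \<longleftrightarrow> (\<forall>q. (E + Nm Z) \<bullet> adjoint M q = 0)" by (simp add: adjoint_works[OF M(1)])
      also have "\<dots> \<longleftrightarrow> (\<forall>W\<in>L. (E + Nm Z) \<bullet> W = 0)"
        unfolding L_def EEE[symmetric] M(2)[symmetric] by auto
      finally show ?thesis .
    qed
    \<comment> \<open>An infimum below 1 is witnessed by a feasible matrix of norm below 1, so
      attainment of the optimal value is not at issue; an empty feasible set gives infinity.\<close>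
    have "zeta M E r UJ VK < 1 \<longleftrightarrow> (\<exists>Z\<in>?Zc. M (Nm Z) = - M E \<and> spectral_norm Z < 1)"
      unfolding zeta_def INF_less_iff Nm_def by (auto simp: one_ereal_def)
    then show ?thesis unfolding source_Nm feas by blast
  qed
  have "Ker \<Phi> \<inter> \<E> \<inter> \<C> = L \<inter> calC" by (simp add: L_def EEE CC)
  then show ?thesis using i_ii ii_iii SNSC zeta by simp
qed

end
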